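(* Consider the linear bandit problem with changing arm set described in the context. Let $\delta\in(0,1)$ and let $\eta(T)\in(0,1)$ be the parameter controlling the approximate MIPS accuracy. With probability at least $1-\delta$, the regret of the Sublinear Time Thompson Sampling algorithm (described in the context) is bounded by $$\begin{aligned}R(T)\le{}&\frac{4\gamma(\delta/4T)}{p}\left(\sqrt{2Td\log\left(1+\tfrac{T}{d}\right)}+\sqrt{8T\log\tfrac4\delta}\right)\\&+\big(\gamma(\delta/4T)+\beta(\delta/4T)\big)\sqrt{2Td\log\left(1+\tfrac Td\right)}\\&+\frac{6\big(1+\gamma(\delta/4T)+\beta(\delta/4T)\big)}{p}\cdot\frac{\eta(T)}{d}\cdot T,\end{aligned}$$ where $\beta(\delta/4T)=1+\sqrt{2\log\frac{4T}{\delta}+d\log\left(1+\frac Td\right)}$, $\gamma(\delta/4T)=\beta(\delta/4T)\sqrt{bd\log\frac{b'd}{\delta/4T}}$, and $b,b',p$ are the constants of the sampling distribution $\mathcal{D}^{TS}$. The per-step time complexity is $K^{1-\Theta(\eta(T)^2)+o(\log^{-0.45}K)}$. The time complexity of the data structure initialization (adding all initial arms to all MIPS solvers), paid once, is $K^{1+o(1)}$.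
   Context: Linear bandit setting. $\mathcal{A}$ is the set of arms; arm $a$ has feature vector $x_a\in\mathbb{R}^d$. At each time step $t\in\{1,\dots,T\}$ at most $C_{change}$ arms ($C_{change}$ a constant) are added to or deleted from $\mathcal{A}$. $K$ is the maximum size of $\mathcal{A}$. The learner plays $a_t\in\mathcal{A}$ and observes reward $r_t$. Assumptions: (i) there is $\theta^*\in\mathbb{R}^d$ with $r_t=\langle\theta^*,x_{a_t}\rangle+\eta_t$, $\eta_t$ a mean-zero noise; (ii) $\mathbb{E}[\exp(\alpha\eta_t)\mid\mathcal{F}_{t-1}]\le\exp(\alpha^2/2)$ for all $\alpha\in\mathbb{R}$, $t\in[T]$, where $\mathcal{F}_{t-1}=\sigma(a_1,r_1,\dots,a_{t-1},r_{t-1},a_t)$; (iii) $\|\theta^*\|_2\le1$ and $\|x_a\|_2\le1$ for all $a$; (iv) the largest expected reward $\max_{a\in\mathcal{A}}x_a^\top\theta^*$ is non-negative. The regret is $R(T)=\sum_{t=1}^T(x_{a_t^*}^\top\theta^*-x_{a_t}^\top\theta^* )$, where $a_t^*=\arg\max_{a\in\mathcal{A}}x_a^\top\theta^*$ is the optimal arm at step $t$. The regime is $K$ extremely large, $d=K^{o(1)}$, $T$ moderate (e.g. $T=\Theta(\log^\gamma K)$ for a constant $\gamma$); $o(\cdot)$ is as $K\to\infty$. Sampling distribution. $\mathcal{D}^{TS}$ is a distribution on $\mathbb{R}^d$, absolutely continuous with respect to Lebesgue measure, such that: (anti-concentration) there is $p>0$ with $\mathbb{P}_{\xi\sim\mathcal{D}^{TS}}(u^\top\xi\ge1)\ge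 p$ for every $u\in\mathbb{R}^d$ with $\|u\|_2=1$; (concentration) there are positive constants $b,b'$ with $\mathbb{P}_{\xi\sim\mathcal{D}^{TS}}\left(\|\xi\|\le\sqrt{bd\log\frac{b'd}{\delta'}}\right)\ge1-\delta'$ for all $\delta'\in(0,1)$. Adaptive MIPS solver. The $(c,r,\epsilon)$-MIPS problem for a finite set $P$ in the unit ball of $\mathbb{R}^d$ and a query $q$ with $\|q\|_2\le1$: find $p\in P$ with $\langle q,p\rangle\ge cr-\epsilon$ if there is $p^*\in P$ with $\langle q,p^*\rangle\ge r+\epsilon$. A single-query solver $\mathcal{S}(c,r,0)$ for $|P|=K$ (adapted from Andoni et al. 2017) solves $(c,r,0)$-MIPS for any given query with probability at least $0.9$, with preprocessing time $K^{1+o(1)}$, time $K^{o(1)}$ to add a point (deletions are likewise supported efficiently), query time $K^{\rho_q+o(\log^{-0.45}K)}$, $\rho_q=\frac{4c'^2}{(1+c'^2)^2}$, $c'=\sqrt{\frac{3-cr}{3-r}}$. The adaptive solver $\mathcal{M}(c,r,\epsilon,\delta')$ keeps $\kappa=d\log(Kd/(\epsilon\delta'))$ independent copies of $\mathcal{S}(c,r,0)$; adding a point adds it to all copies; a query $q$ is rounded to the nearest point $\widehat q$ with all coordinates multiples of $\epsilon/d$, all copies are queried with $\widehat q$, and any point returned by any copy is returned (null if none). Sublinear Time Thompson Sampling algorithm. Input: $\mathcal{A}$, $T$, $\delta$, $\eta(T)$. Set $V_1=I$, $\widehat\theta_1=0$. For $i=1,\dots,\lceil d/\eta(T)\rceil$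 build an independent adaptive MIPS solver $\mathcal{M}_i$ with parameters $\left(1-\frac1{i+1},\frac{i\,\eta(T)}{d},\frac{\eta(T)}{d},\frac{\delta\,\eta(T)}{2d}\right)$ on the points $x_a$, $a\in\mathcal{A}$. For $t=1,\dots,T$: add/delete the changing arms in all $\mathcal{M}_i$; sample $\xi_t\sim\mathcal{D}^{TS}$; put $\widetilde\theta_t=\widehat\theta_t+\beta(\delta/4T)V_t^{-1/2}\xi_t$; query the solvers $\mathcal{M}_i$ with $\widetilde\theta_t/\|\widetilde\theta_t\|$ and let $a_t$ be the non-null result with the largest index $i$ (found by binary search over $i$); play $a_t$, observe $r_t$; set $V_{t+1}=V_t+x_{a_t}x_{a_t}^\top$ and $\widehat\theta_{t+1}=(X_{1:t}^\top X_{1:t}+I)^{-1}X_{1:t}^\top Y_{1:t}$, where $X_{1:t}$ has rows $x_{a_1}^\top,\dots,x_{a_t}^\top$ and $Y_{1:t}=(r_1,\dots,r_t)$.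
   Formalization: If all solvers return null, the exact maximiser is played (scan cost extra); queries round within the unit ball; non-null answers are verified; 1/η(T)=K^{o(1)}; per-step exponent 1-Θ(η²) holds for bounded d, in general d·K^{1-Θ((η/d)²)+o(log^{-0.45}K)}. *)

theory Defs
  imports
    "HOL-Probability.Probability"
    "HOL-Library.Landau_Symbols"
    "Jordan_Normal_Form.Gauss_Jordan_Elimination"
begin

(* The dimension is a number that varies with the number of arms, so vectors and matrices are those
   of Jordan_Normal_Form, with explicit carriers. *)

unbundle no vec_syntax
unbundle no inner_syntax
hide_type (open) Finite_Cartesian_Product.vec
hide_const (open) Finite_Cartesian_Product.vec Finite_Cartesian_Product.mat
  Finite_Cartesian_Product.row Finite_Cartesian_Product.rows

section \<open>Vectors, matrices and distributions in dimension \<open>d\<close>\<close>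

definition vnorm :: "real vec \<Rightarrow> real" where
  "vnorm v = sqrt (scalar_prod v v)"

definition unit_ball :: "nat \<Rightarrow> real vec set" where
  "unit_ball d = {v \<in> carrier_vec d. vnorm v \<le> 1}"

definition outer_square :: "real vec \<Rightarrow> real mat" where
  "outer_square v = mat (dim_vec v) (dim_vec v) (\<lambda>(i, j). vec_index v i * vec_index v j)"

definition mat_inv :: "real mat \<Rightarrow> real mat" where
  "mat_inv A = the (mat_inverse A)"

definition pos_def :: "nat \<Rightarrow> real mat \<Rightarrow> bool" where
  "pos_def d A \<longleftrightarrow> A \<in> carrier_mat d d \<and> transpose_mat A = A \<and>
     (\<forall>v \<in> carrier_vec d. v \<noteq> 0\<^sub>v d \<longrightarrow> scalar_prod v (A *\<^sub>v v) > 0)"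

(* A to the power -1/2, for a positive definite A: the positive definite square root of its inverse *)
definition inv_sqrt_mat :: "nat \<Rightarrow> real mat \<Rightarrow> real mat" where
  "inv_sqrt_mat d A = (THE B. pos_def d B \<and> B * B = mat_inv A)"

(* Borel sets and Lebesgue measure of R^d, transported along the coordinates from the product of
   d copies of the real line *)
definition borel_vec :: "nat \<Rightarrow> real vec measure" where
  "borel_vec d = vimage_algebra (carrier_vec d) (\<lambda>v. \<lambda>i\<in>{..<d}. vec_index v i)
     (Pi\<^sub>M {..<d} (\<lambda>_. borel))"

definition lborel_vec :: "nat \<Rightarrow> real vec measure" where
  "lborel_vec d = distr (Pi\<^sub>M {..<d} (\<lambda>_. lborel)) (borel_vec d) (Matrix.vec d)"

definition sampling_distribution ::
    "nat \<Rightarrow> real \<Rightarrow> real \<Rightarrow> real \<Rightarrow> real vec measure \<Rightarrow> bool" where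
  "sampling_distribution d p b b' D \<longleftrightarrow>
     prob_space D \<and> sets D = sets (borel_vec d) \<and> absolutely_continuous (lborel_vec d) D \<and>
     (\<forall>u \<in> carrier_vec d. vnorm u = 1 \<longrightarrow>
        measure D {\<xi> \<in> space D. scalar_prod u \<xi> \<ge> 1} \<ge> p) \<and>
     (\<forall>\<delta>'. 0 < \<delta>' \<and> \<delta>' < 1 \<longrightarrow>
        measure D {\<xi> \<in> space D. vnorm \<xi> \<le> sqrt (b * d * ln (b' * d / \<delta>'))} \<ge> 1 - \<delta>')"


section \<open>Maximum inner product search\<close>

(* ans is a correct answer to the (c,r,eps)-MIPS problem for the points P and the query q;
   if no point reaches r + eps, the problem asks for nothing *)
definition solves_mips ::
    "real \<Rightarrow> real \<Rightarrow> real \<Rightarrow> real vec set \<Rightarrow> real vec \<Rightarrow> real vec option \<Rightarrow> bool" where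
  "solves_mips c r \<epsilon> P q ans \<longleftrightarrow>
     ((\<exists>p' \<in> P. scalar_prod q p' \<ge> r + \<epsilon>) \<longrightarrow>
      (\<exists>p \<in> P. ans = Some p \<and> scalar_prod q p \<ge> c * r - \<epsilon>))"

datatype change = Add "real vec" | Delete "real vec"

fun apply_change :: "change \<Rightarrow> real vec set \<Rightarrow> real vec set" where
  "apply_change (Add p) P = insert p P"
| "apply_change (Delete p) P = P - {p}"

definition contents :: "real vec set \<Rightarrow> change list \<Rightarrow> real vec set" where
  "contents P us = fold apply_change us P"

definition admissible :: "nat \<Rightarrow> nat \<Rightarrow> real vec set \<Rightarrow> change list \<Rightarrow> bool" where
  "admissible d K P us \<longleftrightarrow>
     (\<forall>k \<le> length us. finite (contents P (take k us)) \<and> card (contents P (take k us)) \<le> K \<and>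
        contents P (take k us) \<subseteq> unit_ball d)"

(* A data structure whose internal randomness is drawn once, from seed_space, when it is built.
   The last three fields are the running times of the three operations. *)
record ('s, 'st) solver =
  seed_space :: "'s measure"
  build :: "'s \<Rightarrow> real vec set \<Rightarrow> 'st"
  modify :: "change \<Rightarrow> 'st \<Rightarrow> 'st"
  lookup :: "'st \<Rightarrow> real vec \<Rightarrow> real vec option"
  build_time :: "'s \<Rightarrow> real vec set \<Rightarrow> real"
  modify_time :: "change \<Rightarrow> 'st \<Rightarrow> real"
  lookup_time :: "'st \<Rightarrow> real vec \<Rightarrow> real"

definition state_after ::
    "('s, 'st) solver \<Rightarrow> 's \<Rightarrow> real vec set \<Rightarrow> change list \<Rightarrow> 'st" where
  "state_after S s P us = fold (modify S) us (build S s P)"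

(* The guarantee S(c,r,0) for at most K points: for point sets and a query that do not depend on the
   seed, the answer is correct with probability at least 0.9.  As usual for such data structures a
   candidate is verified before it is returned, so an answer other than None is always a stored point
   with inner product at least c * r. *)
definition single_query_solver ::
    "nat \<Rightarrow> nat \<Rightarrow> real \<Rightarrow> real \<Rightarrow> ('s, 'st) solver \<Rightarrow> bool" where
  "single_query_solver d K c r S \<longleftrightarrow>
     prob_space (seed_space S) \<and>
     (\<forall>P us q. admissible d K P us \<and> q \<in> unit_ball d \<longrightarrow>
        measure (seed_space S) {s \<in> space (seed_space S).
            solves_mips c r 0 (contents P us) q (lookup S (state_after S s P us) q)} \<ge> 9 / 10 \<and>
        (\<forall>s \<in> space (seed_space S). \<forall>p. lookup S (state_after S s P us) q = Some p \<longrightarrow>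
            p \<in> contents P us \<and> scalar_prod q p \<ge> c * r))"

definition runs_within ::
    "nat \<Rightarrow> nat \<Rightarrow> real \<Rightarrow> real \<Rightarrow> real \<Rightarrow> ('s, 'st) solver \<Rightarrow> bool" where
  "runs_within d K tb tm tq S \<longleftrightarrow>
     (\<forall>s \<in> space (seed_space S). \<forall>P us. admissible d K P us \<longrightarrow>
        build_time S s P \<le> tb \<and>
        (\<forall>u. admissible d K P (us @ [u]) \<longrightarrow> modify_time S u (state_after S s P us) \<le> tm) \<and>
        (\<forall>q \<in> unit_ball d. lookup_time S (state_after S s P us) q \<le> tq))"

definition c_prime :: "real \<Rightarrow> real \<Rightarrow> real" where
  "c_prime c r = sqrt ((3 - c * r) / (3 - r))"

definition rho_q :: "real \<Rightarrow> real \<Rightarrow> real" where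
  "rho_q c r = 4 * (c_prime c r)\<^sup>2 / (1 + (c_prime c r)\<^sup>2)\<^sup>2"

fun modify_times :: "('s, 'st) solver \<Rightarrow> change list \<Rightarrow> 'st \<Rightarrow> real" where
  "modify_times S [] st = 0"
| "modify_times S (u # us) st = modify_time S u st + modify_times S us (modify S u st)"

subsection \<open>The adaptive solver\<close>

definition num_copies :: "nat \<Rightarrow> nat \<Rightarrow> real \<Rightarrow> real \<Rightarrow> nat" where
  "num_copies d K \<epsilon> \<delta>' = nat \<lceil>real d * ln (real K * real d / (\<epsilon> * \<delta>'))\<rceil>"

(* Queries of a MIPS problem lie in the unit ball, so only the grid points in the unit ball are
   candidates; the unrestricted nearest grid point can be longer than 1. *)
definition grid :: "nat \<Rightarrow> real \<Rightarrow> real vec set" where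
  "grid d \<epsilon> = {z \<in> unit_ball d. \<forall>i < d. \<exists>k :: int. vec_index z i = of_int k * (\<epsilon> / d)}"

definition round_query :: "nat \<Rightarrow> real \<Rightarrow> real vec \<Rightarrow> real vec" where
  "round_query d \<epsilon> q = arg_min_on (\<lambda>z. vnorm (q - z)) (grid d \<epsilon>)"

definition adaptive_lookup ::
    "nat \<Rightarrow> real \<Rightarrow> ('s, 'st) solver \<Rightarrow> 'st list \<Rightarrow> real vec \<Rightarrow> real vec option" where
  "adaptive_lookup d \<epsilon> S sts q =
     (case filter (\<lambda>ans. ans \<noteq> None) (map (\<lambda>st. lookup S st (round_query d \<epsilon> q)) sts) of
        [] \<Rightarrow> None | ans # _ \<Rightarrow> ans)"

definition adaptive_lookup_time ::
    "nat \<Rightarrow> real \<Rightarrow> ('s, 'st) solver \<Rightarrow> 'st list \<Rightarrow> real vec \<Rightarrow> real" where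
  "adaptive_lookup_time d \<epsilon> S sts q = (\<Sum>st\<leftarrow>sts. lookup_time S st (round_query d \<epsilon> q))"

subsection \<open>Binary search\<close>

(* Invariant: P lo holds or lo is the initial lower end, P hi fails or hi is the initial upper end.
   The result is the largest index satisfying P whenever P is downward closed. *)
function binary_search :: "(nat \<Rightarrow> bool) \<Rightarrow> nat \<Rightarrow> nat \<Rightarrow> nat" where
  "binary_search P lo hi =
     (if hi \<le> Suc lo then lo
      else let m = (lo + hi) div 2 in
        if P m then binary_search P m hi else binary_search P lo m)"
  by pat_completeness auto
termination by (relation "Wellfounded.measure (\<lambda>(P, lo, hi). hi - lo)") auto

function probes :: "(nat \<Rightarrow> bool) \<Rightarrow> nat \<Rightarrow> nat \<Rightarrow> nat list" where
  "probes P lo hi =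
     (if hi \<le> Suc lo then []
      else let m = (lo + hi) div 2 in
        m # (if P m then probes P m hi else probes P lo m))"
  by pat_completeness auto
termination by (relation "Wellfounded.measure (\<lambda>(P, lo, hi). hi - lo)") auto

declare binary_search.simps [simp del] probes.simps [simp del]


section \<open>The bandit problem and the algorithm\<close>

(* arms t is the arm set in round t >= 1, after the changes of that round; arms 0 is the initial one.
   The arm sets and the features are not random.  solver_for c r is the single-query solver S(c,r,0),
   copy_seed i j the seed of its j-th copy in the i-th adaptive solver. *)
record ('w, 'a, 's, 'st) bandit_run =
  prob :: "'w measure"
  dim :: nat
  size_bound :: nat
  horizon :: nat
  confidence :: real
  accuracy :: real
  arms :: "nat \<Rightarrow> 'a set"
  feature :: "'a \<Rightarrow> real vec"
  theta_star :: "real vec"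
  noise :: "nat \<Rightarrow> 'w \<Rightarrow> real"
  solver_for :: "real \<Rightarrow> real \<Rightarrow> ('s, 'st) solver"
  copy_seed :: "nat \<Rightarrow> nat \<Rightarrow> 'w \<Rightarrow> 's"
  xi :: "nat \<Rightarrow> 'w \<Rightarrow> real vec"
  play :: "nat \<Rightarrow> 'w \<Rightarrow> 'a"

definition reward :: "('w, 'a, 's, 'st) bandit_run \<Rightarrow> nat \<Rightarrow> 'w \<Rightarrow> real" where
  "reward B t \<omega> = scalar_prod (theta_star B) (feature B (play B t \<omega>)) + noise B t \<omega>"

definition optimal_arm :: "('w, 'a, 's, 'st) bandit_run \<Rightarrow> nat \<Rightarrow> 'a" where
  "optimal_arm B t = arg_max_on (\<lambda>a. scalar_prod (feature B a) (theta_star B)) (arms B t)"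

definition regret :: "('w, 'a, 's, 'st) bandit_run \<Rightarrow> 'w \<Rightarrow> real" where
  "regret B \<omega> = (\<Sum>t = 1..horizon B.
     scalar_prod (feature B (optimal_arm B t)) (theta_star B)
     - scalar_prod (feature B (play B t \<omega>)) (theta_star B))"

definition events :: "'w measure \<Rightarrow> ('w \<Rightarrow> 'b) \<Rightarrow> 'b measure \<Rightarrow> 'w set set" where
  "events M X N = {X -` A \<inter> space M | A. A \<in> sets N}"

(* sigma(a_1, r_1, ..., a_(t-1), r_(t-1), a_t) *)
definition history :: "('w, 'a, 's, 'st) bandit_run \<Rightarrow> nat \<Rightarrow> 'w measure" where
  "history B t = sigma (space (prob B))
     ((\<Union>s \<in> {1..t}. events (prob B) (play B s) (count_space UNIV)) \<union>
      (\<Union>s \<in> {1..<t}. events (prob B) (reward B s) borel))"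

(* nn_cond_exp rather than real_cond_exp: the latter is 0 where the conditional expectation is
   infinite. *)
definition linear_bandit :: "nat \<Rightarrow> ('w, 'a, 's, 'st) bandit_run \<Rightarrow> bool" where
  "linear_bandit C_change B \<longleftrightarrow>
     prob_space (prob B) \<and> dim B \<ge> 1 \<and> horizon B \<ge> 1 \<and>
     (\<forall>t \<le> horizon B. finite (arms B t) \<and> arms B t \<noteq> {} \<and> card (arms B t) \<le> size_bound B) \<and>
     (\<forall>t \<in> {1..horizon B}.
        card (arms B t - arms B (t - 1)) + card (arms B (t - 1) - arms B t) \<le> C_change) \<and>
     (\<forall>t \<le> horizon B. feature B ` arms B t \<subseteq> unit_ball (dim B)) \<and>
     theta_star B \<in> unit_ball (dim B) \<and>
     (\<forall>t \<in> {1..horizon B}.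
        scalar_prod (feature B (optimal_arm B t)) (theta_star B) \<ge> 0 \<and>
        play B t \<in> measurable (prob B) (count_space UNIV) \<and>
        (\<forall>\<omega> \<in> space (prob B). play B t \<omega> \<in> arms B t) \<and>
        integrable (prob B) (noise B t) \<and> (\<integral>\<omega>. noise B t \<omega> \<partial>prob B) = 0 \<and>
        (\<forall>\<alpha>. AE \<omega> in prob B.
           nn_cond_exp (prob B) (history B t) (\<lambda>\<omega>. ennreal (exp (\<alpha> * noise B t \<omega>))) \<omega>
             \<le> ennreal (exp (\<alpha>\<^sup>2 / 2))))"

definition beta :: "nat \<Rightarrow> nat \<Rightarrow> real \<Rightarrow> real" where
  "beta d T \<delta>' = 1 + sqrt (2 * ln (1 / \<delta>') + d * ln (1 + T / d))"

definition gamma :: "nat \<Rightarrow> nat \<Rightarrow> real \<Rightarrow> real \<Rightarrow> real \<Rightarrow> real" where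
  "gamma d T b b' \<delta>' = beta d T \<delta>' * sqrt (b * d * ln (b' * d / \<delta>'))"

subsection \<open>Least squares and sampling\<close>

(* design_matrix B \<omega> n is V_(n+1), and least_squares B \<omega> n the estimate after n rounds *)
primrec design_matrix :: "('w, 'a, 's, 'st) bandit_run \<Rightarrow> 'w \<Rightarrow> nat \<Rightarrow> real mat" where
  "design_matrix B \<omega> 0 = 1\<^sub>m (dim B)"
| "design_matrix B \<omega> (Suc n) =
     design_matrix B \<omega> n + outer_square (feature B (play B (Suc n) \<omega>))"

definition least_squares :: "('w, 'a, 's, 'st) bandit_run \<Rightarrow> 'w \<Rightarrow> nat \<Rightarrow> real vec" where
  "least_squares B \<omega> n =
     (if n = 0 then 0\<^sub>v (dim B)
      else let X = mat_of_rows (dim B) (map (\<lambda>s. feature B (play B s \<omega>)) [1..<Suc n]);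
               Y = vec_of_list (map (\<lambda>s. reward B s \<omega>) [1..<Suc n])
           in mat_inv (transpose_mat X * X + 1\<^sub>m (dim B)) *\<^sub>v (transpose_mat X *\<^sub>v Y))"

definition sampled_theta :: "('w, 'a, 's, 'st) bandit_run \<Rightarrow> nat \<Rightarrow> 'w \<Rightarrow> real vec" where
  "sampled_theta B t \<omega> =
     least_squares B \<omega> (t - 1) +
     beta (dim B) (horizon B) (confidence B / (4 * horizon B)) \<cdot>\<^sub>v
       (inv_sqrt_mat (dim B) (design_matrix B \<omega> (t - 1)) *\<^sub>v xi B t \<omega>)"

subsection \<open>The MIPS solvers of the algorithm\<close>

definition num_solvers :: "('w, 'a, 's, 'st) bandit_run \<Rightarrow> nat" where
  "num_solvers B = nat \<lceil>real (dim B) / accuracy B\<rceil>"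

definition mips_c :: "nat \<Rightarrow> real" where
  "mips_c i = 1 - 1 / (i + 1)"

definition mips_r :: "('w, 'a, 's, 'st) bandit_run \<Rightarrow> nat \<Rightarrow> real" where
  "mips_r B i = i * accuracy B / dim B"

definition mips_eps :: "('w, 'a, 's, 'st) bandit_run \<Rightarrow> real" where
  "mips_eps B = accuracy B / dim B"

definition mips_delta :: "('w, 'a, 's, 'st) bandit_run \<Rightarrow> real" where
  "mips_delta B = confidence B * accuracy B / (2 * dim B)"

definition solver_of :: "('w, 'a, 's, 'st) bandit_run \<Rightarrow> nat \<Rightarrow> ('s, 'st) solver" where
  "solver_of B i = solver_for B (mips_c i) (mips_r B i)"

definition copies :: "('w, 'a, 's, 'st) bandit_run \<Rightarrow> nat" where
  "copies B = num_copies (dim B) (size_bound B) (mips_eps B) (mips_delta B)"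

definition points :: "('w, 'a, 's, 'st) bandit_run \<Rightarrow> nat \<Rightarrow> real vec set" where
  "points B t = feature B ` arms B t"

definition list_of :: "'b set \<Rightarrow> 'b list" where
  "list_of X = (SOME xs. distinct xs \<and> set xs = X)"

definition changes :: "('w, 'a, 's, 'st) bandit_run \<Rightarrow> nat \<Rightarrow> change list" where
  "changes B t = map Delete (list_of (points B (t - 1) - points B t))
     @ map Add (list_of (points B t - points B (t - 1)))"

definition copy_states :: "('w, 'a, 's, 'st) bandit_run \<Rightarrow> nat \<Rightarrow> nat \<Rightarrow> 'w \<Rightarrow> 'st list" where
  "copy_states B i t \<omega> =
     map (\<lambda>j. state_after (solver_of B i) (copy_seed B i j \<omega>) (points B 0)
                (concat (map (changes B) [1..<Suc t])))
       [0..<copies B]"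

definition mips_query :: "('w, 'a, 's, 'st) bandit_run \<Rightarrow> nat \<Rightarrow> 'w \<Rightarrow> real vec" where
  "mips_query B t \<omega> = (1 / vnorm (sampled_theta B t \<omega>)) \<cdot>\<^sub>v sampled_theta B t \<omega>"

definition mips_answer :: "('w, 'a, 's, 'st) bandit_run \<Rightarrow> nat \<Rightarrow> 'w \<Rightarrow> nat \<Rightarrow> real vec option" where
  "mips_answer B t \<omega> i =
     adaptive_lookup (dim B) (mips_eps B) (solver_of B i) (copy_states B i t \<omega>) (mips_query B t \<omega>)"

(* binary search over the indices 1, ..., num_solvers B; None if it ends without a non-null answer *)
definition search_result :: "('w, 'a, 's, 'st) bandit_run \<Rightarrow> nat \<Rightarrow> 'w \<Rightarrow> real vec option" where
  "search_result B t \<omega> =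
     (let i = binary_search (\<lambda>i. mips_answer B t \<omega> i \<noteq> None) 0 (num_solvers B + 1)
      in if i = 0 then None else mips_answer B t \<omega> i)"

(* Everything drawn or observed before xi_t is sampled: the seeds of all solvers and the earlier
   samples, plays and rewards. *)
definition past :: "('w, 'a, 's, 'st) bandit_run \<Rightarrow> nat \<Rightarrow> 'w set set" where
  "past B t = sigma_sets (space (prob B))
     ((\<Union>i \<in> {1..num_solvers B}. \<Union>j \<in> {..<copies B}.
         events (prob B) (copy_seed B i j) (seed_space (solver_of B i))) \<union>
      (\<Union>s \<in> {1..<t}. events (prob B) (xi B s) (borel_vec (dim B)) \<union>
         events (prob B) (play B s) (count_space UNIV) \<union> events (prob B) (reward B s) borel))"

(* If the search is null, it yields no arm to play; in such a round the exact maximiser of the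
   sampled reward is played, found by a scan of the arms (see scan_time). *)
definition thompson_sampling_run :: "real vec measure \<Rightarrow> ('w, 'a, 's, 'st) bandit_run \<Rightarrow> bool" where
  "thompson_sampling_run D B \<longleftrightarrow>
     (\<forall>c r. 0 < c \<and> c < 1 \<and> 0 < r \<and> r < 2 \<longrightarrow>
        single_query_solver (dim B) (size_bound B) c r (solver_for B c r)) \<and>
     prob_space.indep_vars (prob B) (\<lambda>(i, j). seed_space (solver_of B i))
       (\<lambda>(i, j). copy_seed B i j) ({1..num_solvers B} \<times> {..<copies B}) \<and>
     (\<forall>i \<in> {1..num_solvers B}. \<forall>j < copies B.
        distr (prob B) (seed_space (solver_of B i)) (copy_seed B i j) = seed_space (solver_of B i)) \<and>
     (\<forall>t \<in> {1..horizon B}.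
        xi B t \<in> measurable (prob B) (borel_vec (dim B)) \<and>
        distr (prob B) (borel_vec (dim B)) (xi B t) = D \<and>
        prob_space.indep_set (prob B) (events (prob B) (xi B t) (borel_vec (dim B))) (past B t) \<and>
        (\<forall>\<omega> \<in> space (prob B).
           case search_result B t \<omega> of
             Some v \<Rightarrow> feature B (play B t \<omega>) = v
           | None \<Rightarrow> (\<forall>a \<in> arms B t.
               scalar_prod (sampled_theta B t \<omega>) (feature B a)
                 \<le> scalar_prod (sampled_theta B t \<omega>) (feature B (play B t \<omega>)))))"

subsection \<open>Bounds and running times\<close>

definition regret_bound ::
    "nat \<Rightarrow> nat \<Rightarrow> real \<Rightarrow> real \<Rightarrow> real \<Rightarrow> real \<Rightarrow> real \<Rightarrow> real" where
  "regret_bound d T \<delta> \<eta> p b b' =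
     (let \<beta> = beta d T (\<delta> / (4 * T)); \<gamma> = gamma d T b b' (\<delta> / (4 * T)) in
        4 * \<gamma> / p * (sqrt (2 * T * d * ln (1 + T / d)) + sqrt (8 * T * ln (4 / \<delta>)))
        + (\<gamma> + \<beta>) * sqrt (2 * T * d * ln (1 + T / d))
        + 6 * (1 + \<gamma> + \<beta>) / p * (\<eta> / d) * T)"

definition initialization_time :: "('w, 'a, 's, 'st) bandit_run \<Rightarrow> 'w \<Rightarrow> real" where
  "initialization_time B \<omega> = (\<Sum>i = 1..num_solvers B. \<Sum>j < copies B.
     build_time (solver_of B i) (copy_seed B i j \<omega>) (points B 0))"

definition scan_time :: "('w, 'a, 's, 'st) bandit_run \<Rightarrow> nat \<Rightarrow> 'w \<Rightarrow> real" where
  "scan_time B t \<omega> =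
     (if search_result B t \<omega> = None then real (dim B) * real (card (arms B t)) else 0)"

(* All operations of round t, including the scan of a null round.
   elem_time d t: cost of the elementary work of round t, i.e. sampling xi_t, linear algebra in dimension d
   with at most t observations, and rounding the query (the same in all solvers) *)
definition round_time ::
    "(nat \<Rightarrow> nat \<Rightarrow> real) \<Rightarrow> ('w, 'a, 's, 'st) bandit_run \<Rightarrow> nat \<Rightarrow> 'w \<Rightarrow> real" where
  "round_time elem_time B t \<omega> =
     elem_time (dim B) t
     + (\<Sum>i = 1..num_solvers B. \<Sum>st\<leftarrow>copy_states B i (t - 1) \<omega>.
          modify_times (solver_of B i) (changes B t) st)
     + (\<Sum>i\<leftarrow>probes (\<lambda>i. mips_answer B t \<omega> i \<noteq> None) 0 (num_solvers B + 1).
          adaptive_lookup_time (dim B) (mips_eps B) (solver_of B i) (copy_states B i t \<omega>)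
            (mips_query B t \<omega>))
     + scan_time B t \<omega>"

end

theory Submission
  imports Defs "Jordan_Normal_Form.Char_Poly" "HOL-Real_Asymp.Real_Asymp"
begin

text \<open>On the confidence ellipsoid the optimal arm loses at most \<open>2 \<gamma>\<close> times an amount \<open>Z\<^sub>t\<close> (\<open>excess\<close>, in
  \<open>[0, 1]\<close>) to the worst truncated sample. \<open>Z\<^sub>t\<close> is known before \<open>\<xi>\<^sub>t\<close> is drawn, and with conditional
  probability at least \<open>p / 2\<close> the sample is optimistic, in which case \<open>Z\<^sub>t\<close> is at most the width \<open>W\<^sub>t\<close> of the
  arm played, up to search errors. Hence \<open>\<Sum>((p / 2) Z\<^sub>t - W\<^sub>t)\<close> concentrates as in Azuma's inequality, and
  \<open>\<Sum>W\<^sub>t\<close> is controlled by the growth of the determinant of the design matrix. The adaptive solvers fail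
  only if all copies of one of them err at some grid point; the number of rounds in which this happens is bounded
  in expectation. For the running time, \<open>\<rho>\<^sub>q = 1 - (s / (2 + s))\<^sup>2\<close> with \<open>s = c'\<^sup>2 - 1\<close>, which is of order
  \<open>\<eta> / d\<close> for every solver.\<close>

hide_const (open) Determinants.det Determinants.trace

text \<open>The arm played depends on the sample through the randomised solvers, so the comparison
  is made with an amount that does not see the sample. The worst case over all samples may be
  unbounded, hence the truncation at \<open>radius delta_round\<close>; taking it over a finite net
  of the ball keeps it measurable, and the net is fine enough that moving the actual sample into it
  costs only \<open>\<gamma> * mips_eps B\<close>. Truncation takes \<open>delta_round\<close> away
  from the probability \<open>p\<close> of optimism, and \<open>p / 2\<close> is what certainly
  remains if \<open>2 * delta_round \<le> p\<close>. The failure probability is divided equally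
  among four events: the ellipsoid misses the parameter, a sample is too long, the supermartingale
  deviates, bad rounds are too frequent. The first two are summed over the rounds, which explains
  the level \<open>delta_round\<close> in \<open>\<beta>\<close> and \<open>\<gamma>\<close>. The
  inverse square root of the design matrix is a definite description; to make sense of it, a
  spectral theorem is proved from complex eigenvalues and reflections. No analysis of matrix
  functions is needed, because arm sets are finite.\<close>

lemma vnorm_nonneg [simp]: "0 \<le> vnorm v"
  by (simp add: vnorm_def scalar_prod_def sum_nonneg)

lemma scalar_prod_self_nonneg [simp]: "0 \<le> (v :: real vec) \<bullet> v"
  by (simp add: scalar_prod_def sum_nonneg)

lemma vnorm_power2: "(vnorm v)\<^sup>2 = v \<bullet> v"
  by (simp add: vnorm_def)

lemma scalar_prod_self_eq_0:
  assumes "(v :: real vec) \<in> carrier_vec d" "v \<bullet> v = 0"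
  shows "v = 0\<^sub>v d"
proof -
  have "\<forall>i\<in>{0..<dim_vec v}. v $ i * v $ i = 0"
    using assms(2) unfolding scalar_prod_def
    by (subst (asm) sum_nonneg_eq_0_iff) auto
  then show ?thesis using assms(1) by (intro eq_vecI) auto
qed

lemma scalar_prod_self_pos:
  assumes "(v :: real vec) \<in> carrier_vec d" "v \<noteq> 0\<^sub>v d"
  shows "0 < v \<bullet> v"
  using scalar_prod_self_eq_0[OF assms(1)] assms(2) scalar_prod_self_nonneg[of v]
  by (auto simp: less_le)

lemma scalar_prod_le_vnorm:
  assumes "u \<in> carrier_vec d" "v \<in> carrier_vec d"
  shows "\<bar>u \<bullet> v\<bar> \<le> vnorm u * vnorm v"
proof -
  have "(u \<bullet> v)\<^sup>2 \<le> (u \<bullet> u) * (v \<bullet> v)"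
    using Cauchy_Schwarz_ineq_sum[of "vec_index u" "vec_index v" "{0..<d}"] assms
    by (simp add: scalar_prod_def power2_eq_square)
  then have "sqrt ((u \<bullet> v)\<^sup>2) \<le> sqrt ((u \<bullet> u) * (v \<bullet> v))" by (rule real_sqrt_le_mono)
  then show ?thesis by (simp add: vnorm_def real_sqrt_mult)
qed

lemma scalar_prod_le_vnorm':
  assumes "u \<in> carrier_vec d" "v \<in> carrier_vec d"
  shows "u \<bullet> v \<le> vnorm u * vnorm v"
  using scalar_prod_le_vnorm[OF assms] by linarith

lemma vnorm_add_le:
  assumes "u \<in> carrier_vec d" "v \<in> carrier_vec d"
  shows "vnorm (u + v) \<le> vnorm u + vnorm v"
proof -
  have "(vnorm (u + v))\<^sup>2 = u \<bullet> u + 2 * (u \<bullet> v) + v \<bullet> v"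
    unfolding vnorm_power2 using assms comm_scalar_prod[OF assms]
    by (simp add: add_scalar_prod_distrib[of _ d] scalar_prod_add_distrib[of _ d])
  also have "\<dots> \<le> (vnorm u + vnorm v)\<^sup>2"
    using scalar_prod_le_vnorm'[OF assms] by (simp add: power2_sum vnorm_power2)
  finally show ?thesis by (rule power2_le_imp_le) simp
qed

lemma vnorm_smult: "vnorm (c \<cdot>\<^sub>v v) = \<bar>c\<bar> * vnorm v"
  by (simp add: vnorm_def real_sqrt_mult)

lemma vnorm_minus_commute:
  assumes "u \<in> carrier_vec d" "v \<in> carrier_vec d"
  shows "vnorm (u - v) = vnorm (v - u)"
proof -
  have "v - u = (-1) \<cdot>\<^sub>v (u - v)" using assms by auto
  then show ?thesis using vnorm_smult[of "-1" "u - v"] by simp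
qed

lemma mat_eq_mult_vecI:
  assumes A: "A \<in> carrier_mat n d" and B: "B \<in> carrier_mat n d"
    and eq: "\<And>v :: 'a :: comm_semiring_1 vec. v \<in> carrier_vec d \<Longrightarrow> A *\<^sub>v v = B *\<^sub>v v"
  shows "A = B"
proof (rule eq_matI)
  fix i j assume ij: "i < dim_row B" "j < dim_col B"
  then have j: "j < d" and i: "i < n" using B by auto
  have "(A *\<^sub>v unit_vec d j) $ i = (B *\<^sub>v unit_vec d j) $ i" using eq[of "unit_vec d j"] by simp
  then show "A $$ (i, j) = B $$ (i, j)" using A B i j by (simp add: scalar_prod_right_unit)
qed (use A B in auto)

lemma outer_square_carrier [simp]: "v \<in> carrier_vec d \<Longrightarrow> outer_square v \<in> carrier_mat d d"
  by (simp add: outer_square_def)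

lemma outer_square_mult_vec:
  assumes "v \<in> carrier_vec d" "w \<in> carrier_vec d"
  shows "outer_square v *\<^sub>v w = (v \<bullet> w) \<cdot>\<^sub>v v"
  using assms by (intro eq_vecI) (auto simp: outer_square_def scalar_prod_def sum_distrib_left mult_ac)

lemma outer_square_sym: "transpose_mat (outer_square v) = outer_square v"
  by (intro eq_matI) (auto simp: outer_square_def)

lemma symmetric_scalar_prod:
  fixes A :: "real mat"
  assumes "A \<in> carrier_mat d d" "transpose_mat A = A" "u \<in> carrier_vec d" "v \<in> carrier_vec d"
  shows "(A *\<^sub>v u) \<bullet> v = u \<bullet> (A *\<^sub>v v)"
  using transpose_vec_mult_scalar[of A d d v u] assms by simp

subsection \<open>The spectral theorem\<close>

text \<open>The characteristic polynomial has a complex root. Pairing the real part of an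
  eigenvector with the image of its imaginary part, symmetry forces the root to be real; then
  whichever of the two parts is nonzero is a real eigenvector for it.\<close>

lemma symmetric_eigenvector:
  fixes A :: "real mat"
  assumes A: "A \<in> carrier_mat n n" and sym: "transpose_mat A = A" and n: "0 < n"
  obtains v e where "v \<in> carrier_vec n" "v \<bullet> v = 1" "A *\<^sub>v v = e \<cdot>\<^sub>v v"
proof -
  define C where "C = map_mat complex_of_real A"
  have C: "C \<in> carrier_mat n n" using A by (simp add: C_def)
  obtain as where as: "char_poly C = (\<Prod>a\<leftarrow>as. [:- a, 1:])" "length as = n"
    using char_poly_factorized[OF C] by blast
  with n obtain k as' where "as = k # as'" by (cases as) auto
  with as(1) have "poly (char_poly C) k = 0" by simp
  then obtain w where w: "w \<in> carrier_vec n" "w \<noteq> 0\<^sub>v n" "C *\<^sub>v w = k \<cdot>\<^sub>v w"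
    using eigenvalue_root_char_poly[OF C] C unfolding eigenvalue_def eigenvector_def by auto
  define a where "a = map_vec Re w"
  define b where "b = map_vec Im w"
  have ab [simp]: "a \<in> carrier_vec n" "b \<in> carrier_vec n" using w by (auto simp: a_def b_def)
  have comp: "(\<Sum>j = 0..<n. complex_of_real (A $$ (i, j)) * w $ j) = k * w $ i" if "i < n" for i
    using arg_cong[OF w(3), of "\<lambda>v. v $ i"] that w(1) A by (simp add: C_def scalar_prod_def)
  have Aa: "A *\<^sub>v a = Re k \<cdot>\<^sub>v a - Im k \<cdot>\<^sub>v b"
    using arg_cong[OF comp, of _ Re] w(1) A by (intro eq_vecI) (auto simp: scalar_prod_def a_def b_def)
  have Ab: "A *\<^sub>v b = Im k \<cdot>\<^sub>v a + Re k \<cdot>\<^sub>v b"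
    using arg_cong[OF comp, of _ Im] w(1) A by (intro eq_vecI) (auto simp: scalar_prod_def a_def b_def)
  have "(A *\<^sub>v a) \<bullet> b = a \<bullet> (A *\<^sub>v b)" by (rule symmetric_scalar_prod[OF A sym]) auto
  then have "Im k * (a \<bullet> a + b \<bullet> b) = 0"
    unfolding Aa Ab
    by (simp add: minus_scalar_prod_distrib[of _ n] scalar_prod_add_distrib[of _ n]
        smult_scalar_prod_distrib[of _ n] scalar_prod_smult_distrib[of _ n] algebra_simps)
  moreover have ne: "a \<noteq> 0\<^sub>v n \<or> b \<noteq> 0\<^sub>v n"
  proof (rule ccontr)
    assume "\<not> ?thesis"
    then have "Re (w $ i) = 0 \<and> Im (w $ i) = 0" if "i < n" for i
      using that w(1) unfolding a_def b_def
      by (metis carrier_vecD index_map_vec(1) index_zero_vec(1))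
    then have "w = 0\<^sub>v n" using w(1) by (intro eq_vecI) (auto simp: complex_eq_iff)
    with w(2) show False by simp
  qed
  moreover have "0 < a \<bullet> a + b \<bullet> b"
    using ne scalar_prod_self_pos[of a n] scalar_prod_self_pos[of b n]
      scalar_prod_self_nonneg[of a] scalar_prod_self_nonneg[of b] ab by fastforce
  ultimately have "Im k = 0" by simp
  with Aa Ab have A': "A *\<^sub>v a = Re k \<cdot>\<^sub>v a" "A *\<^sub>v b = Re k \<cdot>\<^sub>v b"
    by (auto intro!: eq_vecI simp: ab[THEN carrier_vecD])
  from ne A' obtain v where v: "v \<in> carrier_vec n" "v \<noteq> 0\<^sub>v n" "A *\<^sub>v v = Re k \<cdot>\<^sub>v v"
    using ab by blast
  define u where "u = (1 / vnorm v) \<cdot>\<^sub>v v"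
  have pos: "0 < v \<bullet> v" by (rule scalar_prod_self_pos[OF v(1,2)])
  show ?thesis
  proof (rule that[of u "Re k"])
    show "u \<in> carrier_vec n" using v by (simp add: u_def)
    show "u \<bullet> u = 1" using pos v by (simp add: u_def vnorm_def)
    show "A *\<^sub>v u = Re k \<cdot>\<^sub>v u"
      unfolding u_def mult_mat_vec[OF A v(1)] v(3) by (simp add: smult_smult_assoc mult.commute)
  qed
qed

text \<open>The reflection in the hyperplane orthogonal to \<open>v - unit_vec n 0\<close> exchanges
  these two vectors of equal length. It provides an orthogonal matrix with prescribed first column,
  without completing \<open>v\<close> to an orthonormal basis; only \<open>v = unit_vec n 0\<close>
  leaves no normal vector and is treated apart.\<close>

lemma householder:
  assumes v: "v \<in> carrier_vec n" and unit: "v \<bullet> v = (1 :: real)" and n: "0 < n"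
  obtains H where "H \<in> carrier_mat n n" "transpose_mat H = H" "H * H = 1\<^sub>m n"
    "H *\<^sub>v unit_vec n 0 = v"
proof (cases "v = unit_vec n 0")
  case True
  then show ?thesis by (intro that[of "1\<^sub>m n"]) auto
next
  case False
  define w where "w = v - unit_vec n 0"
  have w [simp]: "w \<in> carrier_vec n" using v by (simp add: w_def)
  have "w \<noteq> 0\<^sub>v n"
  proof
    assume "w = 0\<^sub>v n"
    have "v $ i = unit_vec n 0 $ i" if "i < n" for i
      using arg_cong[OF \<open>w = 0\<^sub>v n\<close>, of "\<lambda>x. x $ i"] that v by (simp add: w_def)
    with v False show False by (metis carrier_vecD eq_vecI index_unit_vec(3))
  qed
  then have pos: "0 < w \<bullet> w" by (rule scalar_prod_self_pos[OF w])
  define c where "c = 2 / (w \<bullet> w)"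
  define H where "H = 1\<^sub>m n - c \<cdot>\<^sub>m outer_square w"
  have H: "H \<in> carrier_mat n n"
    unfolding H_def by (intro minus_carrier_mat smult_carrier_mat outer_square_carrier w)
  have Hx: "H *\<^sub>v x = x - (c * (w \<bullet> x)) \<cdot>\<^sub>v w" if x: "x \<in> carrier_vec n" for x
  proof -
    have "(c \<cdot>\<^sub>m outer_square w) *\<^sub>v x = c \<cdot>\<^sub>v (outer_square w *\<^sub>v x)"
      using x by (intro eq_vecI) (auto simp: outer_square_def)
    then show ?thesis using x
      by (simp add: H_def minus_mult_distrib_mat_vec[of _ n n] outer_square_mult_vec[of _ n]
          smult_smult_assoc)
  qed
  show ?thesis
  proof (rule that[of H])
    show "H \<in> carrier_mat n n" by fact
    show "transpose_mat H = H"
      by (intro eq_matI) (auto simp: H_def outer_square_def mult_ac carrier_vecD[OF w])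
    show "H * H = 1\<^sub>m n"
    proof (rule mat_eq_mult_vecI[of _ n n])
      fix x :: "real vec" assume x: "x \<in> carrier_vec n"
      define y where "y = c * (w \<bullet> x)"
      have "w \<bullet> (x - y \<cdot>\<^sub>v w) = w \<bullet> x - y * (w \<bullet> w)"
        using x by (simp add: scalar_prod_minus_distrib[of _ n])
      also have "y * (w \<bullet> w) = 2 * (w \<bullet> x)" using pos by (simp add: y_def c_def)
      finally have *: "c * (w \<bullet> (x - y \<cdot>\<^sub>v w)) = - y" by (simp add: y_def)
      have "H *\<^sub>v (H *\<^sub>v x) = x - y \<cdot>\<^sub>v w - (- y) \<cdot>\<^sub>v w"
        using x Hx[of x] Hx[of "x - y \<cdot>\<^sub>v w"] * by (simp add: y_def)
      also have "\<dots> = x" using x by (intro eq_vecI) (auto simp: carrier_vecD[OF w])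
      finally show "(H * H) *\<^sub>v x = 1\<^sub>m n *\<^sub>v x"
        using x H by (simp add: assoc_mult_mat_vec[of _ n n])
    qed (use H in auto)
    have "w \<bullet> w = (v \<bullet> v) - 2 * (v $ 0) + 1"
      using v n by (simp add: w_def minus_scalar_prod_distrib[of _ n] scalar_prod_minus_distrib[of _ n])
    then have ww: "w \<bullet> w = 2 - 2 * v $ 0" using unit by simp
    have "w \<bullet> unit_vec n 0 = v $ 0 - 1"
      using v n by (simp add: w_def minus_scalar_prod_distrib[of _ n])
    then have "c * (w \<bullet> unit_vec n 0) = -1" using pos ww by (simp add: c_def field_simps)
    then have "H *\<^sub>v unit_vec n 0 = unit_vec n 0 - (-1) \<cdot>\<^sub>v w" by (simp add: Hx)
    also have "\<dots> = v" using v by (intro eq_vecI) (auto simp: w_def)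
    finally show "H *\<^sub>v unit_vec n 0 = v" .
  qed
qed

text \<open>Deflation: conjugating by a reflection that carries the first unit vector to a unit
  eigenvector clears the first column off the diagonal, and by symmetry the first row. The remaining
  block is symmetric of smaller size.\<close>

theorem spectral_theorem_symmetric:
  fixes A :: "real mat"
  assumes "A \<in> carrier_mat n n" "transpose_mat A = A"
  shows "\<exists>P E. P \<in> carrier_mat n n \<and> E \<in> carrier_mat n n \<and> P * transpose_mat P = 1\<^sub>m n \<and>
    transpose_mat P * P = 1\<^sub>m n \<and> diagonal_mat E \<and> A = P * E * transpose_mat P"
  using assms
proof (induction n arbitrary: A)
  case 0
  then show ?case by (intro exI[of _ "1\<^sub>m 0"]) (auto simp: diagonal_mat_def)
next
  case (Suc m)
  let ?n = "Suc m"
  obtain v e where v: "v \<in> carrier_vec ?n" "v \<bullet> v = 1" "A *\<^sub>v v = e \<cdot>\<^sub>v v"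
    using symmetric_eigenvector[OF Suc.prems] by blast
  obtain H where H: "H \<in> carrier_mat ?n ?n" "transpose_mat H = H" "H * H = 1\<^sub>m ?n"
    "H *\<^sub>v unit_vec ?n 0 = v"
    using householder[OF v(1,2)] by blast
  note A = Suc.prems(1)
  define A' where "A' = H * A * H"
  have A': "A' \<in> carrier_mat ?n ?n" using A H by (simp add: A'_def)
  have sym: "transpose_mat A' = A'"
    using A H Suc.prems(2) unfolding A'_def
    by (simp add: transpose_mult[of _ ?n ?n _ ?n] assoc_mult_mat[of _ ?n ?n _ ?n _ ?n])
  have "A' *\<^sub>v unit_vec ?n 0 = H *\<^sub>v (A *\<^sub>v (H *\<^sub>v unit_vec ?n 0))"
    using A H(1) by (simp add: A'_def assoc_mult_mat_vec[of _ ?n ?n _ ?n])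
  also have "\<dots> = e \<cdot>\<^sub>v (H *\<^sub>v (H *\<^sub>v unit_vec ?n 0))"
    unfolding H(4) v(3) using H(1) v(1) by (simp add: mult_mat_vec[of _ ?n ?n])
  also have "H *\<^sub>v (H *\<^sub>v unit_vec ?n 0) = unit_vec ?n 0"
    using H(1,3) by (simp add: assoc_mult_mat_vec[of _ ?n ?n _ ?n, symmetric] del: assoc_mult_mat_vec)
  finally have col: "A' *\<^sub>v unit_vec ?n 0 = e \<cdot>\<^sub>v unit_vec ?n 0" .
  have col0: "A' $$ (i, 0) = (if i = 0 then e else 0)" if "i < ?n" for i
  proof -
    have "A' $$ (i, 0) = (A' *\<^sub>v unit_vec ?n 0) $ i"
      using that A' by (simp add: scalar_prod_right_unit[of _ ?n])
    then show ?thesis unfolding col using that by (simp add: unit_vec_def)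
  qed
  have row0: "A' $$ (0, i) = (if i = 0 then e else 0)" if "i < ?n" for i
    using col0[OF that] A' that arg_cong[OF sym, of "\<lambda>X. X $$ (0, i)"] by simp
  define A3 where "A3 = mat m m (\<lambda>(i, j). A' $$ (Suc i, Suc j))"
  define E1 where "E1 = mat 1 1 (\<lambda>_. e)"
  have blocks: "A' = four_block_mat E1 (0\<^sub>m 1 m) (0\<^sub>m m 1) A3"
    using A' col0 row0 by (intro eq_matI) (auto simp: E1_def A3_def)
  have "A' $$ (j, i) = A' $$ (i, j)" if "i < ?n" "j < ?n" for i j
    using A' that arg_cong[OF sym, of "\<lambda>X. X $$ (i, j)"] by simp
  then have "transpose_mat A3 = A3" by (intro eq_matI) (auto simp: A3_def)
  then obtain P3 E3 where IH: "P3 \<in> carrier_mat m m" "E3 \<in> carrier_mat m m"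
    "P3 * transpose_mat P3 = 1\<^sub>m m" "transpose_mat P3 * P3 = 1\<^sub>m m" "diagonal_mat E3"
    "A3 = P3 * E3 * transpose_mat P3"
    using Suc.IH[of A3] by (auto simp: A3_def)
  define P1 where "P1 = four_block_mat (1\<^sub>m 1) (0\<^sub>m 1 m) (0\<^sub>m m 1) P3"
  define E where "E = four_block_mat E1 (0\<^sub>m 1 m) (0\<^sub>m m 1) E3"
  have E1: "E1 \<in> carrier_mat 1 1" by (simp add: E1_def)
  have P1: "P1 \<in> carrier_mat ?n ?n" and E: "E \<in> carrier_mat ?n ?n"
    using IH E1 four_block_carrier_mat[of _ 1 1 _ m m] by (auto simp: P1_def E_def)
  have tP1: "transpose_mat P1 = four_block_mat (1\<^sub>m 1) (0\<^sub>m 1 m) (0\<^sub>m m 1) (transpose_mat P3)"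
    unfolding P1_def using IH by (subst transpose_four_block_mat[of _ 1 1 _ m _ m]) auto
  have one: "four_block_mat (1\<^sub>m 1) (0\<^sub>m 1 m) (0\<^sub>m m 1) (1\<^sub>m m) = (1\<^sub>m ?n :: real mat)"
    by (intro eq_matI) auto
  have PP1: "P1 * transpose_mat P1 = 1\<^sub>m ?n" "transpose_mat P1 * P1 = 1\<^sub>m ?n"
    unfolding tP1 unfolding P1_def using IH
    by (subst mult_four_block_mat[of _ 1 1 _ m _ m _ _ 1 _ m]; simp add: one)+
  have PEP: "P1 * E * transpose_mat P1 = A'"
    unfolding tP1 blocks unfolding P1_def E_def using IH E1
    by (subst mult_four_block_mat[of _ 1 1 _ m _ m _ _ 1 _ m]; simp)
       (subst mult_four_block_mat[of _ 1 1 _ m _ m _ _ 1 _ m]; simp)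
  define P where "P = H * P1"
  have tP: "transpose_mat P = transpose_mat P1 * H"
    unfolding P_def using H P1 by (simp add: transpose_mult[of _ ?n ?n _ ?n])
  have tP1c: "transpose_mat P1 \<in> carrier_mat ?n ?n" using P1 by simp
  note assoc = assoc_mult_mat[of _ ?n ?n _ ?n _ ?n]
  have "P * transpose_mat P = H * (P1 * transpose_mat P1) * H"
    unfolding tP unfolding P_def using H P1 tP1c by (simp add: assoc)
  then have 1: "P * transpose_mat P = 1\<^sub>m ?n" using PP1 H by simp
  have "transpose_mat P * P = transpose_mat P1 * (H * H) * P1"
    unfolding tP unfolding P_def using H(1) P1 tP1c by (simp add: assoc)
  then have 2: "transpose_mat P * P = 1\<^sub>m ?n" using PP1 H P1 by simp
  have "P * E * transpose_mat P = H * (P1 * E * transpose_mat P1) * H"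
    unfolding tP unfolding P_def using H(1) P1 tP1c E by (simp add: assoc)
  also have "\<dots> = (H * H) * A * (H * H)"
    unfolding PEP A'_def using H(1) A by (simp add: assoc)
  finally have 3: "A = P * E * transpose_mat P" using H(3) A by simp
  have "i = j" if "i < m" "j < m" "E3 $$ (i, j) \<noteq> 0" for i j
    using IH(2,5) that by (auto simp: diagonal_mat_def)
  then have 4: "diagonal_mat E"
    using IH(2) E1 unfolding diagonal_mat_def E_def by (auto simp: less_Suc_eq_0_disj)
  have "P \<in> carrier_mat ?n ?n" using H(1) P1 by (simp add: P_def)
  then show ?case by (intro exI[of _ P] exI[of _ E] conjI E 1 2 3 4)
qed

subsection \<open>Positive definite matrices\<close>

lemma mat_diag_eq_one:
  assumes "\<And>i. i < n \<Longrightarrow> g i = (1 :: real)"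
  shows "mat_diag n g = 1\<^sub>m n"
  using assms by (intro eq_matI) (auto simp: mat_diag_def)

text \<open>In a fixed orthonormal eigenbasis products are taken entrywise on the diagonal; the
  inverse and the inverse square root are both verified this way.\<close>

lemma mat_diag_conj_mult:
  fixes P :: "real mat"
  assumes "P \<in> carrier_mat n n" "transpose_mat P * P = 1\<^sub>m n"
  shows "(P * mat_diag n f * transpose_mat P) * (P * mat_diag n g * transpose_mat P)
    = P * mat_diag n (\<lambda>i. f i * g i) * transpose_mat P"
proof -
  note assoc = assoc_mult_mat[of _ n n _ n _ n] mult_carrier_mat[of _ n n _ n]
  have "(P * mat_diag n f * transpose_mat P) * (P * mat_diag n g * transpose_mat P)
    = P * mat_diag n f * (transpose_mat P * P) * mat_diag n g * transpose_mat P"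
    using assms(1) by (simp add: assoc)
  also have "P * mat_diag n f * (transpose_mat P * P) = P * mat_diag n f"
    unfolding assms(2) using assms(1) by (intro right_mult_one_mat[of _ n n] mult_carrier_mat[of _ n n _ n]) auto
  also have "P * mat_diag n f * mat_diag n g = P * (mat_diag n f * mat_diag n g)"
    using assms(1) by (intro assoc_mult_mat[of _ n n _ n _ n]) auto
  finally show ?thesis by simp
qed

lemma quadratic_mat_diag_conj:
  fixes P :: "real mat"
  assumes P: "P \<in> carrier_mat n n" and v: "v \<in> carrier_vec n"
  shows "v \<bullet> ((P * mat_diag n f * transpose_mat P) *\<^sub>v v)
    = (\<Sum>i<n. f i * ((transpose_mat P *\<^sub>v v) $ i)\<^sup>2)"
proof -
  define y where "y = transpose_mat P *\<^sub>v v"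
  have y: "y \<in> carrier_vec n" using P v by (simp add: y_def)
  have "(P * mat_diag n f * transpose_mat P) *\<^sub>v v = P *\<^sub>v (mat_diag n f *\<^sub>v y)"
    using P v by (simp add: y_def assoc_mult_mat_vec[of _ n n _ n])
  then have "v \<bullet> ((P * mat_diag n f * transpose_mat P) *\<^sub>v v) = y \<bullet> (mat_diag n f *\<^sub>v y)"
    using transpose_vec_mult_scalar[of P n n "mat_diag n f *\<^sub>v y" v] P v y
    by (simp add: y_def mult_mat_vec_carrier[of _ n n])
  also have "mat_diag n f *\<^sub>v y = vec n (\<lambda>i. f i * y $ i)"
    using y by (intro eq_vecI) (auto simp: mat_diag_def scalar_prod_def if_distrib[of "\<lambda>x. x * _"]
        cong: if_cong)
  also have "y \<bullet> \<dots> = (\<Sum>i<n. f i * (y $ i)\<^sup>2)"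
    by (simp add: scalar_prod_def power2_eq_square mult_ac atLeast0LessThan)
  finally show ?thesis by (simp add: y_def)
qed

lemma pos_def_mat_diag_conj:
  assumes P: "P \<in> carrier_mat n n" "P * transpose_mat P = 1\<^sub>m n" and pos: "\<And>i. i < n \<Longrightarrow> f i > 0"
  shows "pos_def n (P * mat_diag n f * transpose_mat P)"
  unfolding pos_def_def
proof (intro conjI ballI impI)
  have "transpose_mat (mat_diag n f) = mat_diag n f" by (intro eq_matI) (auto simp: mat_diag_def)
  then show "transpose_mat (P * mat_diag n f * transpose_mat P) = P * mat_diag n f * transpose_mat P"
    using P(1) by (simp add: transpose_mult[of _ n n _ n] assoc_mult_mat[of _ n n _ n _ n]
        mult_carrier_mat[of _ n n _ n])
next
  fix v :: "real vec" assume v: "v \<in> carrier_vec n" "v \<noteq> 0\<^sub>v n"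
  define y where "y = transpose_mat P *\<^sub>v v"
  have "P *\<^sub>v y = v" using P v
    by (simp add: y_def assoc_mult_mat_vec[of _ n n _ n, symmetric] del: assoc_mult_mat_vec)
  have y: "y \<in> carrier_vec n" using P v by (simp add: y_def)
  have "y \<noteq> 0\<^sub>v n" using \<open>P *\<^sub>v y = v\<close> v P(1) by auto
  then obtain i where i: "i < n" "y $ i \<noteq> 0"
    using y by (metis carrier_vecD eq_vecI index_zero_vec)
  show "0 < v \<bullet> ((P * mat_diag n f * transpose_mat P) *\<^sub>v v)"
    unfolding quadratic_mat_diag_conj[OF P(1) v(1)] y_def[symmetric]
    by (rule sum_pos2[of _ i]) (use i pos in \<open>auto simp: less_imp_le\<close>)
qed (use P in auto)

text \<open>The witness is the \<open>i\<close>-th column of \<open>P\<close>. It translates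
  statements about quadratic forms into statements about single diagonal entries.\<close>

lemma spectral_theorem_eigenvector:
  fixes P :: "real mat"
  assumes P: "P \<in> carrier_mat n n" "transpose_mat P * P = 1\<^sub>m n"
    and A: "A = P * mat_diag n f * transpose_mat P" and i: "i < n"
  obtains p where "p \<in> carrier_vec n" "p \<bullet> p = 1" "A *\<^sub>v p = f i \<cdot>\<^sub>v p"
proof -
  define p where "p = P *\<^sub>v unit_vec n i"
  have p: "p \<in> carrier_vec n" using P by (simp add: p_def)
  have tp: "transpose_mat P *\<^sub>v p = unit_vec n i" using P
    by (simp add: p_def assoc_mult_mat_vec[of _ n n _ n, symmetric] del: assoc_mult_mat_vec)
  have "p \<bullet> p = (transpose_mat P *\<^sub>v p) \<bullet> unit_vec n i"
    using transpose_vec_mult_scalar[of P n n "unit_vec n i" p] P p by (simp add: p_def)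
  then have 1: "p \<bullet> p = 1" using i unfolding tp by simp
  have "mat_diag n f *\<^sub>v unit_vec n i = f i \<cdot>\<^sub>v unit_vec n i"
    using i by (intro eq_vecI) (auto simp: mat_diag_def scalar_prod_right_unit)
  then have "A *\<^sub>v p = P *\<^sub>v (f i \<cdot>\<^sub>v unit_vec n i)"
    unfolding A using P p tp by (simp add: assoc_mult_mat_vec[of _ n n _ n])
  then have "A *\<^sub>v p = f i \<cdot>\<^sub>v p" using P by (simp add: p_def mult_mat_vec[of _ n n])
  with p 1 show ?thesis by (rule that)
qed

lemma spectral_theorem:
  fixes A :: "real mat"
  assumes A: "A \<in> carrier_mat n n" "transpose_mat A = A"
  obtains P f where "P \<in> carrier_mat n n" "P * transpose_mat P = 1\<^sub>m n"
    "transpose_mat P * P = 1\<^sub>m n" "A = P * mat_diag n f * transpose_mat P"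
proof -
  obtain P E where PE: "P \<in> carrier_mat n n" "E \<in> carrier_mat n n" "P * transpose_mat P = 1\<^sub>m n"
    "transpose_mat P * P = 1\<^sub>m n" "diagonal_mat E" "A = P * E * transpose_mat P"
    using spectral_theorem_symmetric[OF A] by blast
  have "E = mat_diag n (\<lambda>i. E $$ (i, i))"
    using PE(2,5) by (intro eq_matI) (auto simp: mat_diag_def diagonal_mat_def)
  with PE show ?thesis by (intro that[of P "\<lambda>i. E $$ (i, i)"]) auto
qed

lemma spectral_theorem_pos_def:
  assumes A: "pos_def n A"
  obtains P f where "P \<in> carrier_mat n n" "P * transpose_mat P = 1\<^sub>m n"
    "transpose_mat P * P = 1\<^sub>m n" "A = P * mat_diag n f * transpose_mat P" "\<And>i. i < n \<Longrightarrow> f i > 0"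
proof -
  obtain P f where Pf: "P \<in> carrier_mat n n" "P * transpose_mat P = 1\<^sub>m n"
    "transpose_mat P * P = 1\<^sub>m n" "A = P * mat_diag n f * transpose_mat P"
    using spectral_theorem[of A n] A by (auto simp: pos_def_def)
  have "f i > 0" if i: "i < n" for i
  proof -
    obtain p where p: "p \<in> carrier_vec n" "p \<bullet> p = 1" "A *\<^sub>v p = f i \<cdot>\<^sub>v p"
      using spectral_theorem_eigenvector[OF Pf(1,3,4) i] by blast
    have "p \<noteq> 0\<^sub>v n" using p(2) by auto
    with A p show ?thesis by (auto simp: pos_def_def)
  qed
  with Pf show ?thesis by (rule that)
qed

text \<open>\<open>mat_inv\<close> applies \<open>the\<close> to an option, so it is meaningful only
  after \<open>None\<close> has been excluded; the inverse read off from the spectral decomposition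
  does this.\<close>

lemma pos_def_inverse:
  assumes A: "pos_def n A"
  shows "mat_inv A \<in> carrier_mat n n" "A * mat_inv A = 1\<^sub>m n" "mat_inv A * A = 1\<^sub>m n"
proof -
  obtain P f where Pf: "P \<in> carrier_mat n n" "P * transpose_mat P = 1\<^sub>m n"
    "transpose_mat P * P = 1\<^sub>m n" "A = P * mat_diag n f * transpose_mat P" "\<And>i. i < n \<Longrightarrow> f i > 0"
    using spectral_theorem_pos_def[OF A] by blast
  define C where "C = P * mat_diag n (\<lambda>i. 1 / f i) * transpose_mat P"
  have one: "P * mat_diag n g * transpose_mat P = 1\<^sub>m n" if "\<And>i. i < n \<Longrightarrow> g i = 1" for g
    using mat_diag_eq_one[of n g, OF that] Pf by simp
  have nz: "f i \<noteq> 0" if "i < n" for i using Pf(5)[OF that] by simp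
  have AC: "A * C = 1\<^sub>m n" "C * A = 1\<^sub>m n"
    unfolding C_def Pf(4) mat_diag_conj_mult[OF Pf(1,3)] by (rule one; use nz in simp)+
  have car: "A \<in> carrier_mat n n" "C \<in> carrier_mat n n"
    using A Pf(1) by (auto simp: pos_def_def C_def)
  have "mat_inverse A \<noteq> None"
    using mat_inverse(1)[OF car(1)] AC car by (auto simp: Units_def ring_mat_def)
  then obtain X where "mat_inverse A = Some X" by blast
  with mat_inverse(2)[OF car(1) this]
  show "mat_inv A \<in> carrier_mat n n" "A * mat_inv A = 1\<^sub>m n" "mat_inv A * A = 1\<^sub>m n"
    by (auto simp: mat_inv_def)
qed

lemma mat_inverse_unique:
  fixes A :: "real mat"
  assumes "A \<in> carrier_mat n n" "B \<in> carrier_mat n n" "C \<in> carrier_mat n n"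
    "B * A = 1\<^sub>m n" "A * C = 1\<^sub>m n"
  shows "B = C"
proof -
  have "B = B * (A * C)" using assms by simp
  also have "\<dots> = (B * A) * C" using assms(1-3) by simp
  finally show ?thesis using assms by simp
qed

text \<open>For an eigenvector \<open>p\<close> of \<open>B - C\<close> with eigenvalue
  \<open>f i\<close>, equality of the squares makes \<open>B p - C p\<close> orthogonal to
  \<open>B p + C p\<close>. The former is \<open>f i\<close> times \<open>p\<close>, and
  \<open>p\<close> has positive inner product with the latter, so \<open>f i = 0\<close>. A
  symmetric matrix without nonzero eigenvalues vanishes.\<close>

lemma pos_def_sqrt_unique:
  assumes B: "pos_def n B" and C: "pos_def n C" and eq: "B * B = C * C"
  shows "B = C"
proof -
  have car: "B \<in> carrier_mat n n" "C \<in> carrier_mat n n"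
    and sym: "transpose_mat B = B" "transpose_mat C = C"
    using B C by (auto simp: pos_def_def)
  have dcar: "B - C \<in> carrier_mat n n" using car by (intro minus_carrier_mat)
  have "transpose_mat (B - C) = B - C" using sym car transpose_minus[of B n n C] by simp
  then obtain P f where Pf: "P \<in> carrier_mat n n" "P * transpose_mat P = 1\<^sub>m n"
    "transpose_mat P * P = 1\<^sub>m n" "B - C = P * mat_diag n f * transpose_mat P"
    using spectral_theorem[OF dcar] by blast
  have "f i = 0" if i: "i < n" for i
  proof -
    obtain p where p: "p \<in> carrier_vec n" "p \<bullet> p = 1" "(B - C) *\<^sub>v p = f i \<cdot>\<^sub>v p"
      using spectral_theorem_eigenvector[OF Pf(1,3,4) i] by blast
    define b where "b = B *\<^sub>v p"
    define c where "c = C *\<^sub>v p"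
    have bc: "b \<in> carrier_vec n" "c \<in> carrier_vec n" using car p by (auto simp: b_def c_def)
    have "p \<noteq> 0\<^sub>v n" using p(2) by auto
    then have pos: "0 < p \<bullet> b" "0 < p \<bullet> c" using B C p by (auto simp: pos_def_def b_def c_def)
    have diff: "b - c = f i \<cdot>\<^sub>v p"
      using p car by (simp add: b_def c_def minus_mult_distrib_mat_vec[of _ n n])
    have "b \<bullet> b = p \<bullet> ((B * B) *\<^sub>v p)"
      using symmetric_scalar_prod[OF car(1) sym(1) p(1) bc(1)] car p(1) by (simp add: b_def)
    also have "\<dots> = c \<bullet> c"
      unfolding eq using symmetric_scalar_prod[OF car(2) sym(2) p(1) bc(2)] car p(1)
      by (simp add: c_def)
    finally have "(b - c) \<bullet> (b + c) = 0"
      using bc comm_scalar_prod[OF bc]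
      by (simp add: minus_scalar_prod_distrib[of _ n] scalar_prod_add_distrib[of _ n])
    then have "f i * (p \<bullet> b + p \<bullet> c) = 0"
      unfolding diff using p(1) bc by (simp add: scalar_prod_add_distrib[of _ n] distrib_left)
    then show "f i = 0" using pos by simp
  qed
  then have "mat_diag n f = 0\<^sub>m n n" by (intro eq_matI) (auto simp: mat_diag_def)
  then have zero: "B - C = 0\<^sub>m n n" using Pf by simp
  show ?thesis
  proof (rule eq_matI)
    fix i j assume "i < dim_row C" "j < dim_col C"
    then show "B $$ (i, j) = C $$ (i, j)"
      using arg_cong[OF zero, of "\<lambda>X. X $$ (i, j)"] car by simp
  qed (use car in auto)
qed

text \<open>Existence and uniqueness discharge the definite description in
  \<open>inv_sqrt_mat\<close>; the witness has \<open>1 / sqrt (f i)\<close> on the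
  diagonal.\<close>

lemma inv_sqrt_mat:
  assumes A: "pos_def n A"
  shows "pos_def n (inv_sqrt_mat n A)" "inv_sqrt_mat n A * inv_sqrt_mat n A = mat_inv A"
proof -
  obtain P f where Pf: "P \<in> carrier_mat n n" "P * transpose_mat P = 1\<^sub>m n"
    "transpose_mat P * P = 1\<^sub>m n" "A = P * mat_diag n f * transpose_mat P" "\<And>i. i < n \<Longrightarrow> f i > 0"
    using spectral_theorem_pos_def[OF A] by blast
  define C where "C = P * mat_diag n (\<lambda>i. 1 / sqrt (f i)) * transpose_mat P"
  have C: "pos_def n C" unfolding C_def by (rule pos_def_mat_diag_conj) (use Pf in auto)
  have car: "A \<in> carrier_mat n n" "C * C \<in> carrier_mat n n" using A Pf(1) by (auto simp: pos_def_def C_def)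
  have "1 / sqrt (f i) * (1 / sqrt (f i)) * f i = 1" if "i < n" for i
    using Pf(5)[OF that] by (simp add: field_simps)
  then have one: "mat_diag n (\<lambda>i. 1 / sqrt (f i) * (1 / sqrt (f i)) * f i) = 1\<^sub>m n"
    by (rule mat_diag_eq_one)
  have "(C * C) * A = 1\<^sub>m n"
    unfolding C_def Pf(4) mat_diag_conj_mult[OF Pf(1,3)] one using Pf(1,2) by simp
  then have CC: "C * C = mat_inv A"
    by (rule mat_inverse_unique[OF car pos_def_inverse(1)[OF A] _ pos_def_inverse(2)[OF A]])
  have "pos_def n (inv_sqrt_mat n A) \<and> inv_sqrt_mat n A * inv_sqrt_mat n A = mat_inv A"
    unfolding inv_sqrt_mat_def
  proof (rule theI[of _ C])
    show "pos_def n C \<and> C * C = mat_inv A" using C CC by blast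
    show "B = C" if "pos_def n B \<and> B * B = mat_inv A" for B
      using that pos_def_sqrt_unique[OF _ C] CC by metis
  qed
  then show "pos_def n (inv_sqrt_mat n A)" "inv_sqrt_mat n A * inv_sqrt_mat n A = mat_inv A"
    by auto
qed

text \<open>The inequality of arithmetic and geometric means for the eigenvalues, from
  \<open>ln x \<le> x - 1\<close> applied to each eigenvalue divided by \<open>m\<close>. The
  columns of \<open>P\<close> have norm 1, so the trace is the sum of the eigenvalues.\<close>

lemma pos_def_ln_det_le:
  assumes A: "pos_def n A" and m: "m > 0" and tr: "(\<Sum>i<n. A $$ (i, i)) \<le> n * m"
  shows "det A > 0" "ln (det A) \<le> n * ln m"
proof -
  obtain P f where Pf: "P \<in> carrier_mat n n" "P * transpose_mat P = 1\<^sub>m n"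
    "transpose_mat P * P = 1\<^sub>m n" "A = P * mat_diag n f * transpose_mat P" "\<And>i. i < n \<Longrightarrow> f i > 0"
    using spectral_theorem_pos_def[OF A] by blast
  have "det P * det (transpose_mat P) = 1"
    using det_mult[of P n "transpose_mat P"] Pf by simp
  moreover have "det (mat_diag n f) = (\<Prod>i<n. f i)"
    by (subst det_upper_triangular[of _ n])
      (auto simp: mat_diag_def diag_mat_def prod.list_conv_set_nth atLeast0LessThan)
  ultimately have det: "det A = (\<Prod>i<n. f i)"
    unfolding Pf(4) using Pf(1) by (simp add: det_mult[of _ n] ac_simps)
  then show "det A > 0" using Pf(5) by (auto intro: prod_pos)
  have car: "A \<in> carrier_mat n n" using A by (simp add: pos_def_def)
  have Aii: "A $$ (i, i) = (\<Sum>k<n. f k * (P $$ (i, k))\<^sup>2)" if i: "i < n" for i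
  proof -
    have "A $$ (i, i) = unit_vec n i \<bullet> (A *\<^sub>v unit_vec n i)"
      using i car by (simp add: scalar_prod_left_unit[of _ n] mult_mat_vec_carrier[of _ n n])
    also have "\<dots> = (\<Sum>k<n. f k * (P $$ (i, k))\<^sup>2)"
      unfolding Pf(4) quadratic_mat_diag_conj[OF Pf(1) unit_vec_carrier] using Pf(1) i
      by (intro sum.cong) (auto simp: scalar_prod_right_unit)
    finally show ?thesis .
  qed
  have col: "(\<Sum>i<n. (P $$ (i, k))\<^sup>2) = 1" if "k < n" for k
    using arg_cong[OF Pf(3), of "\<lambda>X. X $$ (k, k)"] that Pf(1)
    by (simp add: scalar_prod_def power2_eq_square atLeast0LessThan)
  have "(\<Sum>i<n. A $$ (i, i)) = (\<Sum>i<n. \<Sum>k<n. f k * (P $$ (i, k))\<^sup>2)" using Aii by simp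
  also have "\<dots> = (\<Sum>k<n. f k * (\<Sum>i<n. (P $$ (i, k))\<^sup>2))"
    by (subst sum.swap) (simp add: sum_distrib_left)
  also have "\<dots> = (\<Sum>k<n. f k)" using col by simp
  finally have sum: "(\<Sum>k<n. f k) \<le> n * m" using tr by simp
  have "f k \<noteq> 0" if "k < n" for k using Pf(5)[OF that] by simp
  then have "ln (det A) = (\<Sum>k<n. ln (f k))"
    unfolding det by (intro ln_prod) auto
  also have "\<dots> \<le> (\<Sum>k<n. ln m + (f k / m - 1))"
  proof (rule sum_mono)
    fix k assume "k \<in> {..<n}"
    then have "f k > 0" using Pf by simp
    with m have "ln (f k / m) \<le> f k / m - 1" by (intro ln_le_minus_one) simp
    then show "ln (f k) \<le> ln m + (f k / m - 1)" using \<open>f k > 0\<close> m by (simp add: ln_div)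
  qed
  also have "\<dots> = n * ln m + ((\<Sum>k<n. f k) / m - n)"
    by (simp add: sum.distrib sum_subtractf sum_divide_distrib)
  also have "\<dots> \<le> n * ln m" using sum m by (simp add: field_simps)
  finally show "ln (det A) \<le> n * ln m" .
qed

text \<open>The matrix determinant lemma. The bordered matrix \<open>K\<close> is factored into
  block triangular matrices in two ways, by eliminating with its lower right entry 1 and by
  eliminating with \<open>A\<close>; the two Schur complements give the two sides.\<close>

lemma det_rank_one_update:
  assumes A: "pos_def n A" and x: "x \<in> carrier_vec n"
  shows "det (A + outer_square x) = det A * (1 + x \<bullet> (mat_inv A *\<^sub>v x))"
proof -
  note inv = pos_def_inverse[OF A]
  have car: "A \<in> carrier_mat n n" using A by (simp add: pos_def_def)
  define y where "y = mat_inv A *\<^sub>v x"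
  have y: "y \<in> carrier_vec n" using inv x by (simp add: y_def)
  have Ay: "A *\<^sub>v y = x" using inv x car
    by (simp add: y_def assoc_mult_mat_vec[of _ n n _ n, symmetric] del: assoc_mult_mat_vec)
  define X where "X = mat n 1 (\<lambda>(i, j). x $ i)"
  define Y where "Y = mat n 1 (\<lambda>(i, j). y $ i)"
  define X' where "X' = mat 1 n (\<lambda>(i, j). x $ j)"
  have XY [simp]: "X \<in> carrier_mat n 1" "Y \<in> carrier_mat n 1" "X' \<in> carrier_mat 1 n"
    by (auto simp: X_def Y_def X'_def)
  have XX': "X * X' = outer_square x"
    using x by (intro eq_matI) (auto simp: X_def X'_def outer_square_def scalar_prod_def)
  have AY: "A * Y = X"
  proof (rule eq_matI)
    fix i j assume "i < dim_row X" "j < dim_col X"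
    then show "(A * Y) $$ (i, j) = X $$ (i, j)"
      using arg_cong[OF Ay, of "\<lambda>v. v $ i"] car y by (simp add: X_def Y_def scalar_prod_def)
  qed (use car in \<open>auto simp: X_def Y_def\<close>)
  have X'Y: "X' * Y = mat 1 1 (\<lambda>_. x \<bullet> y)"
    using x y by (intro eq_matI) (auto simp: X'_def Y_def scalar_prod_def)
  define K where "K = four_block_mat A (- X) X' (1\<^sub>m 1)"
  have 1: "K = four_block_mat (1\<^sub>m n) (- X) (0\<^sub>m 1 n) (1\<^sub>m 1) *
    four_block_mat (A + outer_square x) (0\<^sub>m n 1) X' (1\<^sub>m 1)"
  proof -
    have "A + outer_square x + - X * X' = A"
      using car x XX' uminus_mult_left_mat[of X X']
      by (intro eq_matI) (auto simp: X_def X'_def outer_square_def scalar_prod_def)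
    moreover have "- X * 1\<^sub>m 1 = - X" by (rule right_mult_one_mat[of _ n]) (simp del: One_nat_def)
    moreover have "0\<^sub>m n 1 + - X = - X" by (rule left_add_zero_mat) (simp del: One_nat_def)
    moreover have "0\<^sub>m 1 n * (A + outer_square x) = 0\<^sub>m 1 n"
      using car x by (intro left_mult_zero_mat[of _ n n]) auto
    moreover have "0\<^sub>m 1 n + X' = X'" "1\<^sub>m 1 * X' = X'"
      by (rule left_add_zero_mat left_mult_one_mat[of _ 1 n], simp del: One_nat_def)+
    moreover have "1\<^sub>m n * (A + outer_square x) = A + outer_square x"
      using car x by (intro left_mult_one_mat[of _ n n]) auto
    moreover have "0\<^sub>m 1 n * 0\<^sub>m n 1 + 1\<^sub>m 1 * 1\<^sub>m 1 = (1\<^sub>m 1 :: real mat)" by auto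
    ultimately show ?thesis
      unfolding K_def using car x
      by (subst mult_four_block_mat[of _ n n _ 1 _ 1 _ _ n _ 1]) (simp_all del: One_nat_def)
  qed
  have 2: "K = four_block_mat A (0\<^sub>m n 1) X' (mat 1 1 (\<lambda>_. 1 + x \<bullet> y)) *
    four_block_mat (1\<^sub>m n) (- Y) (0\<^sub>m 1 n) (1\<^sub>m 1)"
  proof -
    define Z where "Z = mat 1 1 (\<lambda>_. 1 + x \<bullet> y)"
    have Z: "Z \<in> carrier_mat 1 1" by (simp add: Z_def)
    have "A * - Y = - X" using AY uminus_mult_right_mat[of A Y] car by (simp add: Y_def)
    moreover have "0\<^sub>m n 1 * 1\<^sub>m 1 = (0\<^sub>m n 1 :: real mat)" "- X + 0\<^sub>m n 1 = - X"
      by (rule right_mult_one_mat[of _ n] right_add_zero_mat, simp del: One_nat_def)+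
    moreover have "A * 1\<^sub>m n + 0\<^sub>m n 1 * 0\<^sub>m 1 n = A" using car by simp
    moreover have "X' * 1\<^sub>m n + Z * 0\<^sub>m 1 n = X'"
      using right_mult_one_mat[OF XY(3)] right_mult_zero_mat[OF Z, of n] right_add_zero_mat[OF XY(3)]
      by simp
    moreover have "X' * - Y = - (X' * Y)" using uminus_mult_right_mat[of X' Y] by (simp add: Y_def X'_def)
    then have "X' * - Y + Z * 1\<^sub>m 1 = 1\<^sub>m 1"
      unfolding X'Y right_mult_one_mat[OF Z] by (intro eq_matI) (auto simp: Z_def)
    ultimately show ?thesis
      unfolding K_def Z_def[symmetric] using car x Z
      by (subst mult_four_block_mat[of _ n n _ 1 _ 1 _ _ n _ 1]) (simp_all del: One_nat_def)
  qed
  have fb: "four_block_mat A1 A2 A3 A4 \<in> carrier_mat (n + 1) (n + 1)"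
    if "A1 \<in> carrier_mat n n" "A4 \<in> carrier_mat 1 1" for A1 A2 A3 A4 :: "real mat"
    using that by (rule four_block_carrier_mat)
  have dsmall: "det (mat 1 1 (\<lambda>_. c)) = (c :: real)" for c
    by (subst det_single) auto
  have "det K = det (A + outer_square x)"
    unfolding 1 using car x det_four_block_mat_lower_left_zero[of "1\<^sub>m n" n "- X" 1 "0\<^sub>m 1 n" "1\<^sub>m 1"]
      det_four_block_mat_upper_right_zero[of "A + outer_square x" n "0\<^sub>m n 1" 1 X' "1\<^sub>m 1"]
    by (subst det_mult[OF fb fb]) (simp_all del: One_nat_def)
  moreover have "det K = det A * (1 + x \<bullet> y)"
    unfolding 2 using car x det_four_block_mat_lower_left_zero[of "1\<^sub>m n" n "- Y" 1 "0\<^sub>m 1 n" "1\<^sub>m 1"]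
      det_four_block_mat_upper_right_zero[of A n "0\<^sub>m n 1" 1 X' "mat 1 1 (\<lambda>_. 1 + x \<bullet> y)"] dsmall
    by (subst det_mult[OF fb fb]) (simp_all del: One_nat_def)
  ultimately show ?thesis by (simp add: y_def)
qed

lemma pos_def_rank_one_update:
  assumes A: "pos_def n A" and x: "x \<in> carrier_vec n"
  shows "pos_def n (A + outer_square x)"
  unfolding pos_def_def
proof (intro conjI ballI impI)
  have car: "A \<in> carrier_mat n n" "transpose_mat A = A" using A by (auto simp: pos_def_def)
  show "A + outer_square x \<in> carrier_mat n n" using car x by simp
  show "transpose_mat (A + outer_square x) = A + outer_square x"
    using car x transpose_add[of A n n "outer_square x"] by (simp add: outer_square_sym)
  fix v :: "real vec" assume v: "v \<in> carrier_vec n" "v \<noteq> 0\<^sub>v n"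
  have "v \<bullet> ((A + outer_square x) *\<^sub>v v) = v \<bullet> (A *\<^sub>v v) + (x \<bullet> v)\<^sup>2"
    using car v x comm_scalar_prod[OF v(1) x]
    by (simp add: add_mult_distrib_mat_vec[of _ n n] outer_square_mult_vec[of _ n]
        scalar_prod_add_distrib[of _ n] mult_mat_vec_carrier[of _ n n] power2_eq_square)
  then show "0 < v \<bullet> ((A + outer_square x) *\<^sub>v v)"
    using A v by (simp add: pos_def_def add_pos_nonneg)
qed

text \<open>The Sherman-Morrison formula, evaluated at a vector. Instead of exhibiting the inverse,
  the proof solves \<open>V *\<^sub>v y = z\<close>: the solution is \<open>w\<close> corrected
  along \<open>u\<close>, with the coefficient \<open>c\<close> determined by the requirement
  \<open>x \<bullet> y = c\<close>.\<close>

lemma mat_inv_rank_one_update: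
  assumes A: "pos_def n A" and x: "x \<in> carrier_vec n" and z: "z \<in> carrier_vec n"
  defines "\<sigma> \<equiv> x \<bullet> (mat_inv A *\<^sub>v x)"
  shows "z \<bullet> (mat_inv (A + outer_square x) *\<^sub>v z)
    = z \<bullet> (mat_inv A *\<^sub>v z) - (x \<bullet> (mat_inv A *\<^sub>v z))\<^sup>2 / (1 + \<sigma>)"
proof -
  define V where "V = A + outer_square x"
  have V: "pos_def n V" unfolding V_def by (rule pos_def_rank_one_update[OF A x])
  note inv = pos_def_inverse[OF A] and inv' = pos_def_inverse[OF V]
  have car: "A \<in> carrier_mat n n" "V \<in> carrier_mat n n" and sym: "transpose_mat A = A"
    using A V by (auto simp: pos_def_def)
  define u where "u = mat_inv A *\<^sub>v x"
  define w where "w = mat_inv A *\<^sub>v z"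
  define c where "c = (x \<bullet> w) / (1 + \<sigma>)"
  define y where "y = w - c \<cdot>\<^sub>v u"
  have uw [simp]: "u \<in> carrier_vec n" "w \<in> carrier_vec n" using inv x z by (auto simp: u_def w_def)
  have y: "y \<in> carrier_vec n" by (simp add: y_def)
  have Au: "A *\<^sub>v u = x" and Aw: "A *\<^sub>v w = z"
    using inv x z car by (simp_all add: u_def w_def
        assoc_mult_mat_vec[of _ n n _ n, symmetric] del: assoc_mult_mat_vec)
  have zu: "z \<bullet> u = x \<bullet> w"
    using symmetric_scalar_prod[OF car(1) sym uw(2,1)] comm_scalar_prod[OF uw(2) x] by (simp add: Au Aw)
  have "\<sigma> = u \<bullet> (A *\<^sub>v u)"
    using comm_scalar_prod[OF uw(1) x] by (simp add: \<sigma>_def u_def[symmetric] Au)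
  then have "0 \<le> \<sigma>" using A uw(1) car unfolding pos_def_def
    by (cases "u = 0\<^sub>v n") (auto simp: less_imp_le)
  then have "1 + \<sigma> \<noteq> 0" by linarith
  then have c: "x \<bullet> w - c * \<sigma> = c" by (simp add: c_def field_simps)
  have "V *\<^sub>v y = A *\<^sub>v y + (x \<bullet> y) \<cdot>\<^sub>v x"
    using car x y by (simp add: V_def add_mult_distrib_mat_vec[of _ n n] outer_square_mult_vec[of _ n])
  also have "A *\<^sub>v y = z - c \<cdot>\<^sub>v x"
    using car by (simp add: y_def mult_minus_distrib_mat_vec[of _ n n] mult_mat_vec[of _ n n] Au Aw)
  also have "x \<bullet> y = c"
    using x c by (simp add: y_def scalar_prod_minus_distrib[of _ n] \<sigma>_def u_def[symmetric])
  also have "z - c \<cdot>\<^sub>v x + c \<cdot>\<^sub>v x = z" using x z by (intro eq_vecI) auto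
  finally have "V *\<^sub>v y = z" .
  moreover have "mat_inv V *\<^sub>v (V *\<^sub>v y) = (mat_inv V * V) *\<^sub>v y"
    using inv' car y by (intro assoc_mult_mat_vec[symmetric]) auto
  ultimately have "mat_inv V *\<^sub>v z = y" using inv' y by simp
  then have "z \<bullet> (mat_inv V *\<^sub>v z) = z \<bullet> w - c * (z \<bullet> u)"
    using z by (simp add: y_def scalar_prod_minus_distrib[of _ n])
  then show ?thesis
    by (simp add: zu c_def V_def w_def power2_eq_square)
qed

section \<open>Gaussian mixtures and the self-normalised supermartingale\<close>

lemma normal_density_times_exp:
  fixes \<mu> s \<eta> y :: real
  assumes s: "s > 0"
  shows "normal_density \<mu> (sqrt s) y * exp (\<eta> * y - y\<^sup>2 / 2) =
    exp ((2 * \<eta> * \<mu> + \<eta>\<^sup>2 * s - (\<mu> + \<eta> * s)\<^sup>2 / (1 + s) - ln (1 + s)) / 2)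
      * normal_density ((\<mu> + \<eta> * s) / (1 + s)) (sqrt (s / (1 + s))) y"
proof -
  have "sqrt (2 * pi * s) = sqrt (2 * pi * (s / (1 + s))) * sqrt (1 + s)"
    using s by (simp add: real_sqrt_mult[symmetric])
  moreover have "exp (ln (1 + s) / 2) = sqrt (1 + s)"
    using s by (simp add: powr_half_sqrt[symmetric] powr_def)
  ultimately have const: "1 / sqrt (2 * pi * s) = exp (- (ln (1 + s) / 2)) / sqrt (2 * pi * (s / (1 + s)))"
    using s by (simp add: exp_minus divide_simps)
  \<comment> \<open>Completing the square: a normal prior with mean \<mu> and variance
    \<open>s\<close>, multiplied by the likelihood \<open>exp (\<eta> * y - y\<^sup>2 / 2)\<close>,
    is a multiple of the posterior density. The multiple is the change of the exponentiated squared
    noise norm under a rank-one update, its determinant term included.\<close>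
  have expo: "- (y - \<mu>)\<^sup>2 / (2 * s) + (\<eta> * y - y\<^sup>2 / 2) =
    (2 * \<eta> * \<mu> + \<eta>\<^sup>2 * s - (\<mu> + \<eta> * s)\<^sup>2 / (1 + s)) / 2
      + - (y - (\<mu> + \<eta> * s) / (1 + s))\<^sup>2 / (2 * (s / (1 + s)))"
  proof -
    define m where "m = (\<mu> + \<eta> * s) / (1 + s)"
    have ms: "\<mu> + \<eta> * s = m * (1 + s)" using s by (simp add: m_def)
    then have mu: "\<mu> = m * (1 + s) - \<eta> * s" by simp
    have "- (y - \<mu>)\<^sup>2 + 2 * s * (\<eta> * y - y\<^sup>2 / 2) =
      s * (2 * \<eta> * \<mu> + \<eta>\<^sup>2 * s - m\<^sup>2 * (1 + s)) - (y - m)\<^sup>2 * (1 + s)"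
      unfolding mu by (simp add: power2_eq_square algebra_simps)
    moreover have "(\<mu> + \<eta> * s)\<^sup>2 / (1 + s) = m\<^sup>2 * (1 + s)"
      unfolding ms using s by (simp add: power2_eq_square)
    ultimately show ?thesis
      unfolding m_def[symmetric] using s by (simp add: divide_simps) (simp add: algebra_simps)
  qed
  have "normal_density \<mu> (sqrt s) y = 1 / sqrt (2 * pi * s) * exp (- (y - \<mu>)\<^sup>2 / (2 * s))"
    using s by (simp add: normal_density_def)
  then have "normal_density \<mu> (sqrt s) y * exp (\<eta> * y - y\<^sup>2 / 2)
    = 1 / sqrt (2 * pi * s) * exp (- (y - \<mu>)\<^sup>2 / (2 * s) + (\<eta> * y - y\<^sup>2 / 2))"
    by (simp only: exp_add mult.assoc)
  also have "\<dots> = exp (- (ln (1 + s) / 2)) / sqrt (2 * pi * (s / (1 + s))) *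
    (exp ((2 * \<eta> * \<mu> + \<eta>\<^sup>2 * s - (\<mu> + \<eta> * s)\<^sup>2 / (1 + s)) / 2)
      * exp (- (y - (\<mu> + \<eta> * s) / (1 + s))\<^sup>2 / (2 * (s / (1 + s)))))"
    unfolding const expo exp_add ..
  also have "\<dots> = exp ((2 * \<eta> * \<mu> + \<eta>\<^sup>2 * s - (\<mu> + \<eta> * s)\<^sup>2 / (1 + s)) / 2 + - (ln (1 + s) / 2))
      * normal_density ((\<mu> + \<eta> * s) / (1 + s)) (sqrt (s / (1 + s))) y"
    using s unfolding exp_add by (simp add: normal_density_def)
  finally show ?thesis by (simp add: diff_divide_distrib)
qed

lemma nn_integral_normal_density:
  "\<sigma> > 0 \<Longrightarrow> (\<integral>\<^sup>+ y. ennreal (normal_density \<mu> \<sigma> y) \<partial>lborel) = 1"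
  by (subst nn_integral_eq_integral) auto

text \<open>The factor by which the self-normalised martingale grows in one step is a Gaussian mixture,
  over \<open>y\<close>, of \<open>exp (\<eta> y - y\<^sup>2 / 2)\<close>. By Tonelli, sub-Gaussianity is needed only at deterministic \<open>y\<close>.\<close>

lemma (in prob_space) subgaussian_mixture_step:
  fixes \<eta> \<mu> s :: "'a \<Rightarrow> real"
  assumes sub: "subalgebra M F"
    and \<eta> [measurable]: "\<eta> \<in> borel_measurable M"
    and sg: "\<And>\<alpha>. AE \<omega> in M. nn_cond_exp M F (\<lambda>\<omega>. ennreal (exp (\<alpha> * \<eta> \<omega>))) \<omega> \<le> ennreal (exp (\<alpha>\<^sup>2 / 2))"
    and GF [measurable]: "G \<in> borel_measurable F" and \<mu>F [measurable]: "\<mu> \<in> borel_measurable F"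
    and sF [measurable]: "s \<in> borel_measurable F"
    and s0: "\<And>\<omega>. \<omega> \<in> space M \<Longrightarrow> 0 \<le> s \<omega>"
    and deg: "\<And>\<omega>. \<omega> \<in> space M \<Longrightarrow> s \<omega> = 0 \<Longrightarrow> \<mu> \<omega> = 0"
  shows "(\<integral>\<^sup>+ \<omega>. G \<omega> * ennreal (exp ((2 * \<eta> \<omega> * \<mu> \<omega> + (\<eta> \<omega>)\<^sup>2 * s \<omega>
      - (\<mu> \<omega> + \<eta> \<omega> * s \<omega>)\<^sup>2 / (1 + s \<omega>) - ln (1 + s \<omega>)) / 2)) \<partial>M) \<le> (\<integral>\<^sup>+ \<omega>. G \<omega> \<partial>M)"
proof -
  interpret S: sigma_finite_subalgebra M F
    by (rule finite_measure_subalgebra_is_sigma_finite) (use sub in \<open>unfold_locales, simp\<close>)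
  interpret pair_sigma_finite M lborel by unfold_locales
  have [measurable]: "G \<in> borel_measurable M" "\<mu> \<in> borel_measurable M" "s \<in> borel_measurable M"
    using GF \<mu>F sF by (simp_all add: measurable_from_subalg[OF sub])
  define K where "K \<omega> = exp ((2 * \<eta> \<omega> * \<mu> \<omega> + (\<eta> \<omega>)\<^sup>2 * s \<omega>
      - (\<mu> \<omega> + \<eta> \<omega> * s \<omega>)\<^sup>2 / (1 + s \<omega>) - ln (1 + s \<omega>)) / 2)" for \<omega>
  have [measurable]: "K \<in> borel_measurable M" unfolding K_def by measurable
  \<comment> \<open>Where \<open>s \<omega> = 0\<close> there is no density to mix with. There
    \<open>deg\<close> gives \<open>\<mu> \<omega> = 0\<close>, hence \<open>K \<omega> = 1\<close>,
    and this part of \<open>G\<close> is carried along unchanged as \<open>G0\<close>.\<close>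
  define G1 where "G1 \<omega> = (if s \<omega> > 0 then G \<omega> else 0)" for \<omega>
  define G0 where "G0 \<omega> = (if s \<omega> > 0 then 0 else G \<omega>)" for \<omega>
  have [measurable]: "G1 \<in> borel_measurable F" "G1 \<in> borel_measurable M" "G0 \<in> borel_measurable M"
    unfolding G1_def G0_def by measurable
  define w where "w \<omega> y = ennreal (1 / sqrt (2 * pi * s \<omega>) * exp (- (y - \<mu> \<omega>)\<^sup>2 / (2 * s \<omega>)))" for \<omega> y
  have w: "w \<omega> y = ennreal (normal_density (\<mu> \<omega>) (sqrt (s \<omega>)) y)" if "\<omega> \<in> space M" for \<omega> y
    using s0[OF that] by (simp add: w_def normal_density_def)
  have [measurable]: "(\<lambda>(\<omega>, y). w \<omega> y) \<in> borel_measurable (M \<Otimes>\<^sub>M lborel)"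
    unfolding w_def by measurable
  have wF [measurable]: "(\<lambda>\<omega>. w \<omega> y) \<in> borel_measurable F" for y
    unfolding w_def by measurable
  have key: "(\<integral>\<^sup>+ y. w \<omega> y * ennreal (exp (\<eta> \<omega> * y - y\<^sup>2 / 2)) \<partial>lborel) = ennreal (K \<omega>)"
    "(\<integral>\<^sup>+ y. w \<omega> y \<partial>lborel) = 1"
    if \<omega>: "\<omega> \<in> space M" and pos: "s \<omega> > 0" for \<omega>
  proof -
    have "(\<integral>\<^sup>+ y. w \<omega> y * ennreal (exp (\<eta> \<omega> * y - y\<^sup>2 / 2)) \<partial>lborel) =
      (\<integral>\<^sup>+ y. ennreal (K \<omega>) * ennreal (normal_density ((\<mu> \<omega> + \<eta> \<omega> * s \<omega>) / (1 + s \<omega>)) (sqrt (s \<omega> / (1 + s \<omega>))) y) \<partial>lborel)"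
      using normal_density_times_exp[OF pos, of "\<mu> \<omega>" _ "\<eta> \<omega>"]
      by (intro nn_integral_cong) (simp add: w[OF \<omega>] K_def ennreal_mult[symmetric])
    also have "\<dots> = ennreal (K \<omega>)"
      using pos by (subst nn_integral_cmult) (auto simp: nn_integral_normal_density)
    finally show "(\<integral>\<^sup>+ y. w \<omega> y * ennreal (exp (\<eta> \<omega> * y - y\<^sup>2 / 2)) \<partial>lborel) = ennreal (K \<omega>)" .
    show "(\<integral>\<^sup>+ y. w \<omega> y \<partial>lborel) = 1"
      using pos by (simp add: w[OF \<omega>] nn_integral_normal_density)
  qed
  have "(\<integral>\<^sup>+ \<omega>. G1 \<omega> * ennreal (K \<omega>) \<partial>M)
    = (\<integral>\<^sup>+ \<omega>. (\<integral>\<^sup>+ y. G1 \<omega> * (w \<omega> y * ennreal (exp (\<eta> \<omega> * y - y\<^sup>2 / 2))) \<partial>lborel) \<partial>M)"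
  proof (rule nn_integral_cong)
    fix \<omega> assume \<omega>: "\<omega> \<in> space M"
    have [measurable]: "w \<omega> \<in> borel_measurable lborel" unfolding w_def by measurable
    show "G1 \<omega> * ennreal (K \<omega>)
      = (\<integral>\<^sup>+ y. G1 \<omega> * (w \<omega> y * ennreal (exp (\<eta> \<omega> * y - y\<^sup>2 / 2))) \<partial>lborel)"
      using key(1)[OF \<omega>] by (cases "s \<omega> > 0") (auto simp: G1_def nn_integral_cmult)
  qed
  also have "\<dots> = (\<integral>\<^sup>+ y. (\<integral>\<^sup>+ \<omega>. G1 \<omega> * (w \<omega> y * ennreal (exp (\<eta> \<omega> * y - y\<^sup>2 / 2))) \<partial>M) \<partial>lborel)"
    by (rule Fubini'[symmetric]) measurable
  also have "\<dots> \<le> (\<integral>\<^sup>+ y. (\<integral>\<^sup>+ \<omega>. G1 \<omega> * w \<omega> y \<partial>M) \<partial>lborel)"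
  proof (rule nn_integral_mono)
    fix y :: real
    \<comment> \<open>With \<open>y\<close> now a constant, all factors other than
      \<open>exp (y * \<eta> \<omega>)\<close> are \<open>F\<close>-measurable and can be pulled
      out; the conditional bound \<open>exp (y\<^sup>2 / 2)\<close> then cancels the Gaussian factor
      contained in \<open>N\<close>.\<close>
    define N where "N \<omega> = G1 \<omega> * w \<omega> y * ennreal (exp (- y\<^sup>2 / 2))" for \<omega>
    have [measurable]: "N \<in> borel_measurable F" "N \<in> borel_measurable M"
      unfolding N_def by measurable
    have "(\<integral>\<^sup>+ \<omega>. G1 \<omega> * (w \<omega> y * ennreal (exp (\<eta> \<omega> * y - y\<^sup>2 / 2))) \<partial>M)
      = (\<integral>\<^sup>+ \<omega>. N \<omega> * ennreal (exp (y * \<eta> \<omega>)) \<partial>M)"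
      by (intro nn_integral_cong) (simp add: N_def mult.assoc ennreal_mult[symmetric]
          exp_add[symmetric] mult.commute[of y])
    also have "\<dots> = (\<integral>\<^sup>+ \<omega>. N \<omega> * nn_cond_exp M F (\<lambda>\<omega>. ennreal (exp (y * \<eta> \<omega>))) \<omega> \<partial>M)"
      by (rule S.nn_cond_exp_intg[symmetric]) measurable
    also have "\<dots> \<le> (\<integral>\<^sup>+ \<omega>. N \<omega> * ennreal (exp (y\<^sup>2 / 2)) \<partial>M)"
      using sg[of y] by (intro nn_integral_mono_AE) (auto elim!: eventually_mono intro: mult_left_mono)
    also have "\<dots> = (\<integral>\<^sup>+ \<omega>. G1 \<omega> * w \<omega> y \<partial>M)"
      by (intro nn_integral_cong) (simp add: N_def mult.assoc ennreal_mult[symmetric] exp_add[symmetric])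
    finally show "(\<integral>\<^sup>+ \<omega>. G1 \<omega> * (w \<omega> y * ennreal (exp (\<eta> \<omega> * y - y\<^sup>2 / 2))) \<partial>M) \<le> (\<integral>\<^sup>+ \<omega>. G1 \<omega> * w \<omega> y \<partial>M)" .
  qed
  also have "\<dots> = (\<integral>\<^sup>+ \<omega>. (\<integral>\<^sup>+ y. G1 \<omega> * w \<omega> y \<partial>lborel) \<partial>M)"
    by (rule Fubini') measurable
  also have "\<dots> = (\<integral>\<^sup>+ \<omega>. G1 \<omega> \<partial>M)"
  proof (rule nn_integral_cong)
    fix \<omega> assume \<omega>: "\<omega> \<in> space M"
    have [measurable]: "w \<omega> \<in> borel_measurable lborel" unfolding w_def by measurable
    show "(\<integral>\<^sup>+ y. G1 \<omega> * w \<omega> y \<partial>lborel) = G1 \<omega>"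
      using key(2)[OF \<omega>] by (cases "s \<omega> > 0") (auto simp: G1_def nn_integral_cmult)
  qed
  finally have 1: "(\<integral>\<^sup>+ \<omega>. G1 \<omega> * ennreal (K \<omega>) \<partial>M) \<le> (\<integral>\<^sup>+ \<omega>. G1 \<omega> \<partial>M)" .
  have "(\<integral>\<^sup>+ \<omega>. G \<omega> * ennreal (K \<omega>) \<partial>M) = (\<integral>\<^sup>+ \<omega>. G1 \<omega> * ennreal (K \<omega>) + G0 \<omega> \<partial>M)"
  proof (rule nn_integral_cong)
    fix \<omega> assume \<omega>: "\<omega> \<in> space M"
    have "K \<omega> = 1" if "\<not> s \<omega> > 0"
      using that s0[OF \<omega>] deg[OF \<omega>] by (simp add: K_def)
    then show "G \<omega> * ennreal (K \<omega>) = G1 \<omega> * ennreal (K \<omega>) + G0 \<omega>"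
      by (auto simp: G1_def G0_def)
  qed
  also have "\<dots> = (\<integral>\<^sup>+ \<omega>. G1 \<omega> * ennreal (K \<omega>) \<partial>M) + (\<integral>\<^sup>+ \<omega>. G0 \<omega> \<partial>M)"
    by (rule nn_integral_add) measurable
  also have "\<dots> \<le> (\<integral>\<^sup>+ \<omega>. G1 \<omega> \<partial>M) + (\<integral>\<^sup>+ \<omega>. G0 \<omega> \<partial>M)" using 1 by (rule add_right_mono)
  also have "\<dots> = (\<integral>\<^sup>+ \<omega>. G1 \<omega> + G0 \<omega> \<partial>M)"
    by (rule nn_integral_add[symmetric]) measurable
  also have "\<dots> = (\<integral>\<^sup>+ \<omega>. G \<omega> \<partial>M)"
    by (intro nn_integral_cong) (auto simp: G1_def G0_def)
  finally show ?thesis unfolding K_def .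
qed

text \<open>The method of mixtures. \<open>Q\<close> will be the squared norm of the accumulated
  noise in the metric of the inverse design matrix; \<open>QSuc\<close> is what the Sherman-Morrison
  formula yields for it, and the sum of logarithms is the growth of the log-determinant. Each step
  is an instance of \<open>subgaussian_mixture_step\<close>.\<close>

lemma (in prob_space) self_normalised_bound:
  fixes \<eta> \<mu> s Q :: "nat \<Rightarrow> 'a \<Rightarrow> real" and F :: "nat \<Rightarrow> 'a measure"
  assumes sub: "\<And>n. n < N \<Longrightarrow> subalgebra M (F n)"
    and \<eta>: "\<And>n. n < N \<Longrightarrow> \<eta> n \<in> borel_measurable M"
    and sg: "\<And>n \<alpha>. n < N \<Longrightarrow> AE \<omega> in M.
      nn_cond_exp M (F n) (\<lambda>\<omega>. ennreal (exp (\<alpha> * \<eta> n \<omega>))) \<omega> \<le> ennreal (exp (\<alpha>\<^sup>2 / 2))"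
    and QF: "\<And>n. n < N \<Longrightarrow> Q n \<in> borel_measurable (F n)"
    and \<mu>F: "\<And>n. n < N \<Longrightarrow> \<mu> n \<in> borel_measurable (F n)"
    and sF: "\<And>n k. n < N \<Longrightarrow> k \<le> n \<Longrightarrow> s k \<in> borel_measurable (F n)"
    and s0: "\<And>n \<omega>. \<omega> \<in> space M \<Longrightarrow> n < N \<Longrightarrow> 0 \<le> s n \<omega>"
    and deg: "\<And>n \<omega>. \<omega> \<in> space M \<Longrightarrow> n < N \<Longrightarrow> s n \<omega> = 0 \<Longrightarrow> \<mu> n \<omega> = 0"
    and Q0: "\<And>\<omega>. \<omega> \<in> space M \<Longrightarrow> Q 0 \<omega> = 0"
    and QSuc: "\<And>n \<omega>. \<omega> \<in> space M \<Longrightarrow> n < N \<Longrightarrow> Q (Suc n) \<omega> = Q n \<omega> +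
      (2 * \<eta> n \<omega> * \<mu> n \<omega> + (\<eta> n \<omega>)\<^sup>2 * s n \<omega> - (\<mu> n \<omega> + \<eta> n \<omega> * s n \<omega>)\<^sup>2 / (1 + s n \<omega>))"
    and n: "n \<le> N"
  shows "(\<integral>\<^sup>+ \<omega>. ennreal (exp ((Q n \<omega> - (\<Sum>k<n. ln (1 + s k \<omega>))) / 2)) \<partial>M) \<le> 1"
  using n
proof (induction n)
  case 0
  have "(\<integral>\<^sup>+ \<omega>. ennreal (exp ((Q 0 \<omega> - (\<Sum>k<0. ln (1 + s k \<omega>))) / 2)) \<partial>M) = (\<integral>\<^sup>+ \<omega>. 1 \<partial>M)"
    using Q0 by (intro nn_integral_cong) simp
  then show ?case by (simp add: emeasure_space_1)
next
  case (Suc n)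
  then have n: "n < N" by simp
  define G where "G \<omega> = ennreal (exp ((Q n \<omega> - (\<Sum>k<n. ln (1 + s k \<omega>))) / 2))" for \<omega>
  have [measurable]: "Q n \<in> borel_measurable (F n)" by (rule QF[OF n])
  have [measurable]: "k \<in> {..<n} \<Longrightarrow> s k \<in> borel_measurable (F n)" for k using sF[OF n, of k] by simp
  have [measurable]: "G \<in> borel_measurable (F n)" unfolding G_def by measurable
  have "(\<integral>\<^sup>+ \<omega>. ennreal (exp ((Q (Suc n) \<omega> - (\<Sum>k<Suc n. ln (1 + s k \<omega>))) / 2)) \<partial>M)
    = (\<integral>\<^sup>+ \<omega>. G \<omega> * ennreal (exp ((2 * \<eta> n \<omega> * \<mu> n \<omega> + (\<eta> n \<omega>)\<^sup>2 * s n \<omega>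
      - (\<mu> n \<omega> + \<eta> n \<omega> * s n \<omega>)\<^sup>2 / (1 + s n \<omega>) - ln (1 + s n \<omega>)) / 2)) \<partial>M)"
  proof (rule nn_integral_cong)
    fix \<omega> assume \<omega>: "\<omega> \<in> space M"
    have "(Q (Suc n) \<omega> - (\<Sum>k<Suc n. ln (1 + s k \<omega>))) / 2 =
      (Q n \<omega> - (\<Sum>k<n. ln (1 + s k \<omega>))) / 2 + (2 * \<eta> n \<omega> * \<mu> n \<omega> + (\<eta> n \<omega>)\<^sup>2 * s n \<omega>
      - (\<mu> n \<omega> + \<eta> n \<omega> * s n \<omega>)\<^sup>2 / (1 + s n \<omega>) - ln (1 + s n \<omega>)) / 2"
      unfolding QSuc[OF \<omega> n] sum.lessThan_Suc by (simp add: diff_divide_distrib add_divide_distrib)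
    then show "ennreal (exp ((Q (Suc n) \<omega> - (\<Sum>k<Suc n. ln (1 + s k \<omega>))) / 2)) = G \<omega> *
      ennreal (exp ((2 * \<eta> n \<omega> * \<mu> n \<omega> + (\<eta> n \<omega>)\<^sup>2 * s n \<omega>
      - (\<mu> n \<omega> + \<eta> n \<omega> * s n \<omega>)\<^sup>2 / (1 + s n \<omega>) - ln (1 + s n \<omega>)) / 2))"
      by (simp only: G_def exp_add ennreal_mult exp_ge_zero)
  qed
  also have "\<dots> \<le> (\<integral>\<^sup>+ \<omega>. G \<omega> \<partial>M)"
    by (rule subgaussian_mixture_step[OF sub[OF n] \<eta>[OF n] sg[OF n] _ \<mu>F[OF n] sF[OF n order_refl]])
       (use s0 deg n in auto)
  also have "\<dots> \<le> 1" using Suc by (simp add: G_def)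
  finally show ?case .
qed

section \<open>Conditional lower bounds and the Azuma-Hoeffding argument\<close>

lemma (in prob_space) nn_integral_indicator_ge:
  assumes sub: "subalgebra M F" and A: "A \<in> events" and c: "c \<ge> 0"
    and ge: "\<And>E. E \<in> sets F \<Longrightarrow> c * prob E \<le> prob (A \<inter> E)"
    and f: "f \<in> borel_measurable F"
  shows "ennreal c * (\<integral>\<^sup>+ \<omega>. f \<omega> \<partial>M) \<le> (\<integral>\<^sup>+ \<omega>. f \<omega> * indicator A \<omega> \<partial>M)"
proof -
  have FM: "sets F \<subseteq> events" "space F = space M" using sub by (auto simp: subalgebra_def)
  have fM: "f \<in> borel_measurable M" by (rule measurable_from_subalg[OF sub f])
  \<comment> \<open>The hypothesis \<open>ge\<close> compares two measures on \<open>F\<close>: the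
    one with constant density \<open>c\<close> and the one with density the indicator of
    \<open>A\<close>. Comparison of measures passes to integrals, so no conditional expectation of
    the indicator has to be introduced.\<close>
  define M1 where "M1 = restr_to_subalg (density M (\<lambda>_. ennreal c)) F"
  define M2 where "M2 = restr_to_subalg (density M (indicator A)) F"
  have sub1: "subalgebra (density M (\<lambda>_. ennreal c)) F" "subalgebra (density M (indicator A)) F"
    using sub by (auto simp: subalgebra_def)
  have "integral\<^sup>N M1 f \<le> integral\<^sup>N M2 f"
  proof (rule nn_integral_mono_measure)
    show s: "sets M1 = sets M2" using sub1 by (simp add: M1_def M2_def sets_restr_to_subalg)
    have "emeasure M1 \<le> emeasure M2"
    proof (rule le_funI)
      fix E
      show "emeasure M1 E \<le> emeasure M2 E"
      proof (cases "E \<in> sets F")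
        case True
        then have E: "E \<in> events" using FM by auto
        have "emeasure M1 E = ennreal (c * prob E)"
          using True E c sub1 unfolding M1_def
          by (simp add: emeasure_restr_to_subalg emeasure_density_const emeasure_eq_measure ennreal_mult)
        also have "\<dots> \<le> ennreal (prob (A \<inter> E))" using ge[OF True] by (rule ennreal_leI)
        also have "\<dots> = emeasure M2 E"
          using True E A sub1 unfolding M2_def
          by (simp add: emeasure_restr_to_subalg emeasure_density emeasure_eq_measure
              indicator_inter_arith[symmetric])
        finally show ?thesis .
      next
        case False
        then have "emeasure M1 E = 0"
          by (intro emeasure_notin_sets) (simp add: M1_def sets_restr_to_subalg[OF sub1(1)])
        then show ?thesis by simp
      qed
    qed
    then show "M1 \<le> M2" using s sets_eq_imp_space_eq[OF s] by (simp add: le_measure_iff)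
  qed
  moreover have "integral\<^sup>N M1 f = ennreal c * (\<integral>\<^sup>+ \<omega>. f \<omega> \<partial>M)"
    unfolding M1_def using fM
    by (subst nn_integral_subalgebra2[OF sub1(1) f]) (simp add: nn_integral_density nn_integral_cmult)
  moreover have "integral\<^sup>N M2 f = (\<integral>\<^sup>+ \<omega>. f \<omega> * indicator A \<omega> \<partial>M)"
    unfolding M2_def using fM A
    by (subst nn_integral_subalgebra2[OF sub1(2) f]) (simp add: nn_integral_density mult.commute)
  ultimately show ?thesis by simp
qed

text \<open>For negative \<open>y = - z\<close> the claim says that \<open>1 - z + z\<^sup>2\<close>
  times \<open>exp z\<close> is at least 1; this already holds with the quadratic Taylor polynomial
  in place of \<open>exp z\<close>.\<close>

lemma exp_le_quadratic:
  fixes y :: real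
  assumes "y \<le> 1"
  shows "exp y \<le> 1 + y + y\<^sup>2"
proof (cases "0 \<le> y")
  case True
  then show ?thesis using exp_bound assms by simp
next
  case False
  define z where "z = - y"
  have z: "z > 0" using False by (simp add: z_def)
  have "(1 - z + z\<^sup>2) * (1 + z + z\<^sup>2 / 2) = 1 + (z\<^sup>2 / 2 + z ^ 3 / 2 + z ^ 4 / 2)"
    by (simp add: power2_eq_square power3_eq_cube power4_eq_xxxx field_simps)
  then have "1 \<le> (1 - z + z\<^sup>2) * (1 + z + z\<^sup>2 / 2)" using z by simp
  also have "\<dots> \<le> (1 - z + z\<^sup>2) * exp z"
  proof (rule mult_left_mono)
    show "1 + z + z\<^sup>2 / 2 \<le> exp z" using exp_lower_Taylor_quadratic[of z] z by simp
    have "0 \<le> (1 - z / 2)\<^sup>2 + 3 / 4 * z\<^sup>2" by simp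
    then show "0 \<le> 1 - z + z\<^sup>2" by (simp add: power2_eq_square algebra_simps)
  qed
  finally have "exp (- z) \<le> 1 - z + z\<^sup>2" by (simp add: exp_minus field_simps)
  then show ?thesis by (simp add: z_def)
qed

text \<open>The supermartingale \<open>exp (x \<Sum>(c Z - W))\<close> of the Azuma-Hoeffding argument; no conditional
  expectation of \<open>W\<close> is needed, because \<open>Z \<le> W\<close> on an event of conditional probability at least \<open>c\<close>.\<close>

lemma (in prob_space) azuma_step:
  fixes N Z W :: "'a \<Rightarrow> real"
  assumes sub: "subalgebra M F" and A [measurable]: "A \<in> events" and c: "0 \<le> c" "c \<le> 1"
    and ge: "\<And>E. E \<in> sets F \<Longrightarrow> c * prob E \<le> prob (A \<inter> E)"
    and ZF: "Z \<in> borel_measurable F" and Z: "\<And>\<omega>. \<omega> \<in> space M \<Longrightarrow> 0 \<le> Z \<omega> \<and> Z \<omega> \<le> 1"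
    and WM [measurable]: "W \<in> borel_measurable M" and W: "\<And>\<omega>. \<omega> \<in> space M \<Longrightarrow> 0 \<le> W \<omega> \<and> W \<omega> \<le> 1"
    and ZW: "\<And>\<omega>. \<omega> \<in> A \<Longrightarrow> Z \<omega> \<le> W \<omega>"
    and NF: "N \<in> borel_measurable F" and N: "\<And>\<omega>. \<omega> \<in> space M \<Longrightarrow> 0 \<le> N \<omega> \<and> N \<omega> \<le> C"
    and x: "0 \<le> x" "x \<le> 1"
  shows "expectation (\<lambda>\<omega>. N \<omega> * exp (x * (c * Z \<omega> - W \<omega>))) \<le> exp (x\<^sup>2) * expectation N"
proof -
  have [measurable]: "Z \<in> borel_measurable M" "N \<in> borel_measurable M"
    using measurable_from_subalg[OF sub] ZF NF by auto
  have int: "integrable M f" if "f \<in> borel_measurable M" "\<And>\<omega>. \<omega> \<in> space M \<Longrightarrow> \<bar>f \<omega>\<bar> \<le> K" for f :: "'a \<Rightarrow> real" and K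
    using that by (intro integrable_const_bound[of _ K]) auto
  have C: "0 \<le> C" using N not_empty by force
  have iN: "integrable M N" by (rule int[of _ C]) (use N in auto)
  have NZ: "0 \<le> N \<omega> * Z \<omega>" "N \<omega> * Z \<omega> \<le> C" "0 \<le> N \<omega> * W \<omega>" "N \<omega> * W \<omega> \<le> C"
    if "\<omega> \<in> space M" for \<omega>
    using N[OF that] Z[OF that] W[OF that] C
      mult_mono[of "N \<omega>" C "Z \<omega>" 1] mult_mono[of "N \<omega>" C "W \<omega>" 1] by auto
  have iNZ: "integrable M (\<lambda>\<omega>. N \<omega> * Z \<omega>)" and iNW: "integrable M (\<lambda>\<omega>. N \<omega> * W \<omega>)"
    by (rule int[of _ C]; use NZ in \<open>auto simp: abs_of_nonneg\<close>)+
  have iNZA: "integrable M (\<lambda>\<omega>. N \<omega> * Z \<omega> * indicator A \<omega>)"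
    by (rule integrable_mult_indicator[OF A iNZ, simplified, unfolded mult.commute[of "indicator A _"]])
  have "ennreal c * (\<integral>\<^sup>+ \<omega>. ennreal (N \<omega> * Z \<omega>) \<partial>M) \<le> (\<integral>\<^sup>+ \<omega>. ennreal (N \<omega> * Z \<omega>) * indicator A \<omega> \<partial>M)"
    by (rule nn_integral_indicator_ge[OF sub A c(1) ge]) (use ZF NF in auto)
  also have "(\<integral>\<^sup>+ \<omega>. ennreal (N \<omega> * Z \<omega>) * indicator A \<omega> \<partial>M) =
    (\<integral>\<^sup>+ \<omega>. ennreal (N \<omega> * Z \<omega> * indicator A \<omega>) \<partial>M)"
    by (intro nn_integral_cong) (auto simp: indicator_def)
  also have "\<dots> = ennreal (expectation (\<lambda>\<omega>. N \<omega> * Z \<omega> * indicator A \<omega>))"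
    by (rule nn_integral_eq_integral[OF iNZA]) (use NZ in auto)
  also have "(\<integral>\<^sup>+ \<omega>. ennreal (N \<omega> * Z \<omega>) \<partial>M) = ennreal (expectation (\<lambda>\<omega>. N \<omega> * Z \<omega>))"
    by (rule nn_integral_eq_integral[OF iNZ]) (use NZ in auto)
  finally have "c * expectation (\<lambda>\<omega>. N \<omega> * Z \<omega>) \<le> expectation (\<lambda>\<omega>. N \<omega> * Z \<omega> * indicator A \<omega>)"
    using c NZ by (simp add: ennreal_mult[symmetric] integral_nonneg_AE)
  also have "\<dots> \<le> expectation (\<lambda>\<omega>. N \<omega> * W \<omega>)"
  proof (rule integral_mono[OF iNZA iNW])
    fix \<omega> assume "\<omega> \<in> space M"
    then show "N \<omega> * Z \<omega> * indicator A \<omega> \<le> N \<omega> * W \<omega>"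
      using ZW[of \<omega>] N NZ(3) by (auto simp: indicator_def intro: mult_left_mono)
  qed
  finally have drift: "c * expectation (\<lambda>\<omega>. N \<omega> * Z \<omega>) \<le> expectation (\<lambda>\<omega>. N \<omega> * W \<omega>)" .
  have "expectation (\<lambda>\<omega>. N \<omega> * exp (x * (c * Z \<omega> - W \<omega>)))
    \<le> expectation (\<lambda>\<omega>. (1 + x\<^sup>2) * N \<omega> + x * (c * (N \<omega> * Z \<omega>) - N \<omega> * W \<omega>))"
  proof (rule integral_mono)
    \<comment> \<open>Both \<open>c * Z \<omega>\<close> and \<open>W \<omega>\<close> lie in the
      unit interval, so their difference has absolute value at most 1. Hence
      \<open>exp_le_quadratic\<close> applies for \<open>x \<le> 1\<close>, with second-order term
      at most \<open>x\<^sup>2\<close>; this is the source of the factor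
      \<open>exp (x\<^sup>2)\<close>.\<close>
    have bnd: "\<bar>x * (c * Z \<omega> - W \<omega>)\<bar> \<le> x" if "\<omega> \<in> space M" for \<omega>
    proof -
      have "0 \<le> c * Z \<omega>" "c * Z \<omega> \<le> 1" using Z[OF that] c mult_mono[of c 1 "Z \<omega>" 1] by auto
      then have "\<bar>c * Z \<omega> - W \<omega>\<bar> \<le> 1" using W[OF that] by auto
      then show ?thesis using x mult_left_mono[of "\<bar>c * Z \<omega> - W \<omega>\<bar>" 1 x] by (simp add: abs_mult)
    qed
    show "integrable M (\<lambda>\<omega>. N \<omega> * exp (x * (c * Z \<omega> - W \<omega>)))"
    proof (rule int[of _ "C * exp 1"])
      fix \<omega> assume "\<omega> \<in> space M"
      then show "\<bar>N \<omega> * exp (x * (c * Z \<omega> - W \<omega>))\<bar> \<le> C * exp 1"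
        using abs_le_D1[OF order_trans[OF bnd[of \<omega>] x(2)]] N[of \<omega>] C
        by (auto simp: abs_mult intro!: mult_mono)
    qed measurable
    show "integrable M (\<lambda>\<omega>. (1 + x\<^sup>2) * N \<omega> + x * (c * (N \<omega> * Z \<omega>) - N \<omega> * W \<omega>))"
      using iN iNZ iNW by auto
    fix \<omega> assume \<omega>: "\<omega> \<in> space M"
    define y where "y = x * (c * Z \<omega> - W \<omega>)"
    have y: "\<bar>y\<bar> \<le> x" unfolding y_def by (rule bnd[OF \<omega>])
    then have "exp y \<le> 1 + y + y\<^sup>2" using x by (intro exp_le_quadratic) auto
    also have "y\<^sup>2 \<le> x\<^sup>2" using y by (rule power2_le_iff_abs_le[THEN iffD2, rotated]) (use x in auto)
    finally have "N \<omega> * exp y \<le> N \<omega> * (1 + y + x\<^sup>2)" using N[OF \<omega>] by (intro mult_left_mono) auto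
    then show "N \<omega> * exp (x * (c * Z \<omega> - W \<omega>)) \<le> (1 + x\<^sup>2) * N \<omega> + x * (c * (N \<omega> * Z \<omega>) - N \<omega> * W \<omega>)"
      unfolding y_def by (simp add: algebra_simps)
  qed
  also have "\<dots> = (1 + x\<^sup>2) * expectation N + x * (c * expectation (\<lambda>\<omega>. N \<omega> * Z \<omega>) - expectation (\<lambda>\<omega>. N \<omega> * W \<omega>))"
    using iN iNZ iNW by simp
  also have "\<dots> \<le> (1 + x\<^sup>2) * expectation N"
    using drift x by (simp add: mult_nonneg_nonpos)
  also have "\<dots> \<le> exp (x\<^sup>2) * expectation N"
    using N exp_ge_add_one_self[of "x\<^sup>2"] by (intro mult_right_mono) (auto intro!: integral_nonneg_AE)
  finally show ?thesis .
qed

text \<open>Chernoff's method with \<open>azuma_step\<close> iterated over the rounds.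
  \<open>F t\<close> is the information before the sample of round \<open>t\<close> is drawn:
  \<open>Z t\<close> is known by then, whereas \<open>W t\<close> becomes known only later, and so
  only earlier \<open>W s\<close> are asked to be \<open>F t\<close>-measurable.\<close>

lemma (in prob_space) azuma_bound:
  fixes Z W :: "nat \<Rightarrow> 'a \<Rightarrow> real" and F :: "nat \<Rightarrow> 'a measure"
  assumes sub: "\<And>t. t \<in> {1..T} \<Longrightarrow> subalgebra M (F t)"
    and A: "\<And>t. t \<in> {1..T} \<Longrightarrow> A t \<in> events" and c: "0 \<le> c" "c \<le> 1"
    and ge: "\<And>t E. t \<in> {1..T} \<Longrightarrow> E \<in> sets (F t) \<Longrightarrow> c * prob E \<le> prob (A t \<inter> E)"
    and ZF: "\<And>s t. t \<in> {1..T} \<Longrightarrow> s \<in> {1..t} \<Longrightarrow> Z s \<in> borel_measurable (F t)"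
    and Z: "\<And>t \<omega>. \<omega> \<in> space M \<Longrightarrow> t \<in> {1..T} \<Longrightarrow> 0 \<le> Z t \<omega> \<and> Z t \<omega> \<le> 1"
    and WF: "\<And>s t. t \<in> {1..T} \<Longrightarrow> s \<in> {1..<t} \<Longrightarrow> W s \<in> borel_measurable (F t)"
    and WM: "\<And>t. t \<in> {1..T} \<Longrightarrow> W t \<in> borel_measurable M"
    and W: "\<And>t \<omega>. \<omega> \<in> space M \<Longrightarrow> t \<in> {1..T} \<Longrightarrow> 0 \<le> W t \<omega> \<and> W t \<omega> \<le> 1"
    and ZW: "\<And>t \<omega>. t \<in> {1..T} \<Longrightarrow> \<omega> \<in> A t \<Longrightarrow> Z t \<omega> \<le> W t \<omega>"
    and T: "T \<ge> 1" and u: "u > 0"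
  shows "prob {\<omega> \<in> space M. (\<Sum>t = 1..T. c * Z t \<omega> - W t \<omega>) \<ge> u} \<le> exp (- u\<^sup>2 / (4 * T))"
proof -
  have le1: "c * Z t \<omega> - W t \<omega> \<le> 1" if "\<omega> \<in> space M" "t \<in> {1..T}" for t \<omega>
    using Z[OF that] W[OF that] c mult_mono[of c 1 "Z t \<omega>" 1] by auto
  show ?thesis
  proof (cases "u > T")
    case True
    have "(\<Sum>t = 1..T. c * Z t \<omega> - W t \<omega>) < u" if "\<omega> \<in> space M" for \<omega>
    proof -
      have "(\<Sum>t = 1..T. c * Z t \<omega> - W t \<omega>) \<le> (\<Sum>t = 1..T. 1)"
        by (rule sum_mono) (use le1 that in auto)
      then show ?thesis using True by simp
    qed
    then have "{\<omega> \<in> space M. (\<Sum>t = 1..T. c * Z t \<omega> - W t \<omega>) \<ge> u} = {}" by force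
    then show ?thesis by (simp only: measure_empty exp_ge_zero)
  next
    case False
    \<comment> \<open>The minimiser of \<open>T * x\<^sup>2 - x * u\<close>. Here
      \<open>u \<le> T\<close> ensures \<open>x \<le> 1\<close>; a larger \<open>u\<close> is out of
      reach, since each of the \<open>T\<close> summands is at most 1.\<close>
    define x where "x = u / (2 * T)"
    have x: "0 \<le> x" "x \<le> 1" using u False T by (auto simp: x_def field_simps)
    define S where "S n \<omega> = (\<Sum>t = 1..n. c * Z t \<omega> - W t \<omega>)" for n \<omega>
    have ZM: "Z t \<in> borel_measurable M" if "t \<in> {1..T}" for t
      using measurable_from_subalg[OF sub[OF that] ZF[OF that]] that by simp
    have SF: "S n \<in> borel_measurable (F (Suc n))" if "Suc n \<le> T" for n
      unfolding S_def using that
      by (intro borel_measurable_sum borel_measurable_diff borel_measurable_times ZF WF) auto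
    have SM: "S n \<in> borel_measurable M" if "n \<le> T" for n
      unfolding S_def using that
      by (intro borel_measurable_sum borel_measurable_diff borel_measurable_times ZM WM) auto
    have Sle: "S n \<omega> \<le> n" if "\<omega> \<in> space M" "n \<le> T" for n \<omega>
    proof -
      have "S n \<omega> \<le> (\<Sum>t = 1..n. 1)" unfolding S_def by (rule sum_mono) (use le1 that in auto)
      then show ?thesis by simp
    qed
    have bnd: "0 \<le> exp (x * S n \<omega>) \<and> exp (x * S n \<omega>) \<le> exp (x * n)" if "\<omega> \<in> space M" "n \<le> T" for n \<omega>
      using Sle[OF that] x by (auto intro: mult_left_mono)
    have exp: "expectation (\<lambda>\<omega>. exp (x * S n \<omega>)) \<le> exp (x\<^sup>2) ^ n" if "n \<le> T" for n
      using that
    proof (induction n)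
      case 0
      then show ?case by (simp add: S_def prob_space)
    next
      case (Suc n)
      have n: "Suc n \<in> {1..T}" using Suc.prems by simp
      have "expectation (\<lambda>\<omega>. exp (x * S (Suc n) \<omega>))
        = expectation (\<lambda>\<omega>. exp (x * S n \<omega>) * exp (x * (c * Z (Suc n) \<omega> - W (Suc n) \<omega>)))"
        by (intro Bochner_Integration.integral_cong) (simp_all add: S_def exp_add[symmetric] algebra_simps)
      also have "\<dots> \<le> exp (x\<^sup>2) * expectation (\<lambda>\<omega>. exp (x * S n \<omega>))"
        by (rule azuma_step[OF sub[OF n] A[OF n] c ge[OF n] ZF[OF n] Z[OF _ n] WM[OF n] W[OF _ n] ZW[OF n]])
           (use SF[of n] n bnd[of _ n] x in auto)
      also have "\<dots> \<le> exp (x\<^sup>2) * exp (x\<^sup>2) ^ n" using Suc by (intro mult_left_mono) auto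
      finally show ?case by simp
    qed
    have [measurable]: "S T \<in> borel_measurable M" by (rule SM) simp
    have int: "integrable M (\<lambda>\<omega>. exp (x * S T \<omega>))"
      by (rule integrable_const_bound[of _ "exp (x * T)"]) (use bnd[of _ T] in auto)
    have "prob {\<omega> \<in> space M. S T \<omega> \<ge> u} \<le> prob {\<omega> \<in> space M. exp (x * u) \<le> exp (x * S T \<omega>)}"
      using x by (intro finite_measure_mono) (auto intro: mult_left_mono)
    also have "\<dots> \<le> expectation (\<lambda>\<omega>. exp (x * S T \<omega>)) / exp (x * u)"
      by (rule integral_Markov_inequality_measure[OF int, of "{}"]) auto
    also have "\<dots> \<le> exp (x\<^sup>2) ^ T / exp (x * u)" using exp[of T] by (intro divide_right_mono) auto
    also have "\<dots> = exp (T * x\<^sup>2 - x * u)" by (simp add: exp_of_nat_mult[symmetric] exp_diff)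
    also have "T * x\<^sup>2 - x * u = - u\<^sup>2 / (4 * T)"
      using T by (simp add: x_def power2_eq_square field_simps)
    finally show ?thesis by (simp add: S_def)
  qed
qed

lemma vnorm_diff_le:
  assumes "u \<in> carrier_vec d" "v \<in> carrier_vec d"
  shows "vnorm (u - v) \<le> vnorm u + vnorm v"
proof -
  have "u - v = u + (-1) \<cdot>\<^sub>v v" using assms by (intro eq_vecI) auto
  then show ?thesis
    using vnorm_add_le[OF assms(1), of "(-1) \<cdot>\<^sub>v v"] assms(2) vnorm_smult[of "-1" v] by simp
qed

subsection \<open>Rounding to the grid\<close>

text \<open>Passing from coordinates to the Euclidean norm costs only a factor
  \<open>sqrt d\<close>, which the mesh \<open>c / d\<close> more than compensates.\<close>

lemma vnorm_le_of_coords: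
  assumes v: "v \<in> carrier_vec d" and c: "\<And>i. i < d \<Longrightarrow> \<bar>v $ i\<bar> \<le> c / d" and d: "d \<ge> 1" and c0: "0 \<le> c"
  shows "vnorm v \<le> c"
proof -
  have "v \<bullet> v = (\<Sum>i<d. (v $ i)\<^sup>2)"
    using v by (simp add: scalar_prod_def power2_eq_square atLeast0LessThan)
  also have "\<dots> \<le> (\<Sum>i<d. (c / d)\<^sup>2)"
    using power_mono[OF c abs_ge_zero, of _ 2] by (intro sum_mono) auto
  also have "\<dots> = c\<^sup>2 / d" using d by (simp add: power2_eq_square field_simps)
  also have "\<dots> \<le> c\<^sup>2" using d by (simp add: divide_le_eq mult_le_cancel_left1)
  finally show ?thesis unfolding vnorm_def using c0 real_le_lsqrt by blast
qed

lemma abs_index_le_vnorm: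
  assumes v: "v \<in> carrier_vec d" and i: "i < d"
  shows "\<bar>v $ i\<bar> \<le> vnorm v"
proof -
  have "(v $ i)\<^sup>2 \<le> (\<Sum>i<d. (v $ i)\<^sup>2)" using i by (intro member_le_sum) auto
  also have "\<dots> = (vnorm v)\<^sup>2"
    unfolding vnorm_power2 using v by (simp add: scalar_prod_def power2_eq_square atLeast0LessThan)
  finally show ?thesis using abs_le_square_iff[of "v $ i" "vnorm v"] by simp
qed

lemma grid_subset:
  assumes d: "d \<ge> 1" and e: "\<epsilon> > 0"
  defines "m \<equiv> \<lfloor>d / \<epsilon>\<rfloor>"
  shows "grid d \<epsilon> \<subseteq> vec d ` (PiE {..<d} (\<lambda>_. (\<lambda>k. of_int k * (\<epsilon> / d)) ` {- m..m}))"
proof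
  fix z assume z: "z \<in> grid d \<epsilon>"
  then have zc: "z \<in> carrier_vec d" "vnorm z \<le> 1" by (auto simp: grid_def unit_ball_def)
  have "z $ i \<in> (\<lambda>k. of_int k * (\<epsilon> / d)) ` {- m..m}" if i: "i < d" for i
  proof -
    obtain k :: int where k: "z $ i = of_int k * (\<epsilon> / d)" using z i by (auto simp: grid_def)
    have "\<bar>of_int k * (\<epsilon> / d)\<bar> \<le> 1" using abs_index_le_vnorm[OF zc(1) i] zc(2) k by simp
    then have "\<bar>of_int k\<bar> \<le> d / \<epsilon>" using d e by (simp add: abs_mult field_simps)
    then have "of_int \<bar>k\<bar> \<le> d / \<epsilon>" by simp
    then have "\<bar>k\<bar> \<le> m" unfolding m_def by (subst le_floor_iff)
    then show ?thesis unfolding k by (intro imageI) auto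
  qed
  then have "(\<lambda>i\<in>{..<d}. z $ i) \<in> PiE {..<d} (\<lambda>_. (\<lambda>k. of_int k * (\<epsilon> / d)) ` {- m..m})" by auto
  moreover have "z = vec d (\<lambda>i\<in>{..<d}. z $ i)" using zc by (intro eq_vecI) auto
  ultimately show "z \<in> vec d ` (PiE {..<d} (\<lambda>_. (\<lambda>k. of_int k * (\<epsilon> / d)) ` {- m..m}))" by (metis image_eqI)
qed

lemma finite_grid: "d \<ge> 1 \<Longrightarrow> \<epsilon> > 0 \<Longrightarrow> finite (grid d \<epsilon>)"
  by (rule finite_subset[OF grid_subset]) (auto intro: finite_PiE)

lemma card_grid_le:
  assumes d: "d \<ge> 1" and e: "\<epsilon> > 0"
  shows "card (grid d \<epsilon>) \<le> (2 * (d / \<epsilon>) + 1) ^ d"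
proof -
  define m where "m = \<lfloor>d / \<epsilon>\<rfloor>"
  define S where "S = (\<lambda>k. of_int k * (\<epsilon> / real d)) ` {- m..m}"
  have m: "0 \<le> m" using d e by (simp add: m_def)
  have "card (grid d \<epsilon>) \<le> card (vec d ` (PiE {..<d} (\<lambda>_. S)))"
    using grid_subset[OF d e] unfolding m_def S_def by (intro card_mono finite_imageI finite_PiE) auto
  also have "\<dots> \<le> card (PiE {..<d} (\<lambda>_. S))"
    by (intro card_image_le finite_PiE) (auto simp: S_def)
  also have "\<dots> = card S ^ d" by (simp add: card_PiE)
  also have "\<dots> \<le> (nat (2 * m + 1)) ^ d"
    using card_image_le[of "{-m..m}" "\<lambda>k. of_int k * (\<epsilon> / real d)"] unfolding S_def by (intro power_mono) auto
  finally have "real (card (grid d \<epsilon>)) \<le> real (nat (2 * m + 1)) ^ d"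
    by (metis of_nat_le_iff of_nat_power)
  also have "\<dots> \<le> (2 * (d / \<epsilon>) + 1) ^ d"
  proof (intro power_mono)
    have "of_int m \<le> d / \<epsilon>" by (simp add: m_def)
    then show "real (nat (2 * m + 1)) \<le> 2 * (d / \<epsilon>) + 1" using m by simp
  qed simp
  finally show ?thesis .
qed

lemma round_query:
  assumes d: "d \<ge> 1" and e: "\<epsilon> > 0" and q: "q \<in> unit_ball d"
  shows "round_query d \<epsilon> q \<in> grid d \<epsilon>" "vnorm (q - round_query d \<epsilon> q) \<le> \<epsilon>"
proof -
  have qc: "q \<in> carrier_vec d" "vnorm q \<le> 1" using q by (auto simp: unit_ball_def)
  define g where "g = \<epsilon> / d"
  have g: "g > 0" using d e by (simp add: g_def)
  \<comment> \<open>The comparison point is rounded towards zero in every coordinate, not to the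
    nearest multiple: no coordinate grows, so the point stays in the unit ball and thus in
    \<open>grid\<close>, while each coordinate moves by at most the mesh \<open>g\<close>.\<close>
  define k where "k i = (if 0 \<le> q $ i then \<lfloor>q $ i / g\<rfloor> else - \<lfloor>- q $ i / g\<rfloor>)" for i
  define z where "z = vec d (\<lambda>i. of_int (k i) * g)"
  have zc: "z \<in> carrier_vec d" by (simp add: z_def)
  have le: "\<bar>of_int (k i) * g\<bar> \<le> \<bar>q $ i\<bar> \<and> \<bar>q $ i - of_int (k i) * g\<bar> \<le> g" for i
  proof -
    have *: "0 \<le> of_int \<lfloor>x / g\<rfloor> * g" "of_int \<lfloor>x / g\<rfloor> * g \<le> x" "x \<le> of_int \<lfloor>x / g\<rfloor> * g + g" if "0 \<le> x" for x
    proof -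
      show "0 \<le> of_int \<lfloor>x / g\<rfloor> * g" using g that by simp
      have ab: "of_int \<lfloor>x / g\<rfloor> \<le> x / g" "x / g \<le> of_int \<lfloor>x / g\<rfloor> + 1" by linarith+
      show "of_int \<lfloor>x / g\<rfloor> * g \<le> x" using ab(1) g pos_le_divide_eq by blast
      have "x \<le> (of_int \<lfloor>x / g\<rfloor> + 1) * g" using ab(2) g pos_divide_le_eq by blast
      then show "x \<le> of_int \<lfloor>x / g\<rfloor> * g + g" by (simp add: distrib_right)
    qed
    show ?thesis using *[of "q $ i"] *[of "- q $ i"] unfolding k_def
      by (cases "0 \<le> q $ i") auto
  qed
  have "z \<bullet> z \<le> q \<bullet> q"
    using le qc by (auto simp: scalar_prod_def z_def power2_eq_square[symmetric] abs_le_square_iff[symmetric]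
        intro!: sum_mono)
  then have "vnorm z \<le> vnorm q" by (simp add: vnorm_def)
  then have z: "z \<in> grid d \<epsilon>" using zc qc
    by (auto simp: grid_def unit_ball_def z_def g_def)
  have fin: "finite (grid d \<epsilon>)" by (rule finite_grid[OF d e])
  have am: "is_arg_min (\<lambda>z. vnorm (q - z)) (\<lambda>x. x \<in> grid d \<epsilon>) (round_query d \<epsilon> q)"
    unfolding round_query_def using arg_min_if_finite[OF fin, of "\<lambda>z. vnorm (q - z)"] z
    by (auto simp: is_arg_min_def)
  then show "round_query d \<epsilon> q \<in> grid d \<epsilon>" by (simp add: is_arg_min_def)
  have "vnorm (q - round_query d \<epsilon> q) \<le> vnorm (q - z)" using am z by (auto simp: is_arg_min_def not_less)
  also have "\<dots> \<le> \<epsilon>"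
    using le qc d e by (intro vnorm_le_of_coords[of _ d]) (auto simp: z_def g_def)
  finally show "vnorm (q - round_query d \<epsilon> q) \<le> \<epsilon>" .
qed

subsection \<open>Adaptive lookup and binary search\<close>

lemma adaptive_lookup_SomeD:
  assumes "adaptive_lookup d \<epsilon> S sts q = Some v"
  obtains st where "st \<in> set sts" "lookup S st (round_query d \<epsilon> q) = Some v"
proof -
  define L where "L = filter (\<lambda>ans. ans \<noteq> None) (map (\<lambda>st. lookup S st (round_query d \<epsilon> q)) sts)"
  have "Some v \<in> set L"
    using assms unfolding adaptive_lookup_def L_def[symmetric] by (cases L) auto
  then show ?thesis using that unfolding L_def by force
qed

lemma adaptive_lookup_None_iff:
  "adaptive_lookup d \<epsilon> S sts q = None \<longleftrightarrow> (\<forall>st \<in> set sts. lookup S st (round_query d \<epsilon> q) = None)"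
proof -
  define L where "L = filter (\<lambda>ans. ans \<noteq> None) (map (\<lambda>st. lookup S st (round_query d \<epsilon> q)) sts)"
  have L: "ans \<noteq> None" if "ans \<in> set L" for ans using that by (auto simp: L_def)
  have "adaptive_lookup d \<epsilon> S sts q = None \<longleftrightarrow> L = []"
    unfolding adaptive_lookup_def L_def[symmetric] using L by (cases L) auto
  also have "\<dots> \<longleftrightarrow> (\<forall>st \<in> set sts. lookup S st (round_query d \<epsilon> q) = None)"
    unfolding L_def by (auto simp: filter_empty_conv)
  finally show ?thesis .
qed

text \<open>The predicate need not be downward closed; the answers of randomised solvers are not.
  What survives is that the search stops at an index that holds and whose successor fails, up to the
  two ends, and the approximation argument needs nothing more.\<close>

lemma binary_search_bounds:
  "lo < hi \<Longrightarrow> lo \<le> binary_search P lo hi \<and> binary_search P lo hi < hi \<and>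
    (binary_search P lo hi = lo \<or> P (binary_search P lo hi)) \<and>
    (Suc (binary_search P lo hi) = hi \<or> \<not> P (Suc (binary_search P lo hi)))"
proof (induction P lo hi rule: binary_search.induct)
  case (1 P lo hi)
  show ?case
  proof (cases "hi \<le> Suc lo")
    case True
    then show ?thesis using 1(3) by (subst (1 2 3 4 5 6) binary_search.simps) auto
  next
    case False
    define m where "m = (lo + hi) div 2"
    have m: "lo < m" "m < hi" using False by (auto simp: m_def)
    show ?thesis
    proof (cases "P m")
      case True
      have "binary_search P lo hi = binary_search P m hi"
        using False True by (subst binary_search.simps) (simp add: m_def)
      then show ?thesis using 1(1)[OF False m_def True m(2)] m True by auto
    next
      case nP: False
      have "binary_search P lo hi = binary_search P lo m"
        using False nP by (subst binary_search.simps) (simp add: m_def)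
      then show ?thesis using 1(2)[OF False m_def nP m(1)] m nP by auto
    qed
  qed
qed

lemma probes_bounds: "i \<in> set (probes P lo hi) \<Longrightarrow> lo < i \<and> i < hi"
proof (induction P lo hi rule: probes.induct)
  case (1 P lo hi)
  show ?case
  proof (cases "hi \<le> Suc lo")
    case True
    then show ?thesis using 1(3) by (subst (asm) probes.simps) auto
  next
    case False
    define m where "m = (lo + hi) div 2"
    have m: "lo < m" "m < hi" using False by (auto simp: m_def)
    have "i = m \<or> P m \<and> i \<in> set (probes P m hi) \<or> \<not> P m \<and> i \<in> set (probes P lo m)"
      using 1(3) False by (subst (asm) probes.simps) (auto simp: m_def Let_def split: if_splits)
    then show ?thesis using 1(1)[OF False m_def] 1(2)[OF False m_def] m by auto
  qed
qed

lemma length_probes_le: "hi - lo \<le> 2 ^ k \<Longrightarrow> length (probes P lo hi) \<le> k"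
proof (induction k arbitrary: lo hi)
  case 0
  then show ?case by (subst probes.simps) auto
next
  case (Suc k)
  show ?case
  proof (cases "hi \<le> Suc lo")
    case True
    then show ?thesis by (subst probes.simps) auto
  next
    case False
    define m where "m = (lo + hi) div 2"
    have "hi - m \<le> 2 ^ k" "m - lo \<le> 2 ^ k" using Suc.prems by (auto simp: m_def)
    then have "length (probes P m hi) \<le> k" "length (probes P lo m) \<le> k" using Suc.IH by auto
    then show ?thesis using False by (subst probes.simps) (auto simp: m_def Let_def)
  qed
qed

subsection \<open>Contents of the solvers\<close>

lemma contents_append: "contents P (us @ vs) = contents (contents P us) vs"
  by (simp add: contents_def)

lemma contents_map_Delete: "contents P (map Delete xs) = P - set xs"
  by (induction xs arbitrary: P) (auto simp: contents_def)

lemma contents_map_Add: "contents P (map Add xs) = P \<union> set xs"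
  by (induction xs arbitrary: P) (auto simp: contents_def)

lemma admissible_append:
  assumes "admissible d K P us" "admissible d K (contents P us) vs"
  shows "admissible d K P (us @ vs)"
  unfolding admissible_def
proof (intro allI impI)
  fix k assume "k \<le> length (us @ vs)"
  then show "finite (contents P (take k (us @ vs))) \<and> card (contents P (take k (us @ vs))) \<le> K \<and>
    contents P (take k (us @ vs)) \<subseteq> unit_ball d"
    using assms unfolding admissible_def
    by (cases "k \<le> length us") (auto simp: contents_append dest: spec[of _ "k - length us"])
qed

lemma admissible_take: "admissible d K P us \<Longrightarrow> admissible d K P (take k us)"
  by (auto simp: admissible_def min_def)

lemma set_list_of: "finite X \<Longrightarrow> set (list_of X) = X \<and> distinct (list_of X)"
  unfolding list_of_def using someI_ex[of "\<lambda>xs. distinct xs \<and> set xs = X"] finite_distinct_list[of X]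
  by blast

lemma length_list_of: "finite X \<Longrightarrow> length (list_of X) = card X"
  using set_list_of distinct_card by metis

lemma contents_list_of_change:
  assumes "finite P" "finite Q"
  shows "contents P (map Delete (list_of (P - Q)) @ map Add (list_of (Q - P))) = Q"
  using assms by (auto simp: contents_append contents_map_Delete contents_map_Add set_list_of)

text \<open>Because deletions come first, every intermediate set is contained in the old or in the
  new set, and the size bound is never exceeded on the way.\<close>

lemma admissible_list_of_change:
  assumes P: "finite P" "card P \<le> K" "P \<subseteq> unit_ball d" and Q: "finite Q" "card Q \<le> K" "Q \<subseteq> unit_ball d"
  shows "admissible d K P (map Delete (list_of (P - Q)) @ map Add (list_of (Q - P)))"
proof (rule admissible_append)
  show "admissible d K P (map Delete (list_of (P - Q)))"
    unfolding admissible_def take_map contents_map_Delete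
    using P card_mono[OF P(1), of "P - _"] by (auto intro: order_trans)
  have "contents P (map Delete (list_of (P - Q))) = P \<inter> Q"
    using P by (auto simp: contents_map_Delete set_list_of)
  moreover have "admissible d K (P \<inter> Q) (map Add (list_of (Q - P)))"
    unfolding admissible_def take_map contents_map_Add
  proof (intro allI impI)
    fix k
    have "P \<inter> Q \<union> set (take k (list_of (Q - P))) \<subseteq> Q"
      using set_take_subset[of k "list_of (Q - P)"] set_list_of[of "Q - P"] Q by auto
    then show "finite (P \<inter> Q \<union> set (take k (list_of (Q - P)))) \<and>
      card (P \<inter> Q \<union> set (take k (list_of (Q - P)))) \<le> K \<and>
      P \<inter> Q \<union> set (take k (list_of (Q - P))) \<subseteq> unit_ball d"
      using Q by (meson card_mono finite_subset order_trans)
  qed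
  ultimately show "admissible d K (contents P (map Delete (list_of (P - Q)))) (map Add (list_of (Q - P)))"
    by simp
qed

section \<open>Reliability of the solvers under adaptive queries\<close>

locale bandit_algorithm =
  fixes B :: "('w, 'a, 's, 'st) bandit_run" and D :: "real vec measure" and C_change :: nat
  assumes bandit: "linear_bandit C_change B"
    and algorithm: "thompson_sampling_run D B"
    and accuracy: "0 < accuracy B" "accuracy B < 1"
    and confidence: "0 < confidence B" "confidence B < 1"
begin

lemma prob_space_run: "prob_space (prob B)"
  using bandit by (simp add: linear_bandit_def)

lemma dim_pos: "dim B \<ge> 1" and horizon_pos: "horizon B \<ge> 1"
  using bandit by (auto simp: linear_bandit_def)

lemma arms: "t \<le> horizon B \<Longrightarrow> finite (arms B t) \<and> arms B t \<noteq> {} \<and> card (arms B t) \<le> size_bound B"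
  using bandit by (auto simp: linear_bandit_def)

lemma size_bound_pos: "size_bound B \<ge> 1"
  using arms[of 0] by (metis card_gt_0_iff le0 less_one linorder_not_less order_trans)

lemma points: "t \<le> horizon B \<Longrightarrow>
    finite (points B t) \<and> card (points B t) \<le> size_bound B \<and> points B t \<subseteq> unit_ball (dim B)"
  using bandit arms[of t] card_image_le[of "arms B t" "feature B"]
  by (auto simp: linear_bandit_def points_def)

lemma feature_in_unit_ball: "t \<le> horizon B \<Longrightarrow> a \<in> arms B t \<Longrightarrow> feature B a \<in> unit_ball (dim B)"
  using points[of t] by (auto simp: points_def)

lemma mips_eps_pos: "0 < mips_eps B" and mips_eps_less_1: "mips_eps B < 1"
  using accuracy dim_pos by (auto simp: mips_eps_def divide_less_eq)

definition updates :: "nat \<Rightarrow> change list" where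
  "updates t = concat (map (changes B) [1..<Suc t])"

lemma updates_Suc: "updates (Suc t) = updates t @ changes B (Suc t)"
  by (simp add: updates_def)

lemma updates: "t \<le> horizon B \<Longrightarrow> contents (points B 0) (updates t) = points B t \<and>
    admissible (dim B) (size_bound B) (points B 0) (updates t)"
proof (induction t)
  case 0
  then show ?case using points[of 0] by (simp add: updates_def contents_def admissible_def)
next
  case (Suc t)
  have "contents (points B t) (changes B (Suc t)) = points B (Suc t)"
    unfolding changes_def using points[of t] points[of "Suc t"] Suc.prems
    by (simp add: contents_list_of_change)
  moreover have "admissible (dim B) (size_bound B) (points B t) (changes B (Suc t))"
    unfolding changes_def using points[of t] points[of "Suc t"] Suc.prems
    by (simp add: admissible_list_of_change)
  ultimately show ?case
    using Suc by (simp add: updates_Suc contents_append admissible_append)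
qed

text \<open>The threshold of the last solver is at least 1, beyond which no inner product of vectors
  in the unit ball can go. Rounding the number of solvers up overshoots by less than one step, so
  all thresholds stay below 2, in the range for which single-query solvers are provided.\<close>

lemma num_solvers: "1 \<le> num_solvers B" "1 \<le> num_solvers B * mips_eps B" "num_solvers B \<le> 2 * dim B / accuracy B"
  "i \<le> num_solvers B \<Longrightarrow> mips_r B i < 2"
proof -
  have 1: "dim B / accuracy B \<ge> 1" using accuracy dim_pos by (simp add: le_divide_eq)
  have n: "dim B / accuracy B \<le> num_solvers B" "num_solvers B < dim B / accuracy B + 1"
    unfolding num_solvers_def using 1 by linarith+
  show "1 \<le> num_solvers B" using n(1) 1 by linarith
  show "num_solvers B \<le> 2 * dim B / accuracy B" using n(2) 1 by linarith
  show "1 \<le> num_solvers B * mips_eps B"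
    using n(1) accuracy dim_pos by (simp add: mips_eps_def field_simps)
  have "num_solvers B * mips_eps B < (dim B / accuracy B + 1) * mips_eps B"
    using n(2) mips_eps_pos by (rule mult_strict_right_mono)
  also have "\<dots> = 1 + mips_eps B" using accuracy dim_pos by (simp add: mips_eps_def field_simps)
  finally have "num_solvers B * mips_eps B < 2" using mips_eps_less_1 by simp
  moreover assume "i \<le> num_solvers B"
  then have "mips_r B i \<le> num_solvers B * mips_eps B"
    using mips_eps_pos by (simp add: mips_r_def mips_eps_def divide_right_mono mult_right_mono accuracy less_imp_le)
  ultimately show "mips_r B i < 2" by simp
qed

lemma mips_c: "i \<ge> 1 \<Longrightarrow> 0 < mips_c i \<and> mips_c i < 1"
  by (auto simp: mips_c_def field_simps)

lemma mips_r_pos: "i \<ge> 1 \<Longrightarrow> 0 < mips_r B i"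
  using accuracy dim_pos by (simp add: mips_r_def)

lemma single_query:
  "i \<in> {1..num_solvers B} \<Longrightarrow>
    single_query_solver (dim B) (size_bound B) (mips_c i) (mips_r B i) (solver_of B i)"
  using algorithm mips_c mips_r_pos num_solvers(4)
  by (auto simp: thompson_sampling_run_def solver_of_def)

lemma seeds_indep:
  "prob_space.indep_vars (prob B) (\<lambda>(i, j). seed_space (solver_of B i))
       (\<lambda>(i, j). copy_seed B i j) ({1..num_solvers B} \<times> {..<copies B})"
  using algorithm by (simp add: thompson_sampling_run_def)

lemma seed_measurable:
  assumes "i \<in> {1..num_solvers B}" "j < copies B"
  shows "copy_seed B i j \<in> measurable (prob B) (seed_space (solver_of B i))"
proof -
  interpret P: prob_space "prob B" by (rule prob_space_run)
  show ?thesis using seeds_indep assms unfolding P.indep_vars_def by fastforce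
qed

lemma seed_distr:
  "i \<in> {1..num_solvers B} \<Longrightarrow> j < copies B \<Longrightarrow>
    distr (prob B) (seed_space (solver_of B i)) (copy_seed B i j) = seed_space (solver_of B i)"
  using algorithm by (simp add: thompson_sampling_run_def)

definition bad_seeds :: "nat \<Rightarrow> nat \<Rightarrow> real vec \<Rightarrow> 's set" where
  "bad_seeds t i z = {s \<in> space (seed_space (solver_of B i)).
     \<not> solves_mips (mips_c i) (mips_r B i) 0 (points B t) z
         (lookup (solver_of B i) (state_after (solver_of B i) s (points B 0) (updates t)) z)}"

definition failing :: "nat \<Rightarrow> nat \<Rightarrow> real vec \<Rightarrow> 'w set" where
  "failing t i z = {\<omega> \<in> space (prob B). \<forall>j < copies B. copy_seed B i j \<omega> \<in> bad_seeds t i z}"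

text \<open>The seeds are drawn once, while queries depend on earlier answers of the same seeds, so
  no query may be treated as fixed. The union over all grid points covers every possible rounded
  query and leaves an event of the seeds alone.\<close>

definition bad_round :: "nat \<Rightarrow> 'w set" where
  "bad_round t = (\<Union>i \<in> {1..num_solvers B}. \<Union>z \<in> grid (dim B) (mips_eps B). failing t i z)"

lemma bad_seeds:
  assumes i: "i \<in> {1..num_solvers B}" and t: "t \<le> horizon B" and z: "z \<in> unit_ball (dim B)"
  shows "bad_seeds t i z \<in> sets (seed_space (solver_of B i))"
    "measure (seed_space (solver_of B i)) (bad_seeds t i z) \<le> 1 / 10"
proof -
  let ?N = "seed_space (solver_of B i)"
  define G where "G = {s \<in> space ?N. solves_mips (mips_c i) (mips_r B i) 0 (points B t) z
         (lookup (solver_of B i) (state_after (solver_of B i) s (points B 0) (updates t)) z)}"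
  note sq = single_query[OF i, unfolded single_query_solver_def]
  interpret N: prob_space ?N using sq by blast
  have "measure ?N G \<ge> 9 / 10"
    using conjunct2[OF sq, rule_format, of "points B 0" "updates t" z, THEN conjunct1] updates[OF t] z
    by (simp add: G_def)
  \<comment> \<open>\<open>measure\<close> is 0 outside the sigma-algebra, so the lower bound
    \<open>9 / 10\<close> already forces the set to be measurable.\<close>
  moreover from this have G: "G \<in> sets ?N"
    by (rule_tac ccontr) (simp add: measure_notin_sets)
  moreover have "bad_seeds t i z = space ?N - G" by (auto simp: bad_seeds_def G_def)
  ultimately show "bad_seeds t i z \<in> sets ?N" "measure ?N (bad_seeds t i z) \<le> 1 / 10"
    by (auto simp: N.prob_compl)
qed

lemma failing:
  assumes i: "i \<in> {1..num_solvers B}" and t: "t \<le> horizon B" and z: "z \<in> unit_ball (dim B)"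
  shows "failing t i z \<in> sets (prob B)" "measure (prob B) (failing t i z) \<le> (1 / 10) ^ copies B"
proof -
  interpret P: prob_space "prob B" by (rule prob_space_run)
  note bs = bad_seeds[OF i t z]
  have eq: "failing t i z = space (prob B) \<inter> (\<Inter>j \<in> {..<copies B}. copy_seed B i j -` bad_seeds t i z \<inter> space (prob B))"
    by (auto simp: failing_def)
  have ev: "copy_seed B i j -` bad_seeds t i z \<inter> space (prob B) \<in> sets (prob B)" if "j < copies B" for j
    using seed_measurable[OF i that] bs(1) by (rule measurable_sets)
  show "failing t i z \<in> sets (prob B)"
    unfolding failing_def using ev by (simp add: sets.sets_Collect_finite_All' vimage_def Int_def conj_commute)
  show "measure (prob B) (failing t i z) \<le> (1 / 10) ^ copies B"
  \<comment> \<open>The product rule for independent variables is available for nonempty index sets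
    only.\<close>
  proof (cases "copies B = 0")
    case True
    then show ?thesis by simp
  next
    case False
    let ?J = "{i} \<times> {..<copies B}"
    have "failing t i z = (\<Inter>x \<in> ?J. (case x of (i, j) \<Rightarrow> copy_seed B i j) -` bad_seeds t i z \<inter> space (prob B))"
      using False by (auto simp: failing_def)
    also have "measure (prob B) \<dots> = (\<Prod>x \<in> ?J. measure (prob B)
        ((case x of (i, j) \<Rightarrow> copy_seed B i j) -` bad_seeds t i z \<inter> space (prob B)))"
      by (rule P.indep_varsD[OF seeds_indep]) (use False i bs(1) in auto)
    also have "\<dots> \<le> (\<Prod>x \<in> ?J. 1 / 10)"
    proof (intro prod_mono conjI measure_nonneg)
      fix x assume "x \<in> ?J"
      then obtain j where x: "x = (i, j)" and j: "j < copies B" by auto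
      have "measure (prob B) (copy_seed B i j -` bad_seeds t i z \<inter> space (prob B))
        = measure (distr (prob B) (seed_space (solver_of B i)) (copy_seed B i j)) (bad_seeds t i z)"
        by (rule measure_distr[symmetric, OF seed_measurable[OF i j] bs(1)])
      then show "measure (prob B) ((case x of (i, j) \<Rightarrow> copy_seed B i j) -` bad_seeds t i z \<inter> space (prob B)) \<le> 1 / 10"
        using bs(2) seed_distr[OF i j] x by simp
    qed
    also have "\<dots> = (1 / 10) ^ copies B" by simp
    finally show ?thesis .
  qed
qed

lemma grid_in_unit_ball: "z \<in> grid d e \<Longrightarrow> z \<in> unit_ball d"
  by (simp add: grid_def)

text \<open>A union bound over solvers and grid points. There are at least \<open>d * ln X\<close>
  copies and \<open>1 / 10 \<le> exp (- 2)\<close>, so a fixed query fails with probability at most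
  \<open>X\<close> to the power \<open>- 2 * d\<close>. This outweighs the grid, which has at most
  \<open>3 * d\<^sup>2 / \<eta>\<close> to the power \<open>d\<close> points, with a surplus that
  also pays for the number of solvers.\<close>

lemma measure_bad_round:
  assumes t: "t \<le> horizon B"
  shows "bad_round t \<in> sets (prob B)"
    "measure (prob B) (bad_round t) \<le> 3 / 2 * confidence B * mips_eps B"
proof -
  interpret P: prob_space "prob B" by (rule prob_space_run)
  let ?G = "grid (dim B) (mips_eps B)" and ?d = "real (dim B)"
  let ?\<eta> = "accuracy B" and ?\<delta> = "confidence B"
  have fin: "finite ?G" by (rule finite_grid[OF dim_pos mips_eps_pos])
  note fl = failing[OF _ t grid_in_unit_ball]
  show "bad_round t \<in> sets (prob B)"
    unfolding bad_round_def using fl fin by (intro sets.finite_UN) auto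
  have "measure (prob B) (bad_round t) \<le> (\<Sum>i = 1..num_solvers B. measure (prob B) (\<Union>z \<in> ?G. failing t i z))"
    unfolding bad_round_def using fl fin by (intro P.finite_measure_subadditive_finite) auto
  also have "\<dots> \<le> (\<Sum>i = 1..num_solvers B. \<Sum>z \<in> ?G. measure (prob B) (failing t i z))"
    using fl fin by (intro sum_mono P.finite_measure_subadditive_finite) auto
  also have "\<dots> \<le> (\<Sum>i = 1..num_solvers B. \<Sum>z \<in> ?G. (1 / 10) ^ copies B)"
    using fl by (intro sum_mono) auto
  also have "\<dots> = num_solvers B * (card ?G * (1 / 10) ^ copies B)" by simp
  also have "\<dots> \<le> (2 * ?d / ?\<eta>) * ((3 * ?d\<^sup>2 / ?\<eta>) ^ dim B * (?\<eta> ^ 4 * ?\<delta>\<^sup>2 / (4 * ?d ^ 6)) ^ dim B)"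
  proof (intro mult_mono)
    show "real (num_solvers B) \<le> 2 * ?d / ?\<eta>" using num_solvers(3) by simp
    have "2 * (?d / mips_eps B) + 1 \<le> 3 * ?d\<^sup>2 / ?\<eta>"
    proof -
      have "?d\<^sup>2 \<ge> 1" using dim_pos by simp
      then have "?d\<^sup>2 / ?\<eta> \<ge> 1" using accuracy by (simp add: le_divide_eq)
      moreover have "?d / mips_eps B = ?d\<^sup>2 / ?\<eta>"
        using accuracy dim_pos by (simp add: mips_eps_def power2_eq_square)
      ultimately show ?thesis by simp
    qed
    then show "real (card ?G) \<le> (3 * ?d\<^sup>2 / ?\<eta>) ^ dim B"
      using card_grid_le[OF dim_pos mips_eps_pos] mips_eps_pos
      by (elim order_trans) (auto intro!: power_mono)
    \<comment> \<open>The argument of the logarithm in \<open>num_copies\<close> without the factor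
      \<open>size_bound B\<close>, which is at least 1 and only increases the number of
      copies.\<close>
    define X where "X = 2 * ?d ^ 3 / (?\<eta>\<^sup>2 * ?\<delta>)"
    have X: "X > 0" using dim_pos accuracy confidence by (simp add: X_def)
    have "X \<le> size_bound B * X" using size_bound_pos X by simp
    also have "\<dots> = real (size_bound B) * ?d / (mips_eps B * mips_delta B)"
      using dim_pos accuracy confidence
      by (simp add: X_def mips_eps_def mips_delta_def power2_eq_square power3_eq_cube field_simps)
    finally have "ln X \<le> ln (real (size_bound B) * ?d / (mips_eps B * mips_delta B))"
      using X by (subst ln_le_cancel_iff) auto
    then have "?d * ln X \<le> ?d * ln (real (size_bound B) * ?d / (mips_eps B * mips_delta B))"
      by (intro mult_left_mono) auto
    also have "\<dots> \<le> copies B" unfolding copies_def num_copies_def by linarith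
    finally have c: "?d * ln X \<le> copies B" .
    have "(1 / 10 :: real) \<le> exp (- 2)"
    proof -
      have "exp 1 < (3 :: real)" using e_less_272 by simp
      then have "exp 1 * exp 1 \<le> (3 * 3 :: real)" by (intro mult_mono) auto
      then show ?thesis by (simp add: exp_add[symmetric] exp_minus field_simps)
    qed
    then have "(1 / 10 :: real) ^ copies B \<le> exp (- 2) ^ copies B" by (rule power_mono) simp
    also have "\<dots> = exp (- (2 * copies B))" by (simp add: exp_of_nat_mult[symmetric])
    also have "\<dots> \<le> exp (- (2 * (?d * ln X)))" using c by simp
    also have "\<dots> = exp (real (dim B) * ln (1 / X\<^sup>2))"
      using X by (simp add: ln_div ln_realpow)
    also have "\<dots> = (1 / X\<^sup>2) ^ dim B"
      using X by (simp add: exp_of_nat_mult)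
    also have "1 / X\<^sup>2 = ?\<eta> ^ 4 * ?\<delta>\<^sup>2 / (4 * ?d ^ 6)"
      by (simp add: X_def power_divide power_mult_distrib power_mult[symmetric])
    finally show "(1 / 10) ^ copies B \<le> (?\<eta> ^ 4 * ?\<delta>\<^sup>2 / (4 * ?d ^ 6)) ^ dim B" .
  qed (use accuracy in auto)
  also have "\<dots> = (2 * ?d / ?\<eta>) * (3 * ?\<eta> ^ 3 * ?\<delta>\<^sup>2 / (4 * ?d ^ 4)) ^ dim B"
    unfolding power_mult_distrib[symmetric] using accuracy dim_pos
    by (simp add: power_numeral_reduce field_simps)
  \<comment> \<open>The base is at most 1, so the exponent \<open>dim B\<close> may be lowered to 1;
    what remains is of order \<open>\<eta>\<^sup>2 * \<delta>\<^sup>2 / d ^ 3\<close>.\<close>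
  also have "\<dots> \<le> (2 * ?d / ?\<eta>) * (3 * ?\<eta> ^ 3 * ?\<delta>\<^sup>2 / (4 * ?d ^ 4)) ^ 1"
  proof (intro mult_left_mono power_decreasing dim_pos)
    have "?\<eta> ^ 3 \<le> 1" "?\<delta>\<^sup>2 \<le> 1" "1 \<le> ?d ^ 4"
      using accuracy confidence dim_pos by (auto simp: power_le_one)
    then have "?\<eta> ^ 3 * ?\<delta>\<^sup>2 \<le> 1 * 1" using accuracy by (intro mult_mono) auto
    then show "3 * ?\<eta> ^ 3 * ?\<delta>\<^sup>2 / (4 * ?d ^ 4) \<le> 1"
      using \<open>1 \<le> ?d ^ 4\<close> by (subst divide_le_eq_1_pos; linarith)
  qed (use accuracy confidence in auto)
  also have "\<dots> = 3 / 2 * (?\<eta> * ?\<delta>) * ((?\<eta> * ?\<delta>) / ?d ^ 3)"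
    using accuracy dim_pos by (simp add: power_numeral_reduce field_simps)
  also have "\<dots> \<le> 3 / 2 * (?\<eta> * ?\<delta>) * (1 / ?d)"
  proof (intro mult_left_mono)
    have "?\<eta> * ?\<delta> \<le> 1 * 1" using accuracy confidence by (intro mult_mono) auto
    moreover have "?d \<le> ?d ^ 3" using dim_pos by (simp add: self_le_power)
    ultimately show "?\<eta> * ?\<delta> / ?d ^ 3 \<le> 1 / ?d" using dim_pos by (intro frac_le) auto
  qed (use accuracy confidence in auto)
  also have "\<dots> = 3 / 2 * confidence B * mips_eps B" by (simp add: mips_eps_def)
  finally show "measure (prob B) (bad_round t) \<le> 3 / 2 * confidence B * mips_eps B" .
qed

text \<open>The number of copies does not grow with the horizon, so a union bound over rounds is not
  affordable. Markov's inequality is applied to the number of bad rounds instead: against an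
  expectation of at most \<open>3 / 2 * confidence B * mips_eps B\<close> per round, the level
  \<open>6 * mips_eps B\<close> per round leaves probability
  \<open>confidence B / 4\<close>.\<close>

lemma sum_indicator_bad_round:
  "measure (prob B) {\<omega> \<in> space (prob B).
      6 * mips_eps B * horizon B \<le> (\<Sum>t = 1..horizon B. indicator (bad_round t) \<omega>)} \<le> confidence B / 4"
proof -
  interpret P: prob_space "prob B" by (rule prob_space_run)
  let ?u = "\<lambda>\<omega>. (\<Sum>t = 1..horizon B. indicator (bad_round t) \<omega> :: real)"
  have int: "integrable (prob B) (indicator (bad_round t) :: _ \<Rightarrow> real)" if "t \<in> {1..horizon B}" for t
    using measure_bad_round(1)[of t] that by (simp add: P.emeasure_eq_measure)
  have pos: "0 < 6 * mips_eps B * horizon B" using mips_eps_pos horizon_pos by simp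
  have "measure (prob B) {\<omega> \<in> space (prob B). 6 * mips_eps B * horizon B \<le> ?u \<omega>}
    \<le> (\<integral>\<omega>. ?u \<omega> \<partial>prob B) / (6 * mips_eps B * horizon B)"
    by (rule integral_Markov_inequality_measure[of _ _ "{}"]) (use int pos in \<open>auto intro!: sum_nonneg\<close>)
  also have "(\<integral>\<omega>. ?u \<omega> \<partial>prob B) = (\<Sum>t = 1..horizon B. measure (prob B) (bad_round t))"
    using int measure_bad_round(1) by (subst Bochner_Integration.integral_sum) auto
  also have "\<dots> \<le> (\<Sum>t = 1..horizon B. 3 / 2 * confidence B * mips_eps B)"
    using measure_bad_round(2) by (intro sum_mono) auto
  also have "\<dots> / (6 * mips_eps B * horizon B) = confidence B / 4"
    using mips_eps_pos horizon_pos by (simp add: field_simps)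
  finally show ?thesis using pos by (simp add: divide_right_mono)
qed

lemma play_in_arms: "t \<in> {1..horizon B} \<Longrightarrow> \<omega> \<in> space (prob B) \<Longrightarrow> play B t \<omega> \<in> arms B t"
  using bandit by (auto simp: linear_bandit_def)

lemma single_query_sound:
  assumes i: "i \<in> {1..num_solvers B}" and t: "t \<le> horizon B" and z: "z \<in> unit_ball (dim B)"
    and s: "s \<in> space (seed_space (solver_of B i))"
    and v: "lookup (solver_of B i) (state_after (solver_of B i) s (points B 0) (updates t)) z = Some v"
  shows "v \<in> points B t \<and> mips_c i * mips_r B i \<le> z \<bullet> v"
proof -
  have "\<forall>p. lookup (solver_of B i) (state_after (solver_of B i) s (points B 0) (updates t)) z = Some p \<longrightarrow>
    p \<in> contents (points B 0) (updates t) \<and> z \<bullet> p \<ge> mips_c i * mips_r B i"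
    using conjunct2[OF single_query[OF i, unfolded single_query_solver_def], rule_format,
        of "points B 0" "updates t" z, THEN conjunct2] updates[OF t] z s by blast
  then show ?thesis using v updates[OF t] by metis
qed

text \<open>Let the search stop at \<open>i\<close>. The answer of solver \<open>i\<close> has value
  at least \<open>(i + 1) * \<epsilon> - 2 * \<epsilon>\<close>, because \<open>c * r\<close> is
  this plus \<open>\<epsilon> / (i + 1)\<close>. Solver \<open>i + 1\<close> is silent, and outside
  \<open>bad_round\<close> one of its copies is right to be silent, so all values are below
  \<open>(i + 1) * \<epsilon>\<close>; for the last solver Cauchy-Schwarz gives the same. This
  leaves \<open>2 * \<epsilon>\<close> at the rounded query, and undoing the rounding costs
  \<open>2 * \<epsilon>\<close> more, as two points of the unit ball differ by at most 2.\<close>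

lemma search_gap:
  assumes t: "t \<in> {1..horizon B}" and \<omega>: "\<omega> \<in> space (prob B)" "\<omega> \<notin> bad_round t"
    and q: "mips_query B t \<omega> \<in> unit_ball (dim B)" and v: "search_result B t \<omega> = Some v"
    and a: "a \<in> arms B t"
  shows "mips_query B t \<omega> \<bullet> feature B a \<le> mips_query B t \<omega> \<bullet> v + 4 * mips_eps B"
proof -
  let ?e = "mips_eps B" and ?n = "num_solvers B" and ?q = "mips_query B t \<omega>"
  define z where "z = round_query (dim B) ?e ?q"
  define P where "P i \<longleftrightarrow> mips_answer B t \<omega> i \<noteq> None" for i
  define i where "i = binary_search P 0 (?n + 1)"
  have tT: "t \<le> horizon B" using t by simp
  have z: "z \<in> grid (dim B) ?e" "z \<in> unit_ball (dim B)" "vnorm (?q - z) \<le> ?e"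
    using round_query[OF dim_pos mips_eps_pos q] grid_in_unit_ball by (auto simp: z_def)
  have i: "i \<noteq> 0" "mips_answer B t \<omega> i = Some v"
    using v unfolding search_result_def P_def[symmetric] i_def[symmetric] by (auto simp: Let_def split: if_splits)
  have bs: "i \<le> ?n" "i = ?n \<or> \<not> P (Suc i)"
    using binary_search_bounds[of 0 "?n + 1" P] by (auto simp: i_def)
  have iI: "i \<in> {1..?n}" using i bs by auto
  have state: "copy_states B k t \<omega> = map (\<lambda>j. state_after (solver_of B k) (copy_seed B k j \<omega>) (points B 0) (updates t))
       [0..<copies B]" for k
    by (simp add: copy_states_def updates_def)
  have seed: "copy_seed B k j \<omega> \<in> space (seed_space (solver_of B k))" if "k \<in> {1..?n}" "j < copies B" for k j
    using seed_measurable[OF that] \<omega>(1) by (rule measurable_space)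
  obtain st where st: "st \<in> set (copy_states B i t \<omega>)" "lookup (solver_of B i) st z = Some v"
    using adaptive_lookup_SomeD[OF i(2)[unfolded mips_answer_def]] unfolding z_def by blast
  then obtain j where j: "j < copies B" "st = state_after (solver_of B i) (copy_seed B i j \<omega>) (points B 0) (updates t)"
    unfolding state by auto
  have v': "v \<in> points B t" "z \<bullet> v \<ge> mips_c i * mips_r B i"
    using single_query_sound[OF iI tT z(2) seed[OF iI j(1)] st(2)[unfolded j(2)]] by auto
  have ub: "feature B a \<in> unit_ball (dim B)" "v \<in> unit_ball (dim B)"
    using points[OF tT] v'(1) feature_in_unit_ball[OF tT a] by auto
  have car: "?q \<in> carrier_vec (dim B)" "z \<in> carrier_vec (dim B)" "feature B a \<in> carrier_vec (dim B)" "v \<in> carrier_vec (dim B)"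
    using ub z q by (auto simp: unit_ball_def)
  have "z \<bullet> feature B a \<le> (i + 1) * ?e"
  proof (cases "i = ?n")
    case True
    have "z \<bullet> feature B a \<le> vnorm z * vnorm (feature B a)" using car by (intro scalar_prod_le_vnorm') auto
    also have "\<dots> \<le> 1 * 1" using z ub by (intro mult_mono) (auto simp: unit_ball_def)
    also have "\<dots> \<le> i * ?e" using num_solvers(2) True by simp
    also have "\<dots> \<le> (i + 1) * ?e" using mips_eps_pos by simp
    finally show ?thesis .
  next
    case False
    then have k: "Suc i \<in> {1..?n}" using bs by auto
    have "mips_answer B t \<omega> (Suc i) = None" using bs False by (auto simp: P_def)
    then have none: "lookup (solver_of B (Suc i)) (state_after (solver_of B (Suc i)) (copy_seed B (Suc i) j \<omega>)
        (points B 0) (updates t)) z = None" if "j < copies B" for j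
      using that unfolding mips_answer_def adaptive_lookup_None_iff state z_def by auto
    have "\<omega> \<notin> failing t (Suc i) z" using \<omega>(2) k z(1) by (auto simp: bad_round_def)
    then obtain j where j: "j < copies B" "copy_seed B (Suc i) j \<omega> \<notin> bad_seeds t (Suc i) z"
      using \<omega>(1) by (auto simp: failing_def)
    then have "solves_mips (mips_c (Suc i)) (mips_r B (Suc i)) 0 (points B t) z None"
      using seed[OF k j(1)] none[OF j(1)] by (auto simp: bad_seeds_def)
    then have "z \<bullet> feature B a < mips_r B (Suc i)"
      using a by (fastforce simp: solves_mips_def points_def)
    then show ?thesis by (simp add: mips_r_def mips_eps_def add.commute)
  qed
  moreover have "z \<bullet> v \<ge> (i + 1) * ?e - 2 * ?e"
  proof -
    define k where "k = real i + 1"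
    have k: "k > 0" by (simp add: k_def)
    have "mips_c i * mips_r B i = (1 - 1 / k) * ((k - 1) * ?e)"
      by (simp add: mips_c_def mips_r_def mips_eps_def k_def add.commute)
    also have "\<dots> = k * ?e - 2 * ?e + ?e / k" using k by (simp add: field_simps)
    finally have "mips_c i * mips_r B i = k * ?e - 2 * ?e + ?e / k" .
    moreover have "0 < ?e / k" using k mips_eps_pos by simp
    moreover have "(i + 1) * ?e = k * ?e" by (simp add: k_def)
    ultimately show ?thesis using v'(2) by linarith
  qed
  ultimately have gap: "z \<bullet> feature B a \<le> z \<bullet> v + 2 * ?e" by linarith
  have "(?q - z) \<bullet> (feature B a - v) \<le> vnorm (?q - z) * vnorm (feature B a - v)"
    using car by (intro scalar_prod_le_vnorm'[of _ "dim B"]) auto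
  also have "\<dots> \<le> ?e * 2"
  proof (rule mult_mono[OF z(3)])
    have "vnorm (feature B a - v) \<le> vnorm (feature B a) + vnorm v"
      using vnorm_diff_le car by blast
    also have "\<dots> \<le> 2" using ub by (simp add: unit_ball_def)
    finally show "vnorm (feature B a - v) \<le> 2" .
  qed (use mips_eps_pos in auto)
  finally have "?q \<bullet> feature B a - ?q \<bullet> v - (z \<bullet> feature B a - z \<bullet> v) \<le> 2 * ?e"
    using car by (simp add: minus_scalar_prod_distrib[of _ "dim B"] scalar_prod_minus_distrib[of _ "dim B"])
  with gap show ?thesis by linarith
qed

subsection \<open>Measurability with respect to the past\<close>

text \<open>\<open>past B t\<close> is a family of sets, as independence requires;
  \<open>subalgebra\<close> and \<open>borel_measurable\<close> need the same sigma-algebra as a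
  measure.\<close>

definition past_measure :: "nat \<Rightarrow> 'w measure" where
  "past_measure t = sigma (space (prob B)) (past B t)"

lemma play_measurable: "t \<in> {1..horizon B} \<Longrightarrow> play B t \<in> measurable (prob B) (count_space UNIV)"
  and noise_measurable: "t \<in> {1..horizon B} \<Longrightarrow> noise B t \<in> borel_measurable (prob B)"
  and xi_measurable: "t \<in> {1..horizon B} \<Longrightarrow> xi B t \<in> measurable (prob B) (borel_vec (dim B))"
  using bandit algorithm by (auto simp: linear_bandit_def thompson_sampling_run_def)

lemma reward_measurable:
  assumes "t \<in> {1..horizon B}"
  shows "reward B t \<in> borel_measurable (prob B)"
proof -
  have "(\<lambda>\<omega>. theta_star B \<bullet> feature B (play B t \<omega>)) \<in> borel_measurable (prob B)"
    by (rule measurable_compose[OF play_measurable[OF assms]]) simp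
  then show ?thesis using noise_measurable[OF assms] unfolding reward_def by (rule borel_measurable_add)
qed

lemma events_subset: "X \<in> measurable (prob B) N \<Longrightarrow> events (prob B) X N \<subseteq> sets (prob B)"
  by (auto simp: events_def)

lemma past_generator_subset:
  assumes "t \<in> {1..horizon B}"
  shows "(\<Union>i \<in> {1..num_solvers B}. \<Union>j \<in> {..<copies B}.
         events (prob B) (copy_seed B i j) (seed_space (solver_of B i))) \<union>
      (\<Union>s \<in> {1..<t}. events (prob B) (xi B s) (borel_vec (dim B)) \<union>
         events (prob B) (play B s) (count_space UNIV) \<union> events (prob B) (reward B s) borel) \<subseteq> sets (prob B)"
  by (intro Un_least UN_least events_subset seed_measurable xi_measurable play_measurable
      reward_measurable) (use assms in auto)

lemma past_subset: "t \<in> {1..horizon B} \<Longrightarrow> past B t \<subseteq> sets (prob B)"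
  unfolding past_def by (rule sets.sigma_sets_subset[OF past_generator_subset])

lemma space_past_measure [simp]: "space (past_measure t) = space (prob B)"
  by (simp add: past_measure_def space_measure_of_conv)

lemma sets_past_measure: "t \<in> {1..horizon B} \<Longrightarrow> sets (past_measure t) = past B t"
proof -
  assume t: "t \<in> {1..horizon B}"
  have "sets (past_measure t) = sigma_sets (space (prob B)) (past B t)"
    unfolding past_measure_def using past_subset[OF t] sets.space_closed by (intro sets_measure_of) blast
  also have "\<dots> = past B t"
    unfolding past_def by (intro sigma_sets_sigma_sets_eq order_trans[OF past_generator_subset[OF t] sets.space_closed])
  finally show ?thesis .
qed

lemma subalgebra_past: "t \<in> {1..horizon B} \<Longrightarrow> subalgebra (prob B) (past_measure t)"
  using past_subset sets_past_measure by (simp add: subalgebra_def)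

lemma past_measurableI:
  assumes t: "t \<in> {1..horizon B}" and X: "X \<in> measurable (prob B) N"
    and ev: "events (prob B) X N \<subseteq> past B t"
  shows "X \<in> measurable (past_measure t) N"
  using measurable_space[OF X] ev sets_past_measure[OF t]
  by (intro measurableI) (auto simp: events_def)

lemma past_measurable:
  assumes t: "t \<in> {1..horizon B}"
  shows "i \<in> {1..num_solvers B} \<Longrightarrow> j < copies B \<Longrightarrow>
      copy_seed B i j \<in> measurable (past_measure t) (seed_space (solver_of B i))"
    and "s \<in> {1..<t} \<Longrightarrow> play B s \<in> measurable (past_measure t) (count_space UNIV)"
    and "s \<in> {1..<t} \<Longrightarrow> reward B s \<in> borel_measurable (past_measure t)"
proof -
  show "copy_seed B i j \<in> measurable (past_measure t) (seed_space (solver_of B i))"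
    if "i \<in> {1..num_solvers B}" "j < copies B"
    using that by (intro past_measurableI[OF t seed_measurable]) (auto simp: past_def intro!: sigma_sets.Basic)
  show "play B s \<in> measurable (past_measure t) (count_space UNIV)" if "s \<in> {1..<t}"
    using that t by (intro past_measurableI[OF t play_measurable]) (auto simp: past_def intro!: sigma_sets.Basic)
  show "reward B s \<in> borel_measurable (past_measure t)" if "s \<in> {1..<t}"
    using that t by (intro past_measurableI[OF t reward_measurable]) (auto simp: past_def intro!: sigma_sets.Basic)
qed

text \<open>All seeds belong to the past of every round, and \<open>bad_round s\<close> depends on
  nothing else. This is what allows bad rounds to be excluded inside \<open>excess\<close> without
  losing its measurability before the sample.\<close>

lemma bad_round_past:
  assumes t: "t \<in> {1..horizon B}" and s: "s \<le> horizon B"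
  shows "bad_round s \<in> sets (past_measure t)"
proof -
  have "failing s i z \<in> sets (past_measure t)"
    if i: "i \<in> {1..num_solvers B}" and z: "z \<in> grid (dim B) (mips_eps B)" for i z
  proof -
    have "copy_seed B i j -` bad_seeds s i z \<inter> space (prob B) \<in> sets (past_measure t)" if "j < copies B" for j
      using measurable_sets[OF past_measurable(1)[OF t i that] bad_seeds(1)[OF i s grid_in_unit_ball[OF z]]]
      by simp
    then have "{\<omega> \<in> space (past_measure t). \<forall>j \<in> {..<copies B}. copy_seed B i j \<omega> \<in> bad_seeds s i z} \<in> sets (past_measure t)"
      by (intro sets.sets_Collect_finite_All) (auto simp: vimage_def Int_def conj_commute)
    moreover have "failing s i z =
      {\<omega> \<in> space (past_measure t). \<forall>j \<in> {..<copies B}. copy_seed B i j \<omega> \<in> bad_seeds s i z}"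
      by (auto simp: failing_def)
    ultimately show ?thesis by (simp only:)
  qed
  then show ?thesis
    unfolding bad_round_def using finite_grid[OF dim_pos mips_eps_pos] by (intro sets.finite_UN) auto
qed

lemma space_history [simp]: "space (history B t) = space (prob B)"
  by (simp add: history_def space_measure_of_conv)

lemma history_generator_subset:
  assumes "t \<in> {1..horizon B}"
  shows "(\<Union>s \<in> {1..t}. events (prob B) (play B s) (count_space UNIV)) \<union>
      (\<Union>s \<in> {1..<t}. events (prob B) (reward B s) borel) \<subseteq> sets (prob B)"
  by (intro Un_least UN_least events_subset play_measurable reward_measurable) (use assms in auto)

lemma sets_history:
  assumes t: "t \<in> {1..horizon B}"
  shows "sets (history B t) = sigma_sets (space (prob B))
    ((\<Union>s \<in> {1..t}. events (prob B) (play B s) (count_space UNIV)) \<union>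
      (\<Union>s \<in> {1..<t}. events (prob B) (reward B s) borel))"
  unfolding history_def
  by (intro sets_measure_of order_trans[OF history_generator_subset[OF t] sets.space_closed])

lemma subalgebra_history:
  assumes t: "t \<in> {1..horizon B}"
  shows "subalgebra (prob B) (history B t)"
  using sets.sigma_sets_subset[OF history_generator_subset[OF t]]
  by (simp add: subalgebra_def sets_history[OF t])

lemma history_measurable:
  assumes t: "t \<in> {1..horizon B}"
  shows "s \<in> {1..t} \<Longrightarrow> play B s \<in> measurable (history B t) (count_space UNIV)"
    and "s \<in> {1..<t} \<Longrightarrow> reward B s \<in> borel_measurable (history B t)"
proof -
  show "play B s \<in> measurable (history B t) (count_space UNIV)" if "s \<in> {1..t}"
  proof (rule measurableI)
    fix A :: "'a set"
    have "play B s -` A \<inter> space (prob B) \<in> events (prob B) (play B s) (count_space UNIV)"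
      by (auto simp: events_def)
    with that show "play B s -` A \<inter> space (history B t) \<in> sets (history B t)"
      unfolding sets_history[OF t] space_history by (intro sigma_sets.Basic) blast
  qed simp
  show "reward B s \<in> borel_measurable (history B t)" if "s \<in> {1..<t}"
  proof (rule measurableI)
    fix A :: "real set" assume "A \<in> sets borel"
    then have "reward B s -` A \<inter> space (prob B) \<in> events (prob B) (reward B s) borel"
      by (auto simp: events_def)
    with that show "reward B s -` A \<inter> space (history B t) \<in> sets (history B t)"
      unfolding sets_history[OF t] space_history by (intro sigma_sets.Basic) blast
  qed simp
qed

text \<open>Arm sets are finite, so everything determined by finitely many plays takes finitely many values.\<close>

definition play_list :: "nat \<Rightarrow> 'w \<Rightarrow> 'a list" where
  "play_list m \<omega> = map (\<lambda>s. play B s \<omega>) [1..<Suc m]"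

lemma finite_play_list:
  assumes "m \<le> horizon B"
  shows "finite (play_list m ` space (prob B))"
proof (rule finite_subset)
  let ?A = "\<Union>s \<in> {1..m}. arms B s"
  show "play_list m ` space (prob B) \<subseteq> {xs. set xs \<subseteq> ?A \<and> length xs = m}"
  proof (intro image_subsetI CollectI conjI subsetI)
    fix \<omega> a assume \<omega>: "\<omega> \<in> space (prob B)" and a: "a \<in> set (play_list m \<omega>)"
    from a obtain s where s: "a = play B s \<omega>" "s \<in> set [1..<Suc m]"
      unfolding play_list_def set_map by (rule imageE)
    from s(2) have "s \<in> {1..m}" by auto
    with s(1) show "a \<in> ?A" using play_in_arms[of s \<omega>] \<omega> assms by auto
  qed (simp add: play_list_def)
  show "finite {xs. set xs \<subseteq> ?A \<and> length xs = m}"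
    using arms assms by (intro finite_lists_length_eq) auto
qed

lemma play_list_vimage:
  assumes m: "m \<le> horizon B" and N: "space N = space (prob B)"
    and pl: "\<And>s. s \<in> {1..m} \<Longrightarrow> play B s \<in> measurable N (count_space UNIV)"
  shows "play_list m -` A \<inter> space (prob B) \<in> sets N"
proof -
  have single: "play_list m -` {h} \<inter> space (prob B) \<in> sets N" for h
  proof (cases "length h = m")
    case True
    have "play_list m \<omega> = h \<longleftrightarrow> (\<forall>s \<in> {1..m}. play B s \<omega> = h ! (s - 1))" for \<omega>
    proof -
      have "length (play_list m \<omega>) = m" "\<And>k. k < m \<Longrightarrow> play_list m \<omega> ! k = play B (Suc k) \<omega>"
        by (auto simp: play_list_def simp del: upt_Suc)
      then have "play_list m \<omega> = h \<longleftrightarrow> (\<forall>k<m. play B (Suc k) \<omega> = h ! k)"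
        using True by (simp add: list_eq_iff_nth_eq)
      also have "\<dots> \<longleftrightarrow> (\<forall>s \<in> Suc ` {..<m}. play B s \<omega> = h ! (s - 1))" by auto
      finally show ?thesis unfolding image_Suc_lessThan .
    qed
    then have "play_list m -` {h} \<inter> space (prob B) = {\<omega> \<in> space N. \<forall>s \<in> {1..m}. play B s \<omega> = h ! (s - 1)}"
      using N by blast
    also have "\<dots> \<in> sets N"
    proof (intro sets.sets_Collect_finite_All)
      fix s assume "s \<in> {1..m}"
      from measurable_sets[OF pl[OF this], of "{h ! (s - 1)}"]
      show "{\<omega> \<in> space N. play B s \<omega> = h ! (s - 1)} \<in> sets N"
        by (simp add: vimage_def Int_def conj_commute)
    qed simp
    finally show ?thesis .
  next
    case False
    then have "play_list m -` {h} \<inter> space (prob B) = {}"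
      by (auto simp: play_list_def simp del: upt_Suc)
    then show ?thesis by (simp only: sets.empty_sets)
  qed
  have "play_list m -` A \<inter> space (prob B) = (\<Union>h \<in> A \<inter> play_list m ` space (prob B). play_list m -` {h} \<inter> space (prob B))"
    by auto
  also have "\<dots> \<in> sets N" using single finite_play_list[OF m] by (intro sets.finite_UN) auto
  finally show ?thesis .
qed

text \<open>Any preimage under \<open>f\<close> is a finite union of level sets of
  \<open>play_list\<close>, so \<open>f\<close> needs no regularity at all. This disposes of
  inverses and inverse square roots of the design matrix.\<close>

lemma play_determined_measurable:
  assumes m: "m \<le> horizon B" and N: "space N = space (prob B)"
    and pl: "\<And>s. s \<in> {1..m} \<Longrightarrow> play B s \<in> measurable N (count_space UNIV)"
    and f: "\<And>\<omega> \<omega>'. \<omega> \<in> space (prob B) \<Longrightarrow> \<omega>' \<in> space (prob B) \<Longrightarrow> (\<And>s. s \<in> {1..m} \<Longrightarrow> play B s \<omega> = play B s \<omega>')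
       \<Longrightarrow> f \<omega> = f \<omega>'"
  shows "(f :: 'w \<Rightarrow> real) \<in> borel_measurable N"
proof (rule measurableI)
  have f': "f \<omega> = f \<omega>'" if "\<omega> \<in> space (prob B)" "\<omega>' \<in> space (prob B)" "play_list m \<omega> = play_list m \<omega>'" for \<omega> \<omega>'
    using that by (intro f) (auto simp: play_list_def simp del: upt_Suc)
  fix A
  have "f -` A \<inter> space N = play_list m -` (play_list m ` (f -` A \<inter> space (prob B))) \<inter> space (prob B)"
    using f' by (auto simp: N)
  then show "f -` A \<inter> space N \<in> sets N" using play_list_vimage[OF m N pl] by simp
qed simp

end

subsection \<open>Confidence ellipsoids\<close>

lemma quadratic_form_sum:
  fixes A :: "real mat"
  assumes "A \<in> carrier_mat d d" "u \<in> carrier_vec d" "v \<in> carrier_vec d"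
  shows "u \<bullet> (A *\<^sub>v v) = (\<Sum>i<d. \<Sum>j<d. u $ i * A $$ (i, j) * v $ j)"
  using assms by (auto simp: scalar_prod_def sum_distrib_left atLeast0LessThan mult_ac intro!: sum.cong)

lemma inv_sqrt_mat_apply:
  assumes A: "pos_def d A" and v: "v \<in> carrier_vec d"
  defines "M \<equiv> inv_sqrt_mat d A"
  shows "M \<in> carrier_mat d d" "transpose_mat M = M" "M *\<^sub>v v \<in> carrier_vec d"
    "M *\<^sub>v (M *\<^sub>v v) = mat_inv A *\<^sub>v v"
    "u \<in> carrier_vec d \<Longrightarrow> (M *\<^sub>v u) \<bullet> (M *\<^sub>v v) = u \<bullet> (mat_inv A *\<^sub>v v)"
    "u \<in> carrier_vec d \<Longrightarrow> u \<bullet> (M *\<^sub>v v) = (M *\<^sub>v u) \<bullet> v"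
    "(vnorm (M *\<^sub>v v))\<^sup>2 = v \<bullet> (mat_inv A *\<^sub>v v)"
proof -
  show M: "M \<in> carrier_mat d d" "transpose_mat M = M"
    using inv_sqrt_mat(1)[OF A] by (auto simp: M_def pos_def_def)
  show Mv: "M *\<^sub>v v \<in> carrier_vec d" using M v by simp
  show MM: "M *\<^sub>v (M *\<^sub>v v) = mat_inv A *\<^sub>v v"
    using inv_sqrt_mat(2)[OF A] M v by (simp add: M_def assoc_mult_mat_vec[of _ d d _ d, symmetric] del: assoc_mult_mat_vec)
  show *: "(M *\<^sub>v u) \<bullet> (M *\<^sub>v v) = u \<bullet> (mat_inv A *\<^sub>v v)" if "u \<in> carrier_vec d" for u
    using symmetric_scalar_prod[OF M that Mv] MM by simp
  show "u \<bullet> (M *\<^sub>v v) = (M *\<^sub>v u) \<bullet> v" if "u \<in> carrier_vec d"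
    using symmetric_scalar_prod[OF M that v] by simp
  show "(vnorm (M *\<^sub>v v))\<^sup>2 = v \<bullet> (mat_inv A *\<^sub>v v)"
    unfolding vnorm_power2 by (rule *[OF v])
qed

text \<open>A matrix above the identity has a contracting inverse square root. With
  \<open>w = mat_inv A *\<^sub>v v\<close> the hypothesis and Cauchy-Schwarz bound the square of
  \<open>vnorm w\<close> by \<open>vnorm v * vnorm w\<close>; hence
  \<open>vnorm w \<le> vnorm v\<close>, and the quadratic form \<open>v \<bullet> w\<close> is at
  most \<open>v \<bullet> v\<close>.\<close>

lemma vnorm_inv_sqrt_mat_le:
  assumes A: "pos_def d A" and v: "v \<in> carrier_vec d"
    and ge: "\<And>w. w \<in> carrier_vec d \<Longrightarrow> w \<bullet> w \<le> w \<bullet> (A *\<^sub>v w)"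
  shows "vnorm (inv_sqrt_mat d A *\<^sub>v v) \<le> vnorm v"
proof -
  note inv = pos_def_inverse[OF A]
  have car: "A \<in> carrier_mat d d" using A by (simp add: pos_def_def)
  define w where "w = mat_inv A *\<^sub>v v"
  have w: "w \<in> carrier_vec d" using inv v by (simp add: w_def)
  have Aw: "A *\<^sub>v w = v" using inv car v
    by (simp add: w_def assoc_mult_mat_vec[of _ d d _ d, symmetric] del: assoc_mult_mat_vec)
  have 1: "v \<bullet> w \<le> vnorm v * vnorm w" by (rule scalar_prod_le_vnorm'[OF v w])
  have "(vnorm w)\<^sup>2 \<le> v \<bullet> w" using ge[OF w] comm_scalar_prod[OF v w] by (simp add: vnorm_power2 Aw)
  with 1 have "vnorm w * vnorm w \<le> vnorm v * vnorm w" by (simp add: power2_eq_square)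
  then have "vnorm w \<le> vnorm v" using mult_right_le_imp_le[of "vnorm w" "vnorm w" "vnorm v"] vnorm_nonneg[of w] vnorm_nonneg[of v]
    by (cases "vnorm w = 0") (auto simp: less_le)
  then have "vnorm v * vnorm w \<le> vnorm v * vnorm v" by (intro mult_left_mono) auto
  then have "(vnorm (inv_sqrt_mat d A *\<^sub>v v))\<^sup>2 \<le> (vnorm v)\<^sup>2"
    using 1 inv_sqrt_mat_apply(7)[OF A v] by (simp add: w_def power2_eq_square)
  then show ?thesis by (rule power2_le_imp_le) simp
qed

context bandit_algorithm
begin

abbreviation (input) "\<Omega> \<equiv> space (prob B)"

definition arm :: "nat \<Rightarrow> 'w \<Rightarrow> real vec" where
  "arm s \<omega> = feature B (play B s \<omega>)"

lemma arm_in_unit_ball: "s \<in> {1..horizon B} \<Longrightarrow> \<omega> \<in> \<Omega> \<Longrightarrow> arm s \<omega> \<in> unit_ball (dim B)"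
  unfolding arm_def using feature_in_unit_ball[of s] play_in_arms by auto

lemma arm_carrier: "s \<in> {1..horizon B} \<Longrightarrow> \<omega> \<in> \<Omega> \<Longrightarrow> arm s \<omega> \<in> carrier_vec (dim B)"
  and vnorm_arm: "s \<in> {1..horizon B} \<Longrightarrow> \<omega> \<in> \<Omega> \<Longrightarrow> vnorm (arm s \<omega>) \<le> 1"
  using arm_in_unit_ball by (auto simp: unit_ball_def)

lemma theta_star: "theta_star B \<in> carrier_vec (dim B)" "vnorm (theta_star B) \<le> 1"
  using bandit by (auto simp: linear_bandit_def unit_ball_def)

lemma design_matrix_aux:
  assumes "n \<le> horizon B" "\<omega> \<in> \<Omega>"
  shows "pos_def (dim B) (design_matrix B \<omega> n) \<and>
    (\<forall>w \<in> carrier_vec (dim B). w \<bullet> w \<le> w \<bullet> (design_matrix B \<omega> n *\<^sub>v w)) \<and>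
    (\<forall>i < dim B. \<forall>j < dim B. design_matrix B \<omega> n $$ (i, j) =
      (if i = j then 1 else 0) + (\<Sum>s = 1..n. arm s \<omega> $ i * arm s \<omega> $ j))"
  using assms
proof (induction n)
  case 0
  show ?case by (auto simp: pos_def_def scalar_prod_self_pos)
next
  case (Suc n)
  let ?V = "design_matrix B \<omega> n" and ?x = "arm (Suc n) \<omega>"
  have n: "n \<le> horizon B" using Suc.prems(1) by simp
  note IH = Suc.IH[OF n Suc.prems(2)]
  have x: "?x \<in> carrier_vec (dim B)" using Suc.prems by (intro arm_carrier) auto
  have V: "pos_def (dim B) ?V" using IH by blast
  then have car: "?V \<in> carrier_mat (dim B) (dim B)" by (simp add: pos_def_def)
  have "pos_def (dim B) (design_matrix B \<omega> (Suc n))"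
    using pos_def_rank_one_update[OF V x] by (simp add: arm_def)
  moreover have "w \<bullet> w \<le> w \<bullet> (design_matrix B \<omega> (Suc n) *\<^sub>v w)" if w: "w \<in> carrier_vec (dim B)" for w
  proof -
    have "w \<bullet> (design_matrix B \<omega> (Suc n) *\<^sub>v w) = w \<bullet> (?V *\<^sub>v w) + (?x \<bullet> w)\<^sup>2"
      using car w x comm_scalar_prod[OF w x]
      by (simp add: arm_def[symmetric] add_mult_distrib_mat_vec[of _ "dim B" "dim B"] outer_square_mult_vec[of _ "dim B"]
          scalar_prod_add_distrib[of _ "dim B"] mult_mat_vec_carrier[of _ "dim B" "dim B"] power2_eq_square)
    moreover have "w \<bullet> w \<le> w \<bullet> (?V *\<^sub>v w)" using IH w by blast
    ultimately show ?thesis by (smt (verit) zero_le_power2)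
  qed
  moreover have "design_matrix B \<omega> (Suc n) $$ (i, j) =
      (if i = j then 1 else 0) + (\<Sum>s = 1..Suc n. arm s \<omega> $ i * arm s \<omega> $ j)"
    if ij: "i < dim B" "j < dim B" for i j
    using IH ij car carrier_vecD[OF x]
    by (simp add: arm_def[symmetric] outer_square_def)
  ultimately show ?case by blast
qed

lemma design_matrix:
  assumes "n \<le> horizon B" "\<omega> \<in> \<Omega>"
  shows "pos_def (dim B) (design_matrix B \<omega> n)"
    "w \<in> carrier_vec (dim B) \<Longrightarrow> w \<bullet> w \<le> w \<bullet> (design_matrix B \<omega> n *\<^sub>v w)"
    "i < dim B \<Longrightarrow> j < dim B \<Longrightarrow> design_matrix B \<omega> n $$ (i, j) =
      (if i = j then 1 else 0) + (\<Sum>s = 1..n. arm s \<omega> $ i * arm s \<omega> $ j)"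
  using design_matrix_aux[OF assms] by blast+

lemma design_matrix_carrier:
  "n \<le> horizon B \<Longrightarrow> \<omega> \<in> \<Omega> \<Longrightarrow> design_matrix B \<omega> n \<in> carrier_mat (dim B) (dim B)"
  using design_matrix(1) by (simp add: pos_def_def)

definition inv_root :: "nat \<Rightarrow> 'w \<Rightarrow> real mat" where
  "inv_root n \<omega> = inv_sqrt_mat (dim B) (design_matrix B \<omega> n)"

lemma inv_root_carrier: "n \<le> horizon B \<Longrightarrow> \<omega> \<in> \<Omega> \<Longrightarrow> inv_root n \<omega> \<in> carrier_mat (dim B) (dim B)"
  unfolding inv_root_def
  using inv_sqrt_mat_apply(1)[OF design_matrix(1) zero_carrier_vec] by blast

lemma inv_root_mult_carrier:
  "n \<le> horizon B \<Longrightarrow> \<omega> \<in> \<Omega> \<Longrightarrow> v \<in> carrier_vec (dim B) \<Longrightarrow> inv_root n \<omega> *\<^sub>v v \<in> carrier_vec (dim B)"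
  using inv_root_carrier by (intro mult_mat_vec_carrier)

lemma vnorm_inv_root_le:
  assumes "n \<le> horizon B" "\<omega> \<in> \<Omega>" "v \<in> carrier_vec (dim B)"
  shows "vnorm (inv_root n \<omega> *\<^sub>v v) \<le> vnorm v"
  unfolding inv_root_def using assms by (intro vnorm_inv_sqrt_mat_le design_matrix) auto

text \<open>The width of the overview. The index is \<open>t - 1\<close> because the design matrix
  entering round \<open>t\<close> contains the plays of the earlier rounds only.\<close>

definition arm_width :: "nat \<Rightarrow> 'w \<Rightarrow> real" where
  "arm_width t \<omega> = vnorm (inv_root (t - 1) \<omega> *\<^sub>v arm t \<omega>)"

lemma arm_width_bounds:
  assumes "t \<in> {1..horizon B}" "\<omega> \<in> \<Omega>"
  shows "0 \<le> arm_width t \<omega> \<and> arm_width t \<omega> \<le> 1"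
proof -
  have "t - 1 \<le> horizon B" using assms by auto
  then show ?thesis
    using vnorm_inv_root_le[OF _ assms(2) arm_carrier[OF assms], of "t - 1"] vnorm_arm[OF assms]
    by (auto simp: arm_width_def)
qed

lemma arm_width_power2:
  assumes "n < horizon B" "\<omega> \<in> \<Omega>"
  shows "(arm_width (Suc n) \<omega>)\<^sup>2 = arm (Suc n) \<omega> \<bullet> (mat_inv (design_matrix B \<omega> n) *\<^sub>v arm (Suc n) \<omega>)"
  unfolding arm_width_def inv_root_def
  using assms inv_sqrt_mat_apply(7)[OF design_matrix(1), of n \<omega> "arm (Suc n) \<omega>"] arm_carrier by simp

lemma ln_det_design_matrix:
  assumes "n \<le> horizon B" "\<omega> \<in> \<Omega>"
  shows "det (design_matrix B \<omega> n) > 0 \<and>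
    ln (det (design_matrix B \<omega> n)) = (\<Sum>k<n. ln (1 + (arm_width (Suc k) \<omega>)\<^sup>2))"
  using assms(1)
proof (induction n)
  case 0
  then show ?case by simp
next
  case (Suc n)
  have pos: "0 < 1 + (arm_width (Suc n) \<omega>)\<^sup>2" by (simp add: add_pos_nonneg)
  have "det (design_matrix B \<omega> (Suc n)) = det (design_matrix B \<omega> n) * (1 + (arm_width (Suc n) \<omega>)\<^sup>2)"
    using Suc.prems assms(2) arm_width_power2[of n \<omega>]
      det_rank_one_update[OF design_matrix(1) arm_carrier, of n \<omega> "Suc n" \<omega>]
    by (simp add: arm_def)
  then show ?case using Suc pos by (simp add: ln_mult)
qed

text \<open>The sum is the logarithm of the determinant. Arms of norm at most 1 raise the trace of
  the identity by at most 1 per round, so \<open>pos_def_ln_det_le\<close> applies with mean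
  eigenvalue \<open>1 + horizon B / dim B\<close>.\<close>

lemma sum_ln_arm_width_le:
  assumes "n \<le> horizon B" "\<omega> \<in> \<Omega>"
  shows "(\<Sum>k<n. ln (1 + (arm_width (Suc k) \<omega>)\<^sup>2)) \<le> dim B * ln (1 + horizon B / dim B)"
proof -
  have "(\<Sum>i<dim B. design_matrix B \<omega> n $$ (i, i)) = (\<Sum>i<dim B. 1 + (\<Sum>s = 1..n. (arm s \<omega> $ i)\<^sup>2))"
    using design_matrix(3)[OF assms] by (intro sum.cong) (auto simp: power2_eq_square)
  also have "\<dots> = dim B + (\<Sum>s = 1..n. \<Sum>i<dim B. (arm s \<omega> $ i)\<^sup>2)"
    by (simp add: sum.distrib) (rule sum.swap)
  finally have tr: "(\<Sum>i<dim B. design_matrix B \<omega> n $$ (i, i)) =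
    dim B + (\<Sum>s = 1..n. \<Sum>i<dim B. (arm s \<omega> $ i)\<^sup>2)" .
  have "(\<Sum>s = 1..n. \<Sum>i<dim B. (arm s \<omega> $ i)\<^sup>2) \<le> (\<Sum>s = 1..n. 1)"
  proof (rule sum_mono)
    fix s assume "s \<in> {1..n}"
    then have s: "s \<in> {1..horizon B}" using assms by auto
    have "(\<Sum>i<dim B. (arm s \<omega> $ i)\<^sup>2) = (vnorm (arm s \<omega>))\<^sup>2"
      unfolding vnorm_power2 using arm_carrier[OF s assms(2)]
      by (simp add: scalar_prod_def power2_eq_square atLeast0LessThan)
    also have "\<dots> \<le> 1" using vnorm_arm[OF s assms(2)] by (simp add: power_le_one)
    finally show "(\<Sum>i<dim B. (arm s \<omega> $ i)\<^sup>2) \<le> 1" .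
  qed
  moreover have "real (dim B) + n \<le> dim B * (1 + horizon B / dim B)"
    using dim_pos assms by (simp add: field_simps)
  ultimately have tr: "(\<Sum>i<dim B. design_matrix B \<omega> n $$ (i, i)) \<le> dim B * (1 + horizon B / dim B)"
    using tr by simp
  have "1 + real (horizon B) / dim B > 0" by (simp add: add_pos_nonneg)
  from pos_def_ln_det_le(2)[OF design_matrix(1)[OF assms] this tr] ln_det_design_matrix[OF assms]
  show ?thesis by simp
qed

text \<open>The elliptical potential argument: Cauchy-Schwarz passes to squares, and as a width is
  at most 1, its square \<open>z\<close> satisfies \<open>z \<le> 2 * ln (1 + z)\<close>, twice its
  share of the log-determinant.\<close>

lemma sum_arm_width_le:
  assumes \<omega>: "\<omega> \<in> \<Omega>"
  shows "(\<Sum>t = 1..horizon B. arm_width t \<omega>) \<le>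
    sqrt (2 * horizon B * dim B * ln (1 + horizon B / dim B))"
proof -
  let ?T = "horizon B"
  have le: "(arm_width (Suc k) \<omega>)\<^sup>2 \<le> 2 * ln (1 + (arm_width (Suc k) \<omega>)\<^sup>2)" if "k < ?T" for k
  proof -
    define z where "z = (arm_width (Suc k) \<omega>)\<^sup>2"
    have z: "0 \<le> z" "z \<le> 1" using arm_width_bounds[of "Suc k" \<omega>] that \<omega> by (auto simp: z_def power_le_one)
    have "ln (1 / (1 + z)) \<le> 1 / (1 + z) - 1" using z by (intro ln_le_minus_one) simp
    then have "z / (1 + z) \<le> ln (1 + z)" using z by (simp add: ln_div field_simps)
    moreover have "z / 2 \<le> z / (1 + z)" using z by (intro divide_left_mono) auto
    ultimately have "z \<le> 2 * ln (1 + z)" by linarith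
    then show ?thesis by (simp only: z_def)
  qed
  have eq: "(\<Sum>t = 1..?T. f t) = (\<Sum>k<?T. f (Suc k))" for f :: "nat \<Rightarrow> real"
    using sum.reindex[of Suc "{..<?T}" f] by (simp add: image_Suc_lessThan)
  have "(\<Sum>t = 1..?T. arm_width t \<omega>)\<^sup>2 \<le> ?T * (\<Sum>t = 1..?T. (arm_width t \<omega>)\<^sup>2)"
    using Cauchy_Schwarz_ineq_sum[of "\<lambda>_. 1" "\<lambda>t. arm_width t \<omega>" "{1..?T}"] by simp
  also have "\<dots> \<le> ?T * (2 * (dim B * ln (1 + ?T / dim B)))"
  proof (rule mult_left_mono)
    have "(\<Sum>t = 1..?T. (arm_width t \<omega>)\<^sup>2) \<le> (\<Sum>k<?T. 2 * ln (1 + (arm_width (Suc k) \<omega>)\<^sup>2))"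
      unfolding eq using le by (intro sum_mono) auto
    also have "\<dots> \<le> 2 * (dim B * ln (1 + ?T / dim B))"
      unfolding sum_distrib_left[symmetric] using sum_ln_arm_width_le[OF order_refl \<omega>] by simp
    finally show "(\<Sum>t = 1..?T. (arm_width t \<omega>)\<^sup>2) \<le> 2 * (dim B * ln (1 + ?T / dim B))" .
  qed simp
  finally have "(\<Sum>t = 1..?T. arm_width t \<omega>)\<^sup>2 \<le> 2 * ?T * dim B * ln (1 + ?T / dim B)"
    by (simp add: mult_ac)
  then show ?thesis by (rule real_le_rsqrt)
qed

section \<open>Least squares and the accumulated noise\<close>

definition noise_sum :: "nat \<Rightarrow> 'w \<Rightarrow> real vec" where
  "noise_sum n \<omega> = vec (dim B) (\<lambda>i. \<Sum>s = 1..n. noise B s \<omega> * arm s \<omega> $ i)"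

lemma noise_sum_carrier [simp]: "noise_sum n \<omega> \<in> carrier_vec (dim B)"
  by (simp add: noise_sum_def)

lemma noise_sum_Suc:
  assumes "Suc n \<le> horizon B" "\<omega> \<in> \<Omega>"
  shows "noise_sum (Suc n) \<omega> = noise_sum n \<omega> + noise B (Suc n) \<omega> \<cdot>\<^sub>v arm (Suc n) \<omega>"
  using assms arm_carrier[of "Suc n" \<omega>] by (intro eq_vecI) (auto simp: noise_sum_def)

text \<open>The reward vector is the design matrix minus the identity, applied to the true
  parameter, plus the noise; the subtracted identity is the regularisation and appears as the bias
  \<open>- theta_star B\<close>. The second form mentions plays and rewards only and serves
  measurability.\<close>

lemma least_squares_eq:
  assumes n: "n \<le> horizon B" and \<omega>: "\<omega> \<in> \<Omega>"
  shows "least_squares B \<omega> n = theta_star B + mat_inv (design_matrix B \<omega> n) *\<^sub>v (noise_sum n \<omega> - theta_star B)"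
    and "least_squares B \<omega> n = mat_inv (design_matrix B \<omega> n) *\<^sub>v
      vec (dim B) (\<lambda>i. \<Sum>s = 1..n. reward B s \<omega> * arm s \<omega> $ i)"
proof -
  let ?V = "design_matrix B \<omega> n" and ?\<theta> = "theta_star B" and ?d = "dim B"
  let ?b = "vec ?d (\<lambda>i. \<Sum>s = 1..n. reward B s \<omega> * arm s \<omega> $ i)"
  note V = design_matrix(1)[OF n \<omega>] and inv = pos_def_inverse[OF design_matrix(1)[OF n \<omega>]]
  note car = design_matrix_carrier[OF n \<omega>]
  have sI: "s \<in> {1..horizon B}" if "s \<in> {1..n}" for s using that n by auto
  have nthsum: "(\<Sum>k<n. f (k + 1)) = (\<Sum>s = 1..n. f s)" for f :: "nat \<Rightarrow> real"
    using sum.reindex[of Suc "{..<n}" f] by (simp add: image_Suc_lessThan)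
  show ls: "least_squares B \<omega> n = mat_inv ?V *\<^sub>v ?b"
  proof (cases "n = 0")
    case True
    have "?b = 0\<^sub>v ?d" using True by (intro eq_vecI) auto
    then show ?thesis using True inv(1) by (auto simp: least_squares_def intro!: eq_vecI)
  next
    case False
    define X where "X = mat_of_rows ?d (map (\<lambda>s. feature B (play B s \<omega>)) [1..<Suc n])"
    define Y where "Y = vec_of_list (map (\<lambda>s. reward B s \<omega>) [1..<Suc n])"
    have X: "X \<in> carrier_mat n ?d" unfolding X_def by (rule carrier_matI) (simp_all del: upt_Suc)
    have Xk: "X $$ (k, i) = arm (k + 1) \<omega> $ i" if "k < n" "i < ?d" for k i
      using that by (simp add: X_def mat_of_rows_def arm_def del: upt_Suc)
    have Y: "Y \<in> carrier_vec n" unfolding Y_def by (rule carrier_vecI) (simp del: upt_Suc)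
    have Yk: "Y $ k = reward B (k + 1) \<omega>" if "k < n" for k
      using that by (simp add: Y_def vec_of_list_index del: upt_Suc)
    have "transpose_mat X * X + 1\<^sub>m ?d = ?V"
    proof (rule eq_matI)
      fix i j assume "i < dim_row ?V" "j < dim_col ?V"
      then have ij: "i < ?d" "j < ?d" using car by auto
      have "(transpose_mat X * X) $$ (i, j) = (\<Sum>k<n. arm (k + 1) \<omega> $ i * arm (k + 1) \<omega> $ j)"
        using X ij Xk by (simp add: scalar_prod_def atLeast0LessThan)
      also have "\<dots> = (\<Sum>s = 1..n. arm s \<omega> $ i * arm s \<omega> $ j)" by (rule nthsum)
      finally show "(transpose_mat X * X + 1\<^sub>m ?d) $$ (i, j) = ?V $$ (i, j)"
        using design_matrix(3)[OF n \<omega> ij] X ij by simp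
    qed (use X car in auto)
    moreover have "transpose_mat X *\<^sub>v Y = ?b"
    proof (rule eq_vecI)
      fix i assume "i < dim_vec ?b"
      then have i: "i < ?d" by simp
      have "(transpose_mat X *\<^sub>v Y) $ i = (\<Sum>k<n. reward B (k + 1) \<omega> * arm (k + 1) \<omega> $ i)"
        using X Y i Xk Yk by (simp add: scalar_prod_def atLeast0LessThan mult.commute)
      also have "\<dots> = (\<Sum>s = 1..n. reward B s \<omega> * arm s \<omega> $ i)" by (rule nthsum)
      finally show "(transpose_mat X *\<^sub>v Y) $ i = ?b $ i" using i by simp
    qed (use X in auto)
    ultimately show ?thesis using False by (simp add: least_squares_def X_def Y_def del: upt_Suc)
  qed
  have "?b = ?V *\<^sub>v ?\<theta> + (noise_sum n \<omega> - ?\<theta>)"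
  proof (rule eq_vecI)
    fix i assume "i < dim_vec (?V *\<^sub>v ?\<theta> + (noise_sum n \<omega> - ?\<theta>))"
    then have i: "i < ?d" using theta_star by auto
    have "(?V *\<^sub>v ?\<theta>) $ i = (\<Sum>j<?d. ?V $$ (i, j) * ?\<theta> $ j)"
      using car i theta_star by (simp add: scalar_prod_def atLeast0LessThan)
    also have "\<dots> = (\<Sum>j<?d. (if i = j then ?\<theta> $ j else 0) + (\<Sum>s = 1..n. arm s \<omega> $ i * (arm s \<omega> $ j * ?\<theta> $ j)))"
      using design_matrix(3)[OF n \<omega> i] by (intro sum.cong) (auto simp: distrib_left distrib_right sum_distrib_left sum_distrib_right mult_ac)
    also have "\<dots> = ?\<theta> $ i + (\<Sum>s = 1..n. arm s \<omega> $ i * (\<Sum>j<?d. arm s \<omega> $ j * ?\<theta> $ j))"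
      using i by (simp add: sum.distrib sum_distrib_left) (rule sum.swap)
    also have "(\<Sum>s = 1..n. arm s \<omega> $ i * (\<Sum>j<?d. arm s \<omega> $ j * ?\<theta> $ j)) =
      (\<Sum>s = 1..n. arm s \<omega> $ i * (?\<theta> \<bullet> arm s \<omega>))"
    proof (intro sum.cong refl)
      fix s assume s: "s \<in> {1..n}"
      show "arm s \<omega> $ i * (\<Sum>j<?d. arm s \<omega> $ j * ?\<theta> $ j) = arm s \<omega> $ i * (?\<theta> \<bullet> arm s \<omega>)"
        using arm_carrier[OF sI[OF s] \<omega>] by (simp add: scalar_prod_def atLeast0LessThan mult.commute)
    qed
    finally have "(?V *\<^sub>v ?\<theta>) $ i = ?\<theta> $ i + (\<Sum>s = 1..n. arm s \<omega> $ i * (?\<theta> \<bullet> arm s \<omega>))" .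
    then show "?b $ i = (?V *\<^sub>v ?\<theta> + (noise_sum n \<omega> - ?\<theta>)) $ i"
      using i theta_star car
      by (simp add: noise_sum_def reward_def arm_def[symmetric] distrib_left distrib_right sum.distrib mult.commute)
  qed (use theta_star in auto)
  then have "least_squares B \<omega> n = mat_inv ?V *\<^sub>v (?V *\<^sub>v ?\<theta>) + mat_inv ?V *\<^sub>v (noise_sum n \<omega> - ?\<theta>)"
    unfolding ls using inv car theta_star by (simp add: mult_add_distrib_mat_vec[of _ ?d ?d] mult_mat_vec_carrier[of _ ?d ?d])
  moreover have "mat_inv ?V *\<^sub>v (?V *\<^sub>v ?\<theta>) = ?\<theta>"
    using inv car theta_star by (simp add: assoc_mult_mat_vec[of _ ?d ?d _ ?d, symmetric] del: assoc_mult_mat_vec)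
  ultimately show "least_squares B \<omega> n = ?\<theta> + mat_inv ?V *\<^sub>v (noise_sum n \<omega> - ?\<theta>)" by simp
qed

lemma optimal_arm:
  assumes "t \<le> horizon B"
  shows "optimal_arm B t \<in> arms B t"
    "a \<in> arms B t \<Longrightarrow> feature B a \<bullet> theta_star B \<le> feature B (optimal_arm B t) \<bullet> theta_star B"
proof -
  let ?f = "\<lambda>a. feature B a \<bullet> theta_star B"
  have "\<exists>x. is_arg_min (\<lambda>a. - ?f a) (\<lambda>a. a \<in> arms B t) x"
    using arms[OF assms] by (intro ex_is_arg_min_if_finite) auto
  then have "\<exists>x. is_arg_max ?f (\<lambda>a. a \<in> arms B t) x" by (simp add: is_arg_min_def is_arg_max_def)
  then have "is_arg_max ?f (\<lambda>a. a \<in> arms B t) (optimal_arm B t)"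
    unfolding optimal_arm_def arg_max_on_def arg_max_def by (rule someI_ex)
  then show "optimal_arm B t \<in> arms B t"
    "a \<in> arms B t \<Longrightarrow> feature B a \<bullet> theta_star B \<le> feature B (optimal_arm B t) \<bullet> theta_star B"
    by (auto simp: is_arg_max_def not_less)
qed

definition optimal_vec :: "nat \<Rightarrow> real vec" where
  "optimal_vec t = feature B (optimal_arm B t)"

lemma optimal_vec:
  assumes "t \<le> horizon B"
  shows "optimal_vec t \<in> carrier_vec (dim B)" "vnorm (optimal_vec t) \<le> 1" "optimal_vec t \<in> points B t"
  using feature_in_unit_ball[OF assms optimal_arm(1)[OF assms]] optimal_arm(1)[OF assms]
  by (auto simp: optimal_vec_def unit_ball_def points_def)

lemma design_matrix_cong:
  "(\<And>s. s \<in> {1..n} \<Longrightarrow> play B s \<omega> = play B s \<omega>') \<Longrightarrow> design_matrix B \<omega> n = design_matrix B \<omega>' n"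
  by (induction n) auto

text \<open>Common abstraction of \<open>past_measure\<close>, \<open>history\<close> and the full
  probability space, so that each measurability argument is made once. Before round \<open>t\<close>
  the first two observe \<open>t - 1\<close> complete rounds.\<close>

definition observes :: "'w measure \<Rightarrow> nat \<Rightarrow> bool" where
  "observes N m \<longleftrightarrow> m \<le> horizon B \<and> space N = \<Omega> \<and>
     (\<forall>s \<in> {1..m}. play B s \<in> measurable N (count_space UNIV) \<and> reward B s \<in> borel_measurable N)"

lemma observes_past: "t \<in> {1..horizon B} \<Longrightarrow> observes (past_measure t) (t - 1)"
  unfolding observes_def using past_measurable(2,3)[of t] by auto

lemma observes_history: "t \<in> {1..horizon B} \<Longrightarrow> observes (history B t) (t - 1)"
  unfolding observes_def using history_measurable[of t] by auto

lemma observes_prob: "observes (prob B) (horizon B)"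
  unfolding observes_def using play_measurable reward_measurable by auto

lemma observes_mono: "observes N m \<Longrightarrow> k \<le> m \<Longrightarrow> observes N k"
  by (auto simp: observes_def)

lemma observes_play_determined:
  fixes f :: "'w \<Rightarrow> real"
  assumes N: "observes N m"
    and f: "\<And>\<omega> \<omega>'. \<omega> \<in> \<Omega> \<Longrightarrow> \<omega>' \<in> \<Omega> \<Longrightarrow> (\<And>s. s \<in> {1..m} \<Longrightarrow> play B s \<omega> = play B s \<omega>') \<Longrightarrow> f \<omega> = f \<omega>'"
  shows "f \<in> borel_measurable N"
  using N by (intro play_determined_measurable[where m = m] f) (auto simp: observes_def)

lemma arm_coord_measurable:
  "play B s \<in> measurable N (count_space UNIV) \<Longrightarrow> (\<lambda>\<omega>. arm s \<omega> $ i) \<in> borel_measurable N"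
  unfolding arm_def by (drule measurable_compose[of _ _ _ "\<lambda>a. feature B a $ i" borel]) simp_all

text \<open>The noise is not among the generators of the sigma-algebras; it is recovered from the
  play and the reward.\<close>

lemma noise_eq: "noise B s \<omega> = reward B s \<omega> - theta_star B \<bullet> arm s \<omega>"
  by (simp add: reward_def arm_def)

lemma noise_measurable':
  assumes "play B s \<in> measurable N (count_space UNIV)" "reward B s \<in> borel_measurable N"
  shows "noise B s \<in> borel_measurable N"
proof -
  have "(\<lambda>\<omega>. theta_star B \<bullet> arm s \<omega>) \<in> borel_measurable N"
    unfolding arm_def by (rule measurable_compose[OF assms(1)]) simp
  then show ?thesis unfolding noise_eq[abs_def] by (rule borel_measurable_diff[OF assms(2)])
qed

lemma noise_sum_measurable:
  assumes N: "observes N n" and i: "i < dim B"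
  shows "(\<lambda>\<omega>. noise_sum n \<omega> $ i) \<in> borel_measurable N"
  using N i unfolding noise_sum_def observes_def
  by (auto intro!: borel_measurable_sum borel_measurable_times noise_measurable' arm_coord_measurable)

lemma mat_inv_measurable:
  assumes N: "observes N n"
  shows "(\<lambda>\<omega>. mat_inv (design_matrix B \<omega> n) $$ (i, j)) \<in> borel_measurable N"
  by (rule observes_play_determined[OF N]) (use design_matrix_cong[of n] in metis)

lemma inv_root_measurable:
  assumes N: "observes N n"
  shows "(\<lambda>\<omega>. inv_root n \<omega> $$ (i, j)) \<in> borel_measurable N"
  unfolding inv_root_def by (rule observes_play_determined[OF N]) (use design_matrix_cong[of n] in metis)

lemma quadratic_form_measurable:
  fixes u v :: "'w \<Rightarrow> real vec" and A :: "'w \<Rightarrow> real mat"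
  assumes N: "space N = \<Omega>"
    and u: "\<And>i. i < dim B \<Longrightarrow> (\<lambda>\<omega>. u \<omega> $ i) \<in> borel_measurable N"
    and v: "\<And>i. i < dim B \<Longrightarrow> (\<lambda>\<omega>. v \<omega> $ i) \<in> borel_measurable N"
    and A: "\<And>i j. (\<lambda>\<omega>. A \<omega> $$ (i, j)) \<in> borel_measurable N"
    and car: "\<And>\<omega>. \<omega> \<in> \<Omega> \<Longrightarrow> u \<omega> \<in> carrier_vec (dim B)" "\<And>\<omega>. \<omega> \<in> \<Omega> \<Longrightarrow> v \<omega> \<in> carrier_vec (dim B)"
      "\<And>\<omega>. \<omega> \<in> \<Omega> \<Longrightarrow> A \<omega> \<in> carrier_mat (dim B) (dim B)"
  shows "(\<lambda>\<omega>. u \<omega> \<bullet> (A \<omega> *\<^sub>v v \<omega>)) \<in> borel_measurable N"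
proof -
  have "(\<lambda>\<omega>. \<Sum>i<dim B. \<Sum>j<dim B. u \<omega> $ i * A \<omega> $$ (i, j) * v \<omega> $ j) \<in> borel_measurable N"
    using u v A by (auto intro!: borel_measurable_sum borel_measurable_times)
  moreover have "u \<omega> \<bullet> (A \<omega> *\<^sub>v v \<omega>) = (\<Sum>i<dim B. \<Sum>j<dim B. u \<omega> $ i * A \<omega> $$ (i, j) * v \<omega> $ j)"
    if "\<omega> \<in> space N" for \<omega>
    using that N car by (intro quadratic_form_sum) auto
  ultimately show ?thesis by (simp cong: measurable_cong)
qed

lemma mat_inv_carrier: "n \<le> horizon B \<Longrightarrow> \<omega> \<in> \<Omega> \<Longrightarrow> mat_inv (design_matrix B \<omega> n) \<in> carrier_mat (dim B) (dim B)"
  using pos_def_inverse(1)[OF design_matrix(1)] by blast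

text \<open>The process to which \<open>self_normalised_bound\<close> is applied as
  \<open>Q\<close>.\<close>

definition noise_norm2 :: "nat \<Rightarrow> 'w \<Rightarrow> real" where
  "noise_norm2 n \<omega> = noise_sum n \<omega> \<bullet> (mat_inv (design_matrix B \<omega> n) *\<^sub>v noise_sum n \<omega>)"

lemma noise_norm2_measurable: "observes N n \<Longrightarrow> noise_norm2 n \<in> borel_measurable N"
  unfolding noise_norm2_def
  by (rule quadratic_form_measurable)
     (auto simp: observes_def intro!: noise_sum_measurable mat_inv_measurable mat_inv_carrier)

lemma vnorm_noise_sum:
  "n \<le> horizon B \<Longrightarrow> \<omega> \<in> \<Omega> \<Longrightarrow> (vnorm (inv_root n \<omega> *\<^sub>v noise_sum n \<omega>))\<^sup>2 = noise_norm2 n \<omega>"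
  unfolding noise_norm2_def inv_root_def by (rule inv_sqrt_mat_apply(7)[OF design_matrix(1)]) auto

lemma arm_width_cong:
  assumes "\<And>s. s \<in> {1..Suc n} \<Longrightarrow> play B s \<omega> = play B s \<omega>'"
  shows "arm_width (Suc n) \<omega> = arm_width (Suc n) \<omega>'"
proof -
  have "design_matrix B \<omega> n = design_matrix B \<omega>' n" using assms by (intro design_matrix_cong) auto
  moreover have "play B (Suc n) \<omega> = play B (Suc n) \<omega>'" using assms by auto
  ultimately show ?thesis by (simp add: arm_width_def inv_root_def arm_def)
qed

lemma arm_width_measurable: "observes N (Suc n) \<Longrightarrow> arm_width (Suc n) \<in> borel_measurable N"
  by (rule observes_play_determined) (use arm_width_cong in blast)+

text \<open>Expansion of the quadratic form at the new noise sum, combined with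
  \<open>mat_inv_rank_one_update\<close>; symmetry of the inverse matrix is read off from its square
  root. The shape is dictated by \<open>QSuc\<close>.\<close>

lemma noise_norm2_Suc:
  assumes n: "Suc n \<le> horizon B" and \<omega>: "\<omega> \<in> \<Omega>"
  defines "\<eta> \<equiv> noise B (Suc n) \<omega>" and "s \<equiv> (arm_width (Suc n) \<omega>)\<^sup>2"
    and "\<mu> \<equiv> arm (Suc n) \<omega> \<bullet> (mat_inv (design_matrix B \<omega> n) *\<^sub>v noise_sum n \<omega>)"
  shows "noise_norm2 (Suc n) \<omega> = noise_norm2 n \<omega> + (2 * \<eta> * \<mu> + \<eta>\<^sup>2 * s - (\<mu> + \<eta> * s)\<^sup>2 / (1 + s))"
proof -
  let ?d = "dim B"
  have n': "n \<le> horizon B" using n by simp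
  define W where "W = mat_inv (design_matrix B \<omega> n)"
  define S where "S = noise_sum n \<omega>"
  define x where "x = arm (Suc n) \<omega>"
  have V: "pos_def ?d (design_matrix B \<omega> n)" by (rule design_matrix(1)[OF n' \<omega>])
  have x: "x \<in> carrier_vec ?d" using n \<omega> by (simp add: x_def arm_carrier)
  have W: "W \<in> carrier_mat ?d ?d" unfolding W_def by (rule mat_inv_carrier[OF n' \<omega>])
  have S: "S \<in> carrier_vec ?d" by (simp add: S_def)
  have s: "s = x \<bullet> (W *\<^sub>v x)"
    unfolding s_def x_def W_def using n \<omega> by (simp add: arm_width_power2)
  have sym: "u \<bullet> (W *\<^sub>v v) = v \<bullet> (W *\<^sub>v u)" if "u \<in> carrier_vec ?d" "v \<in> carrier_vec ?d" for u v
    unfolding W_def using inv_sqrt_mat_apply(5)[OF V that(2,1)] inv_sqrt_mat_apply(5)[OF V that]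
      comm_scalar_prod[OF inv_sqrt_mat_apply(3)[OF V that(1)] inv_sqrt_mat_apply(3)[OF V that(2)]] by simp
  define z where "z = S + \<eta> \<cdot>\<^sub>v x"
  have z: "z \<in> carrier_vec ?d" using S x by (simp add: z_def)
  have Wz: "W *\<^sub>v z = W *\<^sub>v S + \<eta> \<cdot>\<^sub>v (W *\<^sub>v x)"
    using W S x by (simp add: z_def mult_add_distrib_mat_vec[of _ ?d ?d] mult_mat_vec[of _ ?d ?d])
  have c: "W *\<^sub>v S \<in> carrier_vec ?d" "W *\<^sub>v x \<in> carrier_vec ?d" using W S x by auto
  have \<mu>: "\<mu> = x \<bullet> (W *\<^sub>v S)" by (simp add: \<mu>_def x_def W_def S_def)
  have xz: "x \<bullet> (W *\<^sub>v z) = \<mu> + \<eta> * s"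
    unfolding Wz \<mu> s using x c by (simp add: scalar_prod_add_distrib[of _ ?d])
  have "z \<bullet> (W *\<^sub>v z) = S \<bullet> (W *\<^sub>v z) + \<eta> * (x \<bullet> (W *\<^sub>v z))"
  proof -
    have "(S + \<eta> \<cdot>\<^sub>v x) \<bullet> y = S \<bullet> y + \<eta> * (x \<bullet> y)" if "y \<in> carrier_vec ?d" for y
      using S x that by (simp add: add_scalar_prod_distrib[of _ ?d])
    then show ?thesis using W z unfolding z_def[symmetric] by simp
  qed
  also have "S \<bullet> (W *\<^sub>v z) = S \<bullet> (W *\<^sub>v S) + \<eta> * \<mu>"
    unfolding Wz \<mu> using sym[OF S x] S c by (simp add: scalar_prod_add_distrib[of _ ?d])
  finally have zz: "z \<bullet> (W *\<^sub>v z) = noise_norm2 n \<omega> + 2 * \<eta> * \<mu> + \<eta>\<^sup>2 * s"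
    unfolding xz by (simp add: noise_norm2_def S_def W_def power2_eq_square algebra_simps)
  have "noise_norm2 (Suc n) \<omega> = z \<bullet> (mat_inv (design_matrix B \<omega> n + outer_square x) *\<^sub>v z)"
    using noise_sum_Suc[OF n \<omega>] by (simp add: noise_norm2_def z_def S_def \<eta>_def x_def arm_def)
  also have "\<dots> = z \<bullet> (W *\<^sub>v z) - (x \<bullet> (W *\<^sub>v z))\<^sup>2 / (1 + x \<bullet> (W *\<^sub>v x))"
    unfolding W_def by (rule mat_inv_rank_one_update[OF V x z])
  finally show ?thesis unfolding xz zz s[symmetric] by simp
qed

text \<open>Markov's inequality for the exponential supermartingale, with the random log-determinant
  replaced by its deterministic bound. The statement is for one \<open>n\<close>; the union over
  rounds is taken at the end.\<close>

lemma measure_noise_norm2: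
  assumes n: "n \<le> horizon B" and \<delta>': "0 < \<delta>'" "\<delta>' < 1"
  shows "measure (prob B) {\<omega> \<in> \<Omega>. noise_norm2 n \<omega> > 2 * ln (1 / \<delta>') + dim B * ln (1 + horizon B / dim B)} \<le> \<delta>'"
proof -
  interpret P: prob_space "prob B" by (rule prob_space_run)
  let ?s = "\<lambda>n \<omega>. (arm_width (Suc n) \<omega>)\<^sup>2"
  let ?G = "\<lambda>\<omega>. ennreal (exp ((noise_norm2 n \<omega> - (\<Sum>k<n. ln (1 + ?s k \<omega>))) / 2))"
  have I: "Suc k \<in> {1..horizon B}" if "k < horizon B" for k using that by auto
  have obs: "observes (history B (Suc k)) k" if "k < horizon B" for k
    using observes_history[OF I[OF that]] by simp
  have le1: "(\<integral>\<^sup>+ \<omega>. ?G \<omega> \<partial>prob B) \<le> 1"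
  proof (rule P.self_normalised_bound[where F = "\<lambda>n. history B (Suc n)" and \<eta> = "\<lambda>n. noise B (Suc n)"
        and \<mu> = "\<lambda>n \<omega>. arm (Suc n) \<omega> \<bullet> (mat_inv (design_matrix B \<omega> n) *\<^sub>v noise_sum n \<omega>)" and N = "horizon B"])
    fix k assume k: "k < horizon B"
    show "subalgebra (prob B) (history B (Suc k))" by (rule subalgebra_history[OF I[OF k]])
    show "noise B (Suc k) \<in> borel_measurable (prob B)" by (rule noise_measurable[OF I[OF k]])
    show "AE \<omega> in prob B. nn_cond_exp (prob B) (history B (Suc k)) (\<lambda>\<omega>. ennreal (exp (\<alpha> * noise B (Suc k) \<omega>))) \<omega>
        \<le> ennreal (exp (\<alpha>\<^sup>2 / 2))" for \<alpha>
      using bandit I[OF k] unfolding linear_bandit_def by blast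
    show "noise_norm2 k \<in> borel_measurable (history B (Suc k))"
      by (rule noise_norm2_measurable[OF obs[OF k]])
    show "(\<lambda>\<omega>. arm (Suc k) \<omega> \<bullet> (mat_inv (design_matrix B \<omega> k) *\<^sub>v noise_sum k \<omega>)) \<in> borel_measurable (history B (Suc k))"
      using obs[OF k] k arm_carrier[OF I[OF k]]
      by (intro quadratic_form_measurable noise_sum_measurable mat_inv_measurable mat_inv_carrier
          arm_coord_measurable history_measurable(1)[OF I[OF k]]) auto
    show "?s j \<in> borel_measurable (history B (Suc k))" if "j \<le> k" for j
    proof -
      have "arm_width (Suc j) \<in> borel_measurable (history B (Suc k))"
        using that k history_measurable(1)[OF I[OF k]]
        by (intro play_determined_measurable[where m = "Suc j"] arm_width_cong) auto
      then show ?thesis by (rule borel_measurable_power)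
    qed
    show "0 \<le> ?s k \<omega>" for \<omega> by simp
    \<comment> \<open>The hypothesis \<open>deg\<close>: by Cauchy-Schwarz in the metric of the
      inverse design matrix, an arm of width zero is orthogonal to the noise sum.\<close>
    show "arm (Suc k) \<omega> \<bullet> (mat_inv (design_matrix B \<omega> k) *\<^sub>v noise_sum k \<omega>) = 0" if "\<omega> \<in> \<Omega>" "?s k \<omega> = 0" for \<omega>
    proof -
      have k': "k \<le> horizon B" using k by simp
      note V = design_matrix(1)[OF k' that(1)]
      have x: "arm (Suc k) \<omega> \<in> carrier_vec (dim B)" by (rule arm_carrier[OF I[OF k] that(1)])
      have "vnorm (inv_root k \<omega> *\<^sub>v arm (Suc k) \<omega>) = 0" using that(2) by (simp add: arm_width_def)
      moreover have "\<bar>(inv_root k \<omega> *\<^sub>v arm (Suc k) \<omega>) \<bullet> (inv_root k \<omega> *\<^sub>v noise_sum k \<omega>)\<bar> \<le>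
        vnorm (inv_root k \<omega> *\<^sub>v arm (Suc k) \<omega>) * vnorm (inv_root k \<omega> *\<^sub>v noise_sum k \<omega>)"
        using x by (intro scalar_prod_le_vnorm[of _ "dim B"] inv_root_mult_carrier[OF k' that(1)]) auto
      ultimately show ?thesis
        using inv_sqrt_mat_apply(5)[OF V noise_sum_carrier x] by (simp add: inv_root_def)
    qed
    show "noise_norm2 (Suc k) \<omega> = noise_norm2 k \<omega> + (2 * noise B (Suc k) \<omega> *
        (arm (Suc k) \<omega> \<bullet> (mat_inv (design_matrix B \<omega> k) *\<^sub>v noise_sum k \<omega>)) + (noise B (Suc k) \<omega>)\<^sup>2 * ?s k \<omega>
        - (arm (Suc k) \<omega> \<bullet> (mat_inv (design_matrix B \<omega> k) *\<^sub>v noise_sum k \<omega>) + noise B (Suc k) \<omega> * ?s k \<omega>)\<^sup>2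
          / (1 + ?s k \<omega>))" if "\<omega> \<in> \<Omega>" for \<omega>
      using noise_norm2_Suc[OF _ that, of k] k by simp
  next
    show "noise_norm2 0 \<omega> = 0" for \<omega>
      by (simp add: noise_norm2_def noise_sum_def scalar_prod_def)
  qed (use n in auto)
  have obsP: "observes (prob B) n" using observes_prob n by (rule observes_mono)
  have [measurable]: "noise_norm2 n \<in> borel_measurable (prob B)" by (rule noise_norm2_measurable[OF obsP])
  have [measurable]: "k \<in> {..<n} \<Longrightarrow> arm_width (Suc k) \<in> borel_measurable (prob B)" for k
    using observes_mono[OF obsP, of "Suc k"] by (intro arm_width_measurable) auto
  have [measurable]: "?G \<in> borel_measurable (prob B)" by measurable
  have "emeasure (prob B) {\<omega> \<in> \<Omega>. noise_norm2 n \<omega> > 2 * ln (1 / \<delta>') + dim B * ln (1 + horizon B / dim B)}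
    \<le> emeasure (prob B) ({\<omega> \<in> \<Omega>. 1 \<le> ennreal \<delta>' * ?G \<omega>})"
  proof (rule emeasure_mono)
    show "{\<omega> \<in> \<Omega>. 1 \<le> ennreal \<delta>' * ?G \<omega>} \<in> sets (prob B)" by measurable
    show "{\<omega> \<in> \<Omega>. noise_norm2 n \<omega> > 2 * ln (1 / \<delta>') + dim B * ln (1 + horizon B / dim B)} \<subseteq>
      {\<omega> \<in> \<Omega>. 1 \<le> ennreal \<delta>' * ?G \<omega>}"
    proof safe
      fix \<omega> assume \<omega>: "\<omega> \<in> \<Omega>" and gt: "noise_norm2 n \<omega> > 2 * ln (1 / \<delta>') + dim B * ln (1 + horizon B / dim B)"
      have "2 * ln (1 / \<delta>') \<le> noise_norm2 n \<omega> - dim B * ln (1 + horizon B / dim B)" using gt by argo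
      also have "\<dots> \<le> noise_norm2 n \<omega> - (\<Sum>k<n. ln (1 + ?s k \<omega>))"
        by (intro diff_left_mono sum_ln_arm_width_le[OF n \<omega>])
      finally have "ln (1 / \<delta>') \<le> (noise_norm2 n \<omega> - (\<Sum>k<n. ln (1 + ?s k \<omega>))) / 2"
        by (simp only: le_divide_eq_numeral1 mult.commute)
      then have "exp (ln (1 / \<delta>')) \<le> exp ((noise_norm2 n \<omega> - (\<Sum>k<n. ln (1 + ?s k \<omega>))) / 2)" by simp
      then have "1 \<le> \<delta>' * exp ((noise_norm2 n \<omega> - (\<Sum>k<n. ln (1 + ?s k \<omega>))) / 2)"
        using \<delta>' by (simp add: field_simps)
      then show "1 \<le> ennreal \<delta>' * ?G \<omega>" using \<delta>' by (simp add: ennreal_mult[symmetric] flip: ennreal_1)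
    qed
  qed
  also have "\<dots> \<le> ennreal \<delta>' * (\<integral>\<^sup>+ \<omega>. ?G \<omega> \<partial>prob B)"
  proof -
    have "(\<integral>\<^sup>+ \<omega>. ?G \<omega> * indicator \<Omega> \<omega> \<partial>prob B) = (\<integral>\<^sup>+ \<omega>. ?G \<omega> \<partial>prob B)"
      by (intro nn_integral_cong) simp
    then show ?thesis using nn_integral_Markov_inequality[of ?G \<Omega> "prob B" "ennreal \<delta>'"] by simp
  qed
  also have "\<dots> \<le> ennreal \<delta>' * 1" using le1 by (intro mult_left_mono) auto
  finally show ?thesis using \<delta>' by (simp add: P.emeasure_eq_measure)
qed

end

subsection \<open>Thompson sampling\<close>

locale thompson_sampling = bandit_algorithm B D C_change
  for B :: "('w, 'a, 's, 'st) bandit_run" and D :: "real vec measure" and C_change :: nat +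
  fixes p b b' :: real
  assumes sampling: "sampling_distribution (dim B) p b b' D"
    and constants: "p > 0" "b > 0" "b' > 0"
begin

definition radius :: "real \<Rightarrow> real" where
  "radius \<epsilon> = sqrt (b * dim B * ln (b' * dim B / \<epsilon>))"

lemma prob_space_D: "prob_space D" and space_D: "space D = carrier_vec (dim B)"
  and sets_D: "sets D = sets (borel_vec (dim B))"
proof -
  show "prob_space D" and s: "sets D = sets (borel_vec (dim B))"
    using sampling by (auto simp: sampling_distribution_def)
  show "space D = carrier_vec (dim B)"
    using sets_eq_imp_space_eq[OF s] by (simp add: borel_vec_def)
qed

text \<open>Here too measurability follows from a positive lower bound on \<open>measure\<close>;
  this uses \<open>p > 0\<close>.\<close>

lemma anti_concentration:
  assumes "u \<in> carrier_vec (dim B)" "vnorm u = 1"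
  shows "{\<xi> \<in> space D. u \<bullet> \<xi> \<ge> 1} \<in> sets D" "measure D {\<xi> \<in> space D. u \<bullet> \<xi> \<ge> 1} \<ge> p"
proof -
  show m: "measure D {\<xi> \<in> space D. u \<bullet> \<xi> \<ge> 1} \<ge> p"
    using sampling assms by (auto simp: sampling_distribution_def)
  show "{\<xi> \<in> space D. u \<bullet> \<xi> \<ge> 1} \<in> sets D"
    using m constants(1) by (rule_tac ccontr) (simp add: measure_notin_sets)
qed

lemma concentration:
  assumes "0 < \<epsilon>" "\<epsilon> < 1"
  shows "{\<xi> \<in> space D. vnorm \<xi> \<le> radius \<epsilon>} \<in> sets D" "measure D {\<xi> \<in> space D. vnorm \<xi> \<le> radius \<epsilon>} \<ge> 1 - \<epsilon>"
proof -
  show m: "measure D {\<xi> \<in> space D. vnorm \<xi> \<le> radius \<epsilon>} \<ge> 1 - \<epsilon>"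
    using sampling assms by (auto simp: sampling_distribution_def radius_def)
  show "{\<xi> \<in> space D. vnorm \<xi> \<le> radius \<epsilon>} \<in> sets D"
    using m assms by (rule_tac ccontr) (simp add: measure_notin_sets)
qed

lemma optimistic_probability:
  assumes u: "u \<in> carrier_vec (dim B)" "vnorm u = 1" and e: "0 < \<epsilon>" "\<epsilon> < 1"
  shows "{\<xi> \<in> space D. u \<bullet> \<xi> \<ge> 1 \<and> vnorm \<xi> \<le> radius \<epsilon>} \<in> sets D"
    "measure D {\<xi> \<in> space D. u \<bullet> \<xi> \<ge> 1 \<and> vnorm \<xi> \<le> radius \<epsilon>} \<ge> p - \<epsilon>"
proof -
  interpret D: prob_space D by (rule prob_space_D)
  let ?A = "{\<xi> \<in> space D. u \<bullet> \<xi> \<ge> 1}" and ?C = "{\<xi> \<in> space D. vnorm \<xi> \<le> radius \<epsilon>}"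
  have eq: "{\<xi> \<in> space D. u \<bullet> \<xi> \<ge> 1 \<and> vnorm \<xi> \<le> radius \<epsilon>} = ?A \<inter> ?C" by auto
  note m = anti_concentration[OF u] concentration[OF e]
  show "{\<xi> \<in> space D. u \<bullet> \<xi> \<ge> 1 \<and> vnorm \<xi> \<le> radius \<epsilon>} \<in> sets D" unfolding eq using m by auto
  have "measure D (?A \<union> ?C) + measure D (?A \<inter> ?C) = measure D ?A + measure D ?C"
    using measure_Un3[of ?A D ?C] m by (simp add: D.fmeasurable_eq_sets)
  moreover have "measure D (?A \<union> ?C) \<le> 1" by simp
  ultimately show "measure D {\<xi> \<in> space D. u \<bullet> \<xi> \<ge> 1 \<and> vnorm \<xi> \<le> radius \<epsilon>} \<ge> p - \<epsilon>"
    unfolding eq using m by linarith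
qed

lemma vnorm_unit_vec0: "vnorm (unit_vec (dim B) 0) = 1"
  using dim_pos by (simp add: vnorm_def)

text \<open>The half-spaces belonging to opposite unit vectors are disjoint, and each has
  probability at least \<open>p\<close>. The bound later absorbs absolute constants into
  \<open>6 / p\<close>.\<close>

lemma p_le_half: "p \<le> 1 / 2"
proof -
  interpret D: prob_space D by (rule prob_space_D)
  let ?u = "unit_vec (dim B) 0 :: real vec"
  let ?v = "(-1) \<cdot>\<^sub>v ?u"
  let ?A = "{\<xi> \<in> space D. ?u \<bullet> \<xi> \<ge> 1}" and ?C = "{\<xi> \<in> space D. ?v \<bullet> \<xi> \<ge> 1}"
  have v: "?v \<in> carrier_vec (dim B)" "vnorm ?v = 1"
    unfolding vnorm_smult using vnorm_unit_vec0 by auto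
  note m = anti_concentration[OF unit_vec_carrier vnorm_unit_vec0] anti_concentration[OF v]
  have "?v \<bullet> \<xi> = - (?u \<bullet> \<xi>)" if "\<xi> \<in> space D" for \<xi>
    using that smult_scalar_prod_distrib[OF unit_vec_carrier, of \<xi> "dim B" "-1" 0] by (simp add: space_D)
  then have "?A \<inter> ?C = {}" by fastforce
  then have "measure D ?A + measure D ?C = measure D (?A \<union> ?C)"
    using m by (intro D.finite_measure_Union[symmetric]) auto
  also have "\<dots> \<le> 1" by simp
  finally show ?thesis using m by linarith
qed

text \<open>For \<epsilon> below \<open>p\<close> some sample is at once optimistic and inside the
  ball, and a vector whose inner product with a unit vector is at least 1 cannot be shorter than
  1.\<close>

lemma radius_ge_1:
  assumes "0 < \<epsilon>" "\<epsilon> < p"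
  shows "radius \<epsilon> \<ge> 1"
proof -
  have e1: "\<epsilon> < 1" using assms p_le_half by simp
  let ?u = "unit_vec (dim B) 0 :: real vec"
  have "measure D {\<xi> \<in> space D. ?u \<bullet> \<xi> \<ge> 1 \<and> vnorm \<xi> \<le> radius \<epsilon>} > 0"
    using optimistic_probability(2)[OF unit_vec_carrier vnorm_unit_vec0 assms(1) e1] assms by linarith
  then have "{\<xi> \<in> space D. ?u \<bullet> \<xi> \<ge> 1 \<and> vnorm \<xi> \<le> radius \<epsilon>} \<noteq> {}"
    by (metis measure_empty less_irrefl)
  then obtain \<xi> where \<xi>: "\<xi> \<in> carrier_vec (dim B)" "?u \<bullet> \<xi> \<ge> 1" "vnorm \<xi> \<le> radius \<epsilon>"
    by (auto simp: space_D)
  then show ?thesis using scalar_prod_le_vnorm'[OF unit_vec_carrier \<xi>(1), of 0] vnorm_unit_vec0 by simp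
qed

text \<open>Otherwise the level \<epsilon>, halfway between \<open>b' * dim B\<close> and 1, gives a
  negative logarithm. As \<open>sqrt\<close> is odd, the radius is then negative, yet the ball would
  have positive probability and so be nonempty.\<close>

lemma concentration_constant_ge_1: "1 \<le> b' * dim B"
proof (rule ccontr)
  assume less: "\<not> 1 \<le> b' * dim B"
  define \<epsilon> where "\<epsilon> = (b' * dim B + 1) / 2"
  have pos: "0 < b' * dim B" using constants dim_pos by simp
  have e: "0 < \<epsilon>" "\<epsilon> < 1" "b' * dim B < \<epsilon>" using less pos by (auto simp: \<epsilon>_def)
  have "measure D {\<xi> \<in> space D. vnorm \<xi> \<le> radius \<epsilon>} > 0" using concentration(2)[OF e(1,2)] e by linarith
  then have "{\<xi> \<in> space D. vnorm \<xi> \<le> radius \<epsilon>} \<noteq> {}" by (metis measure_empty less_irrefl)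
  then have "0 \<le> radius \<epsilon>" using vnorm_nonneg order_trans by blast
  then have "0 \<le> b * dim B * ln (b' * dim B / \<epsilon>)" by (simp add: radius_def)
  moreover have "0 < b * dim B" using constants dim_pos by simp
  ultimately have "0 \<le> ln (b' * dim B / \<epsilon>)" using mult_pos_neg[of "b * dim B"] by (meson not_le)
  moreover have "ln (b' * dim B / \<epsilon>) < 0" using e pos by (intro ln_less_zero) auto
  ultimately show False by simp
qed

definition delta_round :: real where
  "delta_round = confidence B / (4 * horizon B)"

lemma delta_round: "0 < delta_round" "delta_round \<le> 1 / 4" "delta_round < 1" "1 \<le> ln (1 / delta_round)"
proof -
  have T: "1 \<le> real (horizon B)" using horizon_pos by simp
  show pos: "0 < delta_round" using confidence T by (simp add: delta_round_def)
  have "confidence B * 1 \<le> 1 * real (horizon B)" using confidence T by (intro mult_mono) auto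
  then show le: "delta_round \<le> 1 / 4" using T by (simp add: delta_round_def field_simps)
  then show "delta_round < 1" by simp
  have "4 \<le> 1 / delta_round" using le pos by (simp add: field_simps)
  then have "exp 1 \<le> (1 / delta_round :: real)" using e_less_272 by linarith
  then show "1 \<le> ln (1 / delta_round)" using pos by (subst ln_ge_iff) auto
qed

definition \<beta> :: real where "\<beta> = beta (dim B) (horizon B) delta_round"
definition \<gamma> :: real where "\<gamma> = gamma (dim B) (horizon B) b b' delta_round"

lemma log_term_nonneg: "0 \<le> dim B * ln (1 + horizon B / dim B)"
  by simp

lemma \<beta>_ge_2: "2 \<le> \<beta>"
proof -
  have "1 \<le> sqrt (2 * ln (1 / delta_round) + dim B * ln (1 + horizon B / dim B))"
  proof (rule real_le_rsqrt)
    show "1\<^sup>2 \<le> 2 * ln (1 / delta_round) + dim B * ln (1 + horizon B / dim B)"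
      unfolding one_power2 using delta_round(4) log_term_nonneg by linarith
  qed
  then show ?thesis by (simp add: \<beta>_def beta_def)
qed

lemma \<beta>_power2: "(\<beta> - 1)\<^sup>2 = 2 * ln (1 / delta_round) + dim B * ln (1 + horizon B / dim B)"
proof -
  have "0 \<le> 2 * ln (1 / delta_round) + dim B * ln (1 + horizon B / dim B)"
    using delta_round(4) log_term_nonneg by linarith
  then show ?thesis by (simp add: \<beta>_def beta_def)
qed

lemma \<gamma>_eq: "\<gamma> = \<beta> * radius delta_round"
  by (simp add: \<gamma>_def \<beta>_def gamma_def radius_def)

text \<open>If \<open>p\<close> is below the failure probability, the truncated samples need not be optimistic with positive
  probability, but then the bound exceeds \<open>2 T\<close>.\<close>

lemma small_p_bound:
  assumes "p < 2 * delta_round"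
  shows "2 * horizon B \<le> 4 * \<gamma> / p * sqrt (8 * horizon B * ln (4 / confidence B))"
proof -
  let ?T = "real (horizon B)" and ?d = "real (dim B)"
  define R where "R = radius delta_round"
  define L where "L = ln (b' * ?d)"
  have bd: "0 < b' * ?d" "0 < b * ?d" using constants dim_pos by auto
  have L: "0 \<le> L" using concentration_constant_ge_1 by (simp add: L_def)
  have ln: "ln (b' * ?d / x) = L + ln (1 / x)" if "x > 0" for x
  proof -
    have "b' * ?d / x = b' * ?d * (1 / x)" by simp
    then show ?thesis unfolding L_def using ln_mult_pos[of "b' * ?d" "1 / x"] bd that by simp
  qed
  \<comment> \<open>Only the sampling law constrains \<open>b\<close> and \<open>b'\<close>, and
    evaluating the radius at level \<open>p / 2\<close> bounds them from below. Multiplication by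
    \<open>p / 2\<close> then removes the logarithm of \<open>2 / p\<close>, by
    \<open>ln x \<le> x\<close>, which leaves \<open>p / 2 \<le> R\<^sup>2\<close>.\<close>
  have "1 \<le> radius (p / 2)" using constants by (intro radius_ge_1) auto
  moreover have "ln (b' * ?d / (p / 2)) = L + ln (2 / p)" using ln[of "p / 2"] constants by simp
  ultimately have "1 \<le> b * ?d * (L + ln (2 / p))" unfolding radius_def by simp
  moreover have "(L + ln (2 / p)) * (p / 2) \<le> L + ln (1 / delta_round)"
  proof -
    have "ln (2 / p) \<le> 2 / p" using constants ln_le_minus_one[of "2 / p"] by simp
    then have "ln (2 / p) * (p / 2) \<le> 2 / p * (p / 2)" using constants by (intro mult_right_mono) auto
    then have "ln (2 / p) * (p / 2) \<le> 1" using constants by simp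
    moreover have "L * (p / 2) \<le> L * 1" using L p_le_half by (intro mult_left_mono) auto
    ultimately show ?thesis using delta_round(4) by (simp add: distrib_right)
  qed
  ultimately have "1 * (p / 2) \<le> b * ?d * (L + ln (1 / delta_round))"
  proof -
    assume 1: "1 \<le> b * ?d * (L + ln (2 / p))" and 2: "(L + ln (2 / p)) * (p / 2) \<le> L + ln (1 / delta_round)"
    have "1 * (p / 2) \<le> b * ?d * (L + ln (2 / p)) * (p / 2)" using 1 constants by (intro mult_right_mono) auto
    also have "\<dots> = b * ?d * ((L + ln (2 / p)) * (p / 2))" by (simp add: mult.assoc)
    also have "\<dots> \<le> b * ?d * (L + ln (1 / delta_round))" using 2 bd by (intro mult_left_mono) auto
    finally show ?thesis .
  qed
  then have R: "p / 2 \<le> R\<^sup>2" "0 \<le> R"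
    using delta_round constants by (auto simp: R_def radius_def ln)
  have lnd: "1 \<le> ln (4 / confidence B)"
  proof -
    have "4 \<le> 4 / confidence B" using confidence by (simp add: field_simps)
    then have "exp 1 \<le> 4 / confidence B" using e_less_272 by linarith
    then show ?thesis using confidence by (subst ln_ge_iff) auto
  qed
  have "(2 * ?T)\<^sup>2 \<le> (4 / p * R * sqrt (8 * ?T * ln (4 / confidence B)))\<^sup>2"
  proof -
    have T: "1 \<le> ?T" using horizon_pos by simp
    have "p * (2 * ?T) \<le> confidence B" using assms T by (simp add: delta_round_def field_simps)
    then have pT: "p * ?T \<le> 1" using confidence by simp
    have "(2 * ?T)\<^sup>2 = 4 * (?T * ?T)" by (simp add: power2_eq_square)
    \<comment> \<open>The constant 64 is generous; it is the product of
      \<open>16 / p\<^sup>2\<close>, \<open>p / 2\<close> and 8 up to the remaining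
      \<open>1 / p\<close>, the form into which \<open>p / 2 \<le> R\<^sup>2\<close> can be
      inserted.\<close>
    also have "\<dots> \<le> 64 * ?T / p"
    proof -
      have "?T * ?T * p \<le> ?T * 1" using pT T by (simp add: mult.assoc mult.commute[of p])
      then show ?thesis using constants T by (simp add: field_simps)
    qed
    also have "\<dots> = 16 / p\<^sup>2 * (p / 2) * (8 * ?T * 1)"
      using constants by (simp add: power2_eq_square)
    also have "\<dots> \<le> 16 / p\<^sup>2 * R\<^sup>2 * (8 * ?T * ln (4 / confidence B))"
      using R lnd T constants by (intro mult_mono) auto
    also have "\<dots> = (4 / p * R * sqrt (8 * ?T * ln (4 / confidence B)))\<^sup>2"
      using lnd T by (simp add: power_mult_distrib power_divide)
    finally show ?thesis .
  qed
  then have "2 * ?T \<le> 4 / p * R * sqrt (8 * ?T * ln (4 / confidence B))"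
    by (rule power2_le_imp_le) (use R lnd constants in auto)
  also have "\<dots> \<le> \<beta> * (4 / p * R * sqrt (8 * ?T * ln (4 / confidence B)))"
    using \<beta>_ge_2 R lnd constants by (intro mult_right_mono[of 1 \<beta>, simplified]) auto
  finally show ?thesis by (simp add: \<gamma>_eq R_def mult_ac)
qed

subsection \<open>Optimistic samples\<close>

text \<open>The direction in which a sample raises the apparent value of the optimal arm. If the
  optimal arm has width zero, any unit vector serves, and the default keeps anti-concentration
  applicable.\<close>

definition optimism_direction :: "nat \<Rightarrow> 'w \<Rightarrow> real vec" where
  "optimism_direction t \<omega> = (let y = inv_root (t - 1) \<omega> *\<^sub>v optimal_vec t in
     if vnorm y = 0 then unit_vec (dim B) 0 else (1 / vnorm y) \<cdot>\<^sub>v y)"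

lemma optimism_direction:
  assumes t: "t \<in> {1..horizon B}" and \<omega>: "\<omega> \<in> \<Omega>"
  shows "optimism_direction t \<omega> \<in> carrier_vec (dim B)" "vnorm (optimism_direction t \<omega>) = 1"
proof -
  have "t - 1 \<le> horizon B" using t by auto
  then have "inv_root (t - 1) \<omega> *\<^sub>v optimal_vec t \<in> carrier_vec (dim B)"
    using \<omega> optimal_vec(1)[of t] t by (intro inv_root_mult_carrier) auto
  then show "optimism_direction t \<omega> \<in> carrier_vec (dim B)" "vnorm (optimism_direction t \<omega>) = 1"
    using vnorm_unit_vec0 vnorm_nonneg[of "inv_root (t - 1) \<omega> *\<^sub>v optimal_vec t"]
    by (auto simp: optimism_direction_def Let_def vnorm_smult)
qed

lemma optimism_direction_cong:
  assumes "play_list (t - 1) \<omega> = play_list (t - 1) \<omega>'"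
  shows "optimism_direction t \<omega> = optimism_direction t \<omega>'"
proof -
  have "play B s \<omega> = play B s \<omega>'" if "s \<in> {1..t - 1}" for s
    using assms that by (auto simp: play_list_def simp del: upt_Suc)
  then have "design_matrix B \<omega> (t - 1) = design_matrix B \<omega>' (t - 1)" by (rule design_matrix_cong)
  then show ?thesis by (simp add: optimism_direction_def inv_root_def)
qed

definition optimistic :: "nat \<Rightarrow> 'w set" where
  "optimistic t = {\<omega> \<in> \<Omega>. optimism_direction t \<omega> \<bullet> xi B t \<omega> \<ge> 1 \<and> vnorm (xi B t \<omega>) \<le> radius delta_round}"

lemma xi_distr: "t \<in> {1..horizon B} \<Longrightarrow> distr (prob B) (borel_vec (dim B)) (xi B t) = D"
  using algorithm by (simp add: thompson_sampling_run_def)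

lemma xi_carrier: "t \<in> {1..horizon B} \<Longrightarrow> \<omega> \<in> \<Omega> \<Longrightarrow> xi B t \<omega> \<in> carrier_vec (dim B)"
  using measurable_space[OF xi_measurable] by (simp add: borel_vec_def)

lemma measure_xi:
  assumes t: "t \<in> {1..horizon B}" and C: "C \<in> sets D"
  shows "measure (prob B) (xi B t -` C \<inter> \<Omega>) = measure D C"
  using measure_distr[OF xi_measurable[OF t], of C] C xi_distr[OF t] sets_D by simp

text \<open>The direction depends on earlier plays only. On each of the finitely many play histories
  it is a constant vector, so the event splits into one about \<open>xi B t\<close> and one in the
  past, and independence turns the measure into a product. Summing over histories replaces
  conditioning.\<close>

lemma optimistic_past:
  assumes t: "t \<in> {1..horizon B}" and E: "E \<in> sets (past_measure t)"
  shows "optimistic t \<inter> E \<in> sets (prob B)"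
    "(p - delta_round) * measure (prob B) E \<le> measure (prob B) (optimistic t \<inter> E)"
proof -
  interpret P: prob_space "prob B" by (rule prob_space_run)
  let ?m = "t - 1"
  define C where "C u = {\<xi> \<in> space D. u \<bullet> \<xi> \<ge> 1 \<and> vnorm \<xi> \<le> radius delta_round}" for u
  define H where "H = play_list ?m ` \<Omega>"
  \<comment> \<open>\<open>SOME\<close> selects an arbitrary outcome with history \<open>h\<close>;
    by \<open>optimism_direction_cong\<close> the direction does not depend on the choice.\<close>
  define dir where "dir h = optimism_direction t (SOME \<omega>. \<omega> \<in> \<Omega> \<and> play_list ?m \<omega> = h)" for h
  define S where "S h = (xi B t -` C (dir h) \<inter> \<Omega>) \<inter> (E \<inter> (play_list ?m -` {h} \<inter> \<Omega>))" for h
  have m: "?m \<le> horizon B" using t by auto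
  have finH: "finite H" unfolding H_def by (rule finite_play_list[OF m])
  have witness: "(SOME \<omega>'. \<omega>' \<in> \<Omega> \<and> play_list ?m \<omega>' = h) \<in> \<Omega> \<and>
      play_list ?m (SOME \<omega>'. \<omega>' \<in> \<Omega> \<and> play_list ?m \<omega>' = h) = h" if "h \<in> H" for h
    using that unfolding H_def by (intro someI_ex[of "\<lambda>\<omega>'. \<omega>' \<in> \<Omega> \<and> play_list ?m \<omega>' = h"]) auto
  have dir: "dir h \<in> carrier_vec (dim B)" "vnorm (dir h) = 1" if "h \<in> H" for h
    unfolding dir_def using optimism_direction[OF t conjunct1[OF witness[OF that]]] by auto
  have dir_eq: "dir (play_list ?m \<omega>) = optimism_direction t \<omega>" if "\<omega> \<in> \<Omega>" for \<omega>
    unfolding dir_def using witness[of "play_list ?m \<omega>"] that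
    by (intro optimism_direction_cong) (auto simp: H_def)
  have C: "C (dir h) \<in> sets D" "measure D (C (dir h)) \<ge> p - delta_round" if "h \<in> H" for h
    unfolding C_def using optimistic_probability[OF dir[OF that] delta_round(1,3)] by auto
  have "space (past_measure t) = \<Omega>" by simp
  then have pl: "play_list ?m -` {h} \<inter> \<Omega> \<in> sets (past_measure t)" for h
    using past_measurable(2)[OF t] by (intro play_list_vimage[OF m]) auto
  have xiC: "xi B t -` C (dir h) \<inter> \<Omega> \<in> events (prob B) (xi B t) (borel_vec (dim B))" if "h \<in> H" for h
    using C(1)[OF that] sets_D by (auto simp: events_def)
  have xiC': "xi B t -` C (dir h) \<inter> \<Omega> \<in> sets (prob B)" if "h \<in> H" for h
    using xiC[OF that] events_subset[OF xi_measurable[OF t]] by blast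
  have Eh: "E \<inter> (play_list ?m -` {h} \<inter> \<Omega>) \<in> past B t" for h
    using E pl[of h] sets_past_measure[OF t] by auto
  have Eh': "E \<inter> (play_list ?m -` {h} \<inter> \<Omega>) \<in> sets (prob B)" for h
    using Eh[of h] past_subset[OF t] by blast
  have "E \<subseteq> \<Omega>" using sets.sets_into_space[OF E] by simp
  have eq: "optimistic t \<inter> E = (\<Union>h \<in> H. S h)"
  proof (intro equalityI subsetI)
    fix \<omega> assume "\<omega> \<in> optimistic t \<inter> E"
    then show "\<omega> \<in> (\<Union>h \<in> H. S h)"
      using dir_eq[of \<omega>] xi_carrier[OF t, of \<omega>]
      by (intro UN_I[of "play_list ?m \<omega>"]) (auto simp: optimistic_def S_def C_def H_def space_D)
  next
    fix \<omega> assume "\<omega> \<in> (\<Union>h \<in> H. S h)"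
    then show "\<omega> \<in> optimistic t \<inter> E"
      using dir_eq[of \<omega>] by (auto simp: optimistic_def S_def C_def)
  qed
  have Sm: "S h \<in> sets (prob B)" if "h \<in> H" for h
    unfolding S_def using xiC'[OF that] Eh' by auto
  show "optimistic t \<inter> E \<in> sets (prob B)" unfolding eq using Sm finH by auto
  have disj: "disjoint_family_on (\<lambda>h. E \<inter> (play_list ?m -` {h} \<inter> \<Omega>)) H" "disjoint_family_on S H"
    by (auto simp: disjoint_family_on_def S_def)
  have "E = (\<Union>h \<in> H. E \<inter> (play_list ?m -` {h} \<inter> \<Omega>))" using \<open>E \<subseteq> \<Omega>\<close> by (auto simp: H_def)
  then have "measure (prob B) E = (\<Sum>h \<in> H. measure (prob B) (E \<inter> (play_list ?m -` {h} \<inter> \<Omega>)))"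
    using P.finite_measure_finite_Union[OF finH _ disj(1)] Eh' by auto
  then have "(p - delta_round) * measure (prob B) E =
    (\<Sum>h \<in> H. (p - delta_round) * measure (prob B) (E \<inter> (play_list ?m -` {h} \<inter> \<Omega>)))"
    by (simp add: sum_distrib_left)
  also have "\<dots> \<le> (\<Sum>h \<in> H. measure (prob B) (S h))"
  proof (rule sum_mono)
    fix h assume h: "h \<in> H"
    have ind: "P.indep_set (events (prob B) (xi B t) (borel_vec (dim B))) (past B t)"
      using algorithm t by (simp add: thompson_sampling_run_def)
    have "measure (prob B) (S h) = measure D (C (dir h)) * measure (prob B) (E \<inter> (play_list ?m -` {h} \<inter> \<Omega>))"
      unfolding S_def using P.indep_setD[OF ind xiC[OF h] Eh[of h]] measure_xi[OF t C(1)[OF h]] by simp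
    then show "(p - delta_round) * measure (prob B) (E \<inter> (play_list ?m -` {h} \<inter> \<Omega>)) \<le> measure (prob B) (S h)"
      using C(2)[OF h] by (simp add: mult_right_mono)
  qed
  also have "\<dots> = measure (prob B) (optimistic t \<inter> E)"
    unfolding eq using Sm by (intro P.finite_measure_finite_Union[symmetric] finH disj) auto
  finally show "(p - delta_round) * measure (prob B) E \<le> measure (prob B) (optimistic t \<inter> E)" .
qed

text \<open>The sampled parameter as a function of the sample, so that the actual draw can be
  compared with hypothetical ones at the same outcome.\<close>

definition theta_at :: "nat \<Rightarrow> 'w \<Rightarrow> real vec \<Rightarrow> real vec" where
  "theta_at t \<omega> v = least_squares B \<omega> (t - 1) + \<beta> \<cdot>\<^sub>v (inv_root (t - 1) \<omega> *\<^sub>v v)"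

lemma sampled_theta_eq: "sampled_theta B t \<omega> = theta_at t \<omega> (xi B t \<omega>)"
  by (simp add: sampled_theta_def theta_at_def inv_root_def \<beta>_def delta_round_def)

definition best_value :: "nat \<Rightarrow> real vec \<Rightarrow> real" where
  "best_value t \<theta> = Max ((\<lambda>a. feature B a \<bullet> \<theta>) ` arms B t)"

lemma best_value:
  assumes "t \<le> horizon B"
  shows "a \<in> arms B t \<Longrightarrow> feature B a \<bullet> \<theta> \<le> best_value t \<theta>"
    "\<exists>a \<in> arms B t. best_value t \<theta> = feature B a \<bullet> \<theta>"
proof -
  have fin: "finite ((\<lambda>a. feature B a \<bullet> \<theta>) ` arms B t)" "(\<lambda>a. feature B a \<bullet> \<theta>) ` arms B t \<noteq> {}"
    using arms[OF assms] by auto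
  show "feature B a \<bullet> \<theta> \<le> best_value t \<theta>" if "a \<in> arms B t"
    unfolding best_value_def using fin that by (intro Max_ge) auto
  show "\<exists>a \<in> arms B t. best_value t \<theta> = feature B a \<bullet> \<theta>"
    unfolding best_value_def using Max_in[OF fin] by auto
qed

text \<open>An upper bound, known before the sample is drawn, for the regret of optimal play against a truncated
  sample; the minimum over the ball of samples is taken over a finite net.\<close>

definition pessimism :: "nat \<Rightarrow> 'w \<Rightarrow> real" where
  "pessimism t \<omega> = Max ((\<lambda>z. optimal_vec t \<bullet> theta_star B -
     best_value t (theta_at t \<omega> (radius delta_round \<cdot>\<^sub>v z))) ` grid (dim B) (mips_eps B))"

text \<open>The loss \<open>4 * mips_eps B\<close> of \<open>search_gap\<close> is measured at a
  normalised query; \<open>1 + \<beta> + \<gamma>\<close> bounds the norm by which it must be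
  rescaled.\<close>

definition search_error :: real where
  "search_error = 4 * mips_eps B * (1 + \<beta> + \<gamma>)"

text \<open>The threshold uses \<open>\<beta> - 1\<close> because the remaining 1 pays for the
  regularisation bias, the parameter having norm at most 1.\<close>

definition confident :: "nat \<Rightarrow> 'w set" where
  "confident t = {\<omega> \<in> \<Omega>. noise_norm2 (t - 1) \<omega> \<le> (\<beta> - 1)\<^sup>2}"

definition good_past :: "nat \<Rightarrow> 'w set" where
  "good_past t = confident t - bad_round t"

text \<open>Subtracting \<open>search_error\<close> here makes \<open>optimistic_excess\<close> hold
  without an error term, as the Azuma argument demands. The value 0 outside \<open>good_past\<close>
  keeps all bounds valid for every outcome, and membership in \<open>good_past\<close> is decided
  before the sample.\<close>

definition excess :: "nat \<Rightarrow> 'w \<Rightarrow> real" where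
  "excess t \<omega> = (if \<omega> \<in> good_past t then max 0 ((pessimism t \<omega> - search_error) / (2 * \<gamma>)) else 0)"

lemma least_squares_carrier:
  assumes "n \<le> horizon B" "\<omega> \<in> \<Omega>"
  shows "least_squares B \<omega> n \<in> carrier_vec (dim B)"
  unfolding least_squares_eq(2)[OF assms] using mat_inv_carrier[OF assms] by (intro mult_mat_vec_carrier) auto

lemma theta_at_carrier:
  assumes "t \<in> {1..horizon B}" "\<omega> \<in> \<Omega>" "v \<in> carrier_vec (dim B)"
  shows "theta_at t \<omega> v \<in> carrier_vec (dim B)"
proof -
  have "t - 1 \<le> horizon B" using assms by auto
  then show ?thesis unfolding theta_at_def using assms
    by (intro add_carrier_vec smult_carrier_vec[THEN iffD2] least_squares_carrier inv_root_mult_carrier) auto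
qed

lemma scalar_prod_theta_at:
  assumes t: "t \<in> {1..horizon B}" and \<omega>: "\<omega> \<in> \<Omega>" and x: "x \<in> carrier_vec (dim B)" and v: "v \<in> carrier_vec (dim B)"
  shows "x \<bullet> theta_at t \<omega> v = x \<bullet> least_squares B \<omega> (t - 1) + \<beta> * (x \<bullet> (inv_root (t - 1) \<omega> *\<^sub>v v))"
    "x \<bullet> theta_at t \<omega> v = x \<bullet> least_squares B \<omega> (t - 1) + \<beta> * ((inv_root (t - 1) \<omega> *\<^sub>v x) \<bullet> v)"
proof -
  have n: "t - 1 \<le> horizon B" using t by auto
  show 1: "x \<bullet> theta_at t \<omega> v = x \<bullet> least_squares B \<omega> (t - 1) + \<beta> * (x \<bullet> (inv_root (t - 1) \<omega> *\<^sub>v v))"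
    unfolding theta_at_def
    using least_squares_carrier[OF n \<omega>] inv_root_mult_carrier[OF n \<omega> v] x
    by (simp add: scalar_prod_add_distrib[of _ "dim B"])
  then show "x \<bullet> theta_at t \<omega> v = x \<bullet> least_squares B \<omega> (t - 1) + \<beta> * ((inv_root (t - 1) \<omega> *\<^sub>v x) \<bullet> v)"
    using inv_sqrt_mat_apply(6)[OF design_matrix(1)[OF n \<omega>] v x] by (simp add: inv_root_def)
qed

text \<open>With \<open>M\<close> the inverse square root of the design matrix, the estimation error
  is \<open>M\<close> applied twice to \<open>w\<close>, the noise sum minus the parameter. Both
  claims follow from \<open>vnorm (M *\<^sub>v w) \<le> \<beta>\<close>: the first by
  Cauchy-Schwarz, the second because \<open>M\<close> is a contraction.\<close>

lemma confident_estimate: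
  assumes t: "t \<in> {1..horizon B}" and c: "\<omega> \<in> confident t"
  shows "x \<in> carrier_vec (dim B) \<Longrightarrow>
      \<bar>x \<bullet> (least_squares B \<omega> (t - 1) - theta_star B)\<bar> \<le> \<beta> * vnorm (inv_root (t - 1) \<omega> *\<^sub>v x)"
    "vnorm (least_squares B \<omega> (t - 1)) \<le> 1 + \<beta>"
proof -
  let ?d = "dim B"
  define n where "n = t - 1"
  have n: "n \<le> horizon B" using t by (auto simp: n_def)
  have \<omega>: "\<omega> \<in> \<Omega>" and nn: "noise_norm2 n \<omega> \<le> (\<beta> - 1)\<^sup>2" using c by (auto simp: confident_def n_def)
  define M where "M = inv_root n \<omega>"
  define w where "w = noise_sum n \<omega> - theta_star B"
  note ap = inv_sqrt_mat_apply[OF design_matrix(1)[OF n \<omega>], folded inv_root_def M_def]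
  have w: "w \<in> carrier_vec ?d" using theta_star by (simp add: w_def)
  have diff: "least_squares B \<omega> n - theta_star B = mat_inv (design_matrix B \<omega> n) *\<^sub>v w"
    unfolding least_squares_eq(1)[OF n \<omega>] w_def[symmetric]
    using theta_star mat_inv_carrier[OF n \<omega>] w by (intro eq_vecI) auto
  have "M *\<^sub>v w = M *\<^sub>v noise_sum n \<omega> - M *\<^sub>v theta_star B"
    unfolding w_def using ap(1)[OF w] theta_star by (intro mult_minus_distrib_mat_vec) auto
  then have "vnorm (M *\<^sub>v w) \<le> vnorm (M *\<^sub>v noise_sum n \<omega>) + vnorm (M *\<^sub>v theta_star B)"
    using vnorm_diff_le[OF ap(3) ap(3)] theta_star by simp
  moreover have "vnorm (M *\<^sub>v noise_sum n \<omega>) \<le> \<beta> - 1"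
  proof (rule power2_le_imp_le)
    show "(vnorm (M *\<^sub>v noise_sum n \<omega>))\<^sup>2 \<le> (\<beta> - 1)\<^sup>2"
      unfolding M_def vnorm_noise_sum[OF n \<omega>] by (rule nn)
    show "0 \<le> \<beta> - 1" using \<beta>_ge_2 by simp
  qed
  moreover have "vnorm (M *\<^sub>v theta_star B) \<le> 1"
    using vnorm_inv_root_le[OF n \<omega> theta_star(1)] theta_star(2) by (simp add: M_def)
  ultimately have Mw: "vnorm (M *\<^sub>v w) \<le> \<beta>" by linarith
  show "\<bar>x \<bullet> (least_squares B \<omega> (t - 1) - theta_star B)\<bar> \<le> \<beta> * vnorm (inv_root (t - 1) \<omega> *\<^sub>v x)"
    if x: "x \<in> carrier_vec ?d" for x
  proof -
    have "\<bar>x \<bullet> (least_squares B \<omega> n - theta_star B)\<bar> = \<bar>(M *\<^sub>v x) \<bullet> (M *\<^sub>v w)\<bar>"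
      unfolding diff using ap(5)[OF w x] by simp
    also have "\<dots> \<le> vnorm (M *\<^sub>v x) * vnorm (M *\<^sub>v w)"
      using ap(3) x w by (intro scalar_prod_le_vnorm) auto
    also have "\<dots> \<le> vnorm (M *\<^sub>v x) * \<beta>" using Mw by (intro mult_left_mono) auto
    finally show ?thesis by (simp add: n_def M_def mult.commute)
  qed
  have "vnorm (least_squares B \<omega> n) \<le> vnorm (theta_star B) + vnorm (mat_inv (design_matrix B \<omega> n) *\<^sub>v w)"
    unfolding least_squares_eq(1)[OF n \<omega>] w_def[symmetric]
    using theta_star mat_inv_carrier[OF n \<omega>] w by (intro vnorm_add_le[of _ ?d]) (auto intro: mult_mat_vec_carrier)
  also have "mat_inv (design_matrix B \<omega> n) *\<^sub>v w = M *\<^sub>v (M *\<^sub>v w)" using ap(4)[OF w] by simp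
  also have "vnorm \<dots> \<le> vnorm (M *\<^sub>v w)"
    unfolding M_def by (rule vnorm_inv_root_le[OF n \<omega>]) (use ap(3)[OF w] in \<open>simp add: M_def\<close>)
  finally show "vnorm (least_squares B \<omega> (t - 1)) \<le> 1 + \<beta>"
    using theta_star Mw by (simp add: n_def)
qed

context
  assumes p_large: "2 * delta_round \<le> p"
begin

lemma radius_delta: "1 \<le> radius delta_round"
  using p_large delta_round(1) by (intro radius_ge_1) auto

lemma \<gamma>_ge: "\<beta> \<le> \<gamma>" "2 \<le> \<gamma>"
proof -
  have "\<beta> * 1 \<le> \<beta> * radius delta_round" using radius_delta \<beta>_ge_2 by (intro mult_left_mono) auto
  then show "\<beta> \<le> \<gamma>" by (simp add: \<gamma>_eq)
  then show "2 \<le> \<gamma>" using \<beta>_ge_2 by simp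
qed

lemma search_error_nonneg: "0 \<le> search_error"
  using mips_eps_pos \<beta>_ge_2 \<gamma>_ge by (simp add: search_error_def)

lemma theta_at_diff:
  assumes t: "t \<in> {1..horizon B}" and \<omega>: "\<omega> \<in> \<Omega>" and x: "x \<in> carrier_vec (dim B)"
    and v: "v \<in> carrier_vec (dim B)" "v' \<in> carrier_vec (dim B)"
  shows "x \<bullet> theta_at t \<omega> v - x \<bullet> theta_at t \<omega> v' \<le> \<beta> * (vnorm (inv_root (t - 1) \<omega> *\<^sub>v x) * vnorm (v - v'))"
proof -
  have n: "t - 1 \<le> horizon B" using t by auto
  have c: "inv_root (t - 1) \<omega> *\<^sub>v x \<in> carrier_vec (dim B)" by (rule inv_root_mult_carrier[OF n \<omega> x])
  have "x \<bullet> theta_at t \<omega> v - x \<bullet> theta_at t \<omega> v' = \<beta> * ((inv_root (t - 1) \<omega> *\<^sub>v x) \<bullet> (v - v'))"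
    unfolding scalar_prod_theta_at(2)[OF t \<omega> x v(1)] scalar_prod_theta_at(2)[OF t \<omega> x v(2)]
    using c v by (simp add: scalar_prod_minus_distrib[of _ "dim B"] algebra_simps)
  also have "\<dots> \<le> \<beta> * (vnorm (inv_root (t - 1) \<omega> *\<^sub>v x) * vnorm (v - v'))"
    using \<beta>_ge_2 c v by (intro mult_left_mono scalar_prod_le_vnorm'[of _ "dim B"]) auto
  finally show ?thesis .
qed

lemma vnorm_theta_at:
  assumes t: "t \<in> {1..horizon B}" and c: "\<omega> \<in> confident t"
    and v: "v \<in> carrier_vec (dim B)" "vnorm v \<le> radius delta_round"
  shows "vnorm (theta_at t \<omega> v) \<le> 1 + \<beta> + \<gamma>"
proof -
  have n: "t - 1 \<le> horizon B" and \<omega>: "\<omega> \<in> \<Omega>" using t c by (auto simp: confident_def)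
  have "vnorm (theta_at t \<omega> v) \<le> vnorm (least_squares B \<omega> (t - 1)) + vnorm (\<beta> \<cdot>\<^sub>v (inv_root (t - 1) \<omega> *\<^sub>v v))"
    unfolding theta_at_def using least_squares_carrier[OF n \<omega>] inv_root_mult_carrier[OF n \<omega> v(1)]
    by (intro vnorm_add_le[of _ "dim B"]) auto
  also have "\<dots> \<le> (1 + \<beta>) + \<beta> * radius delta_round"
    unfolding vnorm_smult using confident_estimate(2)[OF t c] \<beta>_ge_2 order_trans[OF vnorm_inv_root_le[OF n \<omega> v(1)] v(2)]
    by (intro add_mono) (auto intro: mult_left_mono)
  finally show ?thesis by (simp add: \<gamma>_eq)
qed

text \<open>The estimate of the optimal arm is off by at most \<beta> times its width, so only the
  component of \<open>v\<close> along its direction matters. For an optimistic \<open>v\<close> the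
  right-hand side is nonpositive; for any \<open>v\<close> in the truncation ball it is at most
  \<open>2 * \<gamma>\<close>.\<close>

lemma optimal_vec_theta_at_ge:
  assumes t: "t \<in> {1..horizon B}" and c: "\<omega> \<in> confident t" and v: "v \<in> carrier_vec (dim B)"
  shows "optimal_vec t \<bullet> theta_star B - best_value t (theta_at t \<omega> v) \<le>
    \<beta> * vnorm (inv_root (t - 1) \<omega> *\<^sub>v optimal_vec t) - \<beta> * ((inv_root (t - 1) \<omega> *\<^sub>v optimal_vec t) \<bullet> v)"
proof -
  have n: "t - 1 \<le> horizon B" "t \<le> horizon B" and \<omega>: "\<omega> \<in> \<Omega>" using t c by (auto simp: confident_def)
  note o = optimal_vec[OF n(2)]
  have "optimal_vec t \<bullet> theta_at t \<omega> v \<le> best_value t (theta_at t \<omega> v)"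
    unfolding optimal_vec_def by (rule best_value(1)[OF n(2) optimal_arm(1)[OF n(2)]])
  moreover have "optimal_vec t \<bullet> theta_star B - optimal_vec t \<bullet> least_squares B \<omega> (t - 1)
      \<le> \<beta> * vnorm (inv_root (t - 1) \<omega> *\<^sub>v optimal_vec t)"
    using confident_estimate(1)[OF t c o(1)] o(1) theta_star least_squares_carrier[OF n(1) \<omega>]
    by (simp add: scalar_prod_minus_distrib[of _ "dim B"])
  ultimately show ?thesis using scalar_prod_theta_at(2)[OF t \<omega> o(1) v] by linarith
qed

lemma net_carrier:
  assumes "z \<in> grid (dim B) (mips_eps B)"
  shows "radius delta_round \<cdot>\<^sub>v z \<in> carrier_vec (dim B)" "vnorm (radius delta_round \<cdot>\<^sub>v z) \<le> radius delta_round"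
  using grid_in_unit_ball[OF assms] radius_delta by (auto simp: unit_ball_def vnorm_smult mult_left_le)

lemma net_nonempty: "grid (dim B) (mips_eps B) \<noteq> {}"
proof -
  have "0\<^sub>v (dim B) \<in> unit_ball (dim B)" by (simp add: unit_ball_def vnorm_def)
  then show ?thesis using round_query(1)[OF dim_pos mips_eps_pos] by blast
qed

lemma pessimism_ge: "z \<in> grid (dim B) (mips_eps B) \<Longrightarrow>
  optimal_vec t \<bullet> theta_star B - best_value t (theta_at t \<omega> (radius delta_round \<cdot>\<^sub>v z)) \<le> pessimism t \<omega>"
  unfolding pessimism_def using finite_grid[OF dim_pos mips_eps_pos] by (intro Max_ge) auto

lemma pessimism_le:
  assumes "\<And>z. z \<in> grid (dim B) (mips_eps B) \<Longrightarrow>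
    optimal_vec t \<bullet> theta_star B - best_value t (theta_at t \<omega> (radius delta_round \<cdot>\<^sub>v z)) \<le> c"
  shows "pessimism t \<omega> \<le> c"
  unfolding pessimism_def using finite_grid[OF dim_pos mips_eps_pos] net_nonempty assms by (intro Max.boundedI) auto

lemma pessimism_le_2\<gamma>:
  assumes t: "t \<in> {1..horizon B}" and c: "\<omega> \<in> confident t"
  shows "pessimism t \<omega> \<le> 2 * \<gamma>"
proof (rule pessimism_le)
  fix z assume z: "z \<in> grid (dim B) (mips_eps B)"
  let ?y = "inv_root (t - 1) \<omega> *\<^sub>v optimal_vec t" and ?v = "radius delta_round \<cdot>\<^sub>v z"
  have n: "t - 1 \<le> horizon B" "t \<le> horizon B" and \<omega>: "\<omega> \<in> \<Omega>" using t c by (auto simp: confident_def)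
  have y: "?y \<in> carrier_vec (dim B)" "vnorm ?y \<le> 1"
    using inv_root_mult_carrier[OF n(1) \<omega>] vnorm_inv_root_le[OF n(1) \<omega>] optimal_vec[OF n(2)] by force+
  have "- (?y \<bullet> ?v) \<le> vnorm ?y * vnorm ?v" using scalar_prod_le_vnorm[OF y(1) net_carrier(1)[OF z]] by linarith
  also have "\<dots> \<le> 1 * radius delta_round" using y net_carrier(2)[OF z] radius_delta by (intro mult_mono) auto
  finally have "\<beta> * - (?y \<bullet> ?v) \<le> \<beta> * radius delta_round" using \<beta>_ge_2 by (intro mult_left_mono) auto
  moreover have "\<beta> * vnorm ?y \<le> \<beta>" using y \<beta>_ge_2 by (simp add: mult_left_le)
  ultimately show "optimal_vec t \<bullet> theta_star B - best_value t (theta_at t \<omega> ?v) \<le> 2 * \<gamma>"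
    using optimal_vec_theta_at_ge[OF t c net_carrier(1)[OF z]] \<gamma>_ge(1) unfolding \<gamma>_eq by linarith
qed

lemma search_error:
  assumes t: "t \<in> {1..horizon B}" and g: "\<omega> \<in> good_past t" and \<xi>: "vnorm (xi B t \<omega>) \<le> radius delta_round"
  shows "best_value t (sampled_theta B t \<omega>) \<le> arm t \<omega> \<bullet> sampled_theta B t \<omega> + search_error"
proof -
  have tT: "t \<le> horizon B" and c: "\<omega> \<in> confident t" and \<omega>: "\<omega> \<in> \<Omega>" "\<omega> \<notin> bad_round t"
    using t g by (auto simp: good_past_def confident_def)
  let ?\<theta> = "sampled_theta B t \<omega>"
  have \<theta>: "?\<theta> \<in> carrier_vec (dim B)" "vnorm ?\<theta> \<le> 1 + \<beta> + \<gamma>"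
    using theta_at_carrier[OF t \<omega>(1) xi_carrier[OF t \<omega>(1)]] vnorm_theta_at[OF t c xi_carrier[OF t \<omega>(1)] \<xi>]
    by (auto simp: sampled_theta_eq)
  obtain a where a: "a \<in> arms B t" "best_value t ?\<theta> = feature B a \<bullet> ?\<theta>" using best_value(2)[OF tT] by blast
  have xa: "feature B a \<in> carrier_vec (dim B)" using feature_in_unit_ball[OF tT a(1)] by (simp add: unit_ball_def)
  have x: "arm t \<omega> \<in> carrier_vec (dim B)" by (rule arm_carrier[OF t \<omega>(1)])
  have rule: "case search_result B t \<omega> of Some v \<Rightarrow> feature B (play B t \<omega>) = v
           | None \<Rightarrow> (\<forall>a \<in> arms B t. ?\<theta> \<bullet> feature B a \<le> ?\<theta> \<bullet> feature B (play B t \<omega>))"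
    using algorithm t \<omega>(1) unfolding thompson_sampling_run_def by blast
  show ?thesis
  proof (cases "search_result B t \<omega>")
    case None
    then have "?\<theta> \<bullet> feature B a \<le> ?\<theta> \<bullet> arm t \<omega>" using rule a(1) by (auto simp: arm_def)
    then show ?thesis
      unfolding a(2) using comm_scalar_prod[OF \<theta>(1) xa] comm_scalar_prod[OF \<theta>(1) x] search_error_nonneg by simp
  next
    case (Some v)
    then have v: "arm t \<omega> = v" using rule by (simp add: arm_def)
    define q where "q = mips_query B t \<omega>"
    have q_eq: "q = (1 / vnorm ?\<theta>) \<cdot>\<^sub>v ?\<theta>" by (simp add: q_def mips_query_def)
    \<comment> \<open>If the sampled parameter is zero, \<open>1 / 0 = 0\<close> makes the query the
      zero vector, which still lies in the unit ball.\<close>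
    have q: "q \<in> unit_ball (dim B)" using \<theta>(1) unfolding q_eq by (simp add: unit_ball_def vnorm_smult)
    have dot: "x \<bullet> ?\<theta> = vnorm ?\<theta> * (q \<bullet> x)" if "x \<in> carrier_vec (dim B)" for x
    proof (cases "vnorm ?\<theta> = 0")
      case True
      then show ?thesis using scalar_prod_le_vnorm[OF that \<theta>(1)] by simp
    next
      case False
      then show ?thesis using comm_scalar_prod[OF that \<theta>(1)] \<theta>(1) that by (simp add: q_eq)
    qed
    have "q \<bullet> feature B a \<le> q \<bullet> v + 4 * mips_eps B"
      using search_gap[OF t \<omega> _ Some a(1)] q by (simp add: q_def)
    then have "vnorm ?\<theta> * (q \<bullet> feature B a) \<le> vnorm ?\<theta> * (q \<bullet> v + 4 * mips_eps B)" by (intro mult_left_mono) auto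
    also have "\<dots> = vnorm ?\<theta> * (q \<bullet> v) + 4 * mips_eps B * vnorm ?\<theta>" by (simp add: algebra_simps)
    also have "4 * mips_eps B * vnorm ?\<theta> \<le> search_error"
      unfolding search_error_def using \<theta>(2) mips_eps_pos by (intro mult_left_mono) auto
    finally show ?thesis unfolding a(2) dot[OF xa] dot[OF x] by (simp add: v)
  qed
qed

text \<open>Optimism puts the optimal value below the best sampled value, which the arm played
  attains up to \<open>search_error\<close>. Exchanging the sample for any other one in the ball
  changes the value of that arm by at most \<open>2 * \<gamma>\<close> times its width, and this
  value is still a lower bound for the best value there.\<close>

lemma optimistic_excess:
  assumes t: "t \<in> {1..horizon B}" and o: "\<omega> \<in> optimistic t"
  shows "excess t \<omega> \<le> arm_width t \<omega>"
proof (cases "\<omega> \<in> good_past t")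
  case False
  have "\<omega> \<in> \<Omega>" using o by (simp add: optimistic_def)
  then show ?thesis using False arm_width_bounds[OF t] by (simp add: excess_def)
next
  case g: True
  have n: "t - 1 \<le> horizon B" "t \<le> horizon B" and c: "\<omega> \<in> confident t" and \<omega>: "\<omega> \<in> \<Omega>"
    using t g by (auto simp: good_past_def confident_def)
  let ?y = "inv_root (t - 1) \<omega> *\<^sub>v optimal_vec t" and ?\<xi> = "xi B t \<omega>" and ?\<theta> = "sampled_theta B t \<omega>"
  let ?W = "arm_width t \<omega>"
  have \<xi>: "?\<xi> \<in> carrier_vec (dim B)" "vnorm ?\<xi> \<le> radius delta_round" "optimism_direction t \<omega> \<bullet> ?\<xi> \<ge> 1"
    using o xi_carrier[OF t \<omega>] by (auto simp: optimistic_def)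
  have y: "?y \<in> carrier_vec (dim B)" using inv_root_mult_carrier[OF n(1) \<omega>] optimal_vec[OF n(2)] by auto
  have "vnorm ?y \<le> ?y \<bullet> ?\<xi>"
  proof (cases "vnorm ?y = 0")
    case True
    then show ?thesis using scalar_prod_le_vnorm[OF y \<xi>(1)] by simp
  next
    case False
    then have pos: "0 < vnorm ?y" using vnorm_nonneg[of ?y] by linarith
    then have "1 \<le> (1 / vnorm ?y) * (?y \<bullet> ?\<xi>)"
      using \<xi>(3) y \<xi>(1) False by (simp add: optimism_direction_def Let_def)
    then show ?thesis using pos by (simp add: field_simps)
  qed
  then have "\<beta> * vnorm ?y \<le> \<beta> * (?y \<bullet> ?\<xi>)" using \<beta>_ge_2 by (intro mult_left_mono) auto
  then have opt: "optimal_vec t \<bullet> theta_star B \<le> best_value t ?\<theta>"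
    using optimal_vec_theta_at_ge[OF t c \<xi>(1)] by (simp add: sampled_theta_eq)
  have x: "arm t \<omega> \<in> carrier_vec (dim B)" by (rule arm_carrier[OF t \<omega>])
  have "pessimism t \<omega> \<le> 2 * \<gamma> * ?W + search_error"
  proof (rule pessimism_le)
    fix z assume z: "z \<in> grid (dim B) (mips_eps B)"
    let ?v = "radius delta_round \<cdot>\<^sub>v z"
    note v = net_carrier[OF z]
    have "arm t \<omega> \<bullet> theta_at t \<omega> ?v \<le> best_value t (theta_at t \<omega> ?v)"
      unfolding arm_def by (rule best_value(1)[OF n(2) play_in_arms[OF t \<omega>]])
    moreover have "arm t \<omega> \<bullet> theta_at t \<omega> ?\<xi> - arm t \<omega> \<bullet> theta_at t \<omega> ?v \<le> \<beta> * (?W * vnorm (?\<xi> - ?v))"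
      unfolding arm_width_def by (rule theta_at_diff[OF t \<omega> x \<xi>(1) v(1)])
    moreover have "\<beta> * (?W * vnorm (?\<xi> - ?v)) \<le> \<beta> * (?W * (2 * radius delta_round))"
      using vnorm_diff_le[OF \<xi>(1) v(1)] \<xi>(2) v(2) \<beta>_ge_2 arm_width_bounds[OF t \<omega>]
      by (intro mult_left_mono) auto
    ultimately show "optimal_vec t \<bullet> theta_star B - best_value t (theta_at t \<omega> ?v) \<le> 2 * \<gamma> * ?W + search_error"
      using opt search_error[OF t g \<xi>(2)] unfolding sampled_theta_eq \<gamma>_eq by (simp add: mult_ac)
  qed
  then have "(pessimism t \<omega> - search_error) / (2 * \<gamma>) \<le> ?W"
    using \<gamma>_ge by (simp add: divide_le_eq mult_ac)
  then show ?thesis using g arm_width_bounds[OF t \<omega>] by (simp add: excess_def)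
qed

lemma excess_bounds:
  assumes t: "t \<in> {1..horizon B}"
  shows "0 \<le> excess t \<omega> \<and> excess t \<omega> \<le> 1"
proof (cases "\<omega> \<in> good_past t")
  case True
  then have "pessimism t \<omega> - search_error \<le> 2 * \<gamma>"
    using pessimism_le_2\<gamma>[OF t, of \<omega>] search_error_nonneg by (auto simp: good_past_def)
  then have "(pessimism t \<omega> - search_error) / (2 * \<gamma>) \<le> 1" using \<gamma>_ge by (simp add: divide_le_eq)
  then show ?thesis using True by (simp add: excess_def)
qed (simp add: excess_def)

text \<open>Three gaps are added: from the optimal value to the best sampled value, bounded by
  \<open>pessimism\<close> after the sample is moved to a net point at cost
  \<open>\<gamma> * mips_eps B\<close>; from there to the sampled value of the arm played; and from
  its sampled to its true value. The search error occurs twice since \<open>excess\<close> has it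
  subtracted.\<close>

lemma round_regret:
  assumes t: "t \<in> {1..horizon B}" and g: "\<omega> \<in> good_past t" and \<xi>: "vnorm (xi B t \<omega>) \<le> radius delta_round"
  shows "optimal_vec t \<bullet> theta_star B - arm t \<omega> \<bullet> theta_star B \<le>
    2 * \<gamma> * excess t \<omega> + 2 * search_error + \<gamma> * mips_eps B + (\<gamma> + \<beta>) * arm_width t \<omega>"
proof -
  let ?d = "dim B" and ?\<xi> = "xi B t \<omega>" and ?\<theta> = "sampled_theta B t \<omega>" and ?R = "radius delta_round"
  have n: "t - 1 \<le> horizon B" "t \<le> horizon B" and c: "\<omega> \<in> confident t" and \<omega>: "\<omega> \<in> \<Omega>"
    using t g by (auto simp: good_past_def confident_def)
  have \<xi>c: "?\<xi> \<in> carrier_vec ?d" by (rule xi_carrier[OF t \<omega>])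
  have x: "arm t \<omega> \<in> carrier_vec ?d" by (rule arm_carrier[OF t \<omega>])
  define q where "q = (1 / ?R) \<cdot>\<^sub>v ?\<xi>"
  have q: "q \<in> unit_ball ?d" using \<xi>c \<xi> radius_delta by (simp add: q_def unit_ball_def vnorm_smult)
  define z where "z = round_query ?d (mips_eps B) q"
  have z: "z \<in> grid ?d (mips_eps B)" "vnorm (q - z) \<le> mips_eps B"
    using round_query[OF dim_pos mips_eps_pos q] by (auto simp: z_def)
  let ?v = "?R \<cdot>\<^sub>v z"
  note v = net_carrier[OF z(1)]
  have zc: "z \<in> carrier_vec ?d" using grid_in_unit_ball[OF z(1)] by (simp add: unit_ball_def)
  have "?v - ?\<xi> = ?R \<cdot>\<^sub>v (z - q)"
    using \<xi>c zc radius_delta by (intro eq_vecI) (auto simp: q_def right_diff_distrib)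
  then have "vnorm (?v - ?\<xi>) = ?R * vnorm (z - q)" using radius_delta by (simp add: vnorm_smult)
  also have "vnorm (z - q) = vnorm (q - z)" using zc q by (intro vnorm_minus_commute) (auto simp: unit_ball_def)
  finally have close: "vnorm (?v - ?\<xi>) \<le> ?R * mips_eps B" using z(2) radius_delta by (simp add: mult_left_mono)
  obtain a where a: "a \<in> arms B t" "best_value t (theta_at t \<omega> ?v) = feature B a \<bullet> theta_at t \<omega> ?v"
    using best_value(2)[OF n(2)] by blast
  have xa: "feature B a \<in> carrier_vec ?d" "vnorm (feature B a) \<le> 1"
    using feature_in_unit_ball[OF n(2) a(1)] by (auto simp: unit_ball_def)
  have "feature B a \<bullet> theta_at t \<omega> ?v - feature B a \<bullet> theta_at t \<omega> ?\<xi> \<le>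
    \<beta> * (vnorm (inv_root (t - 1) \<omega> *\<^sub>v feature B a) * vnorm (?v - ?\<xi>))"
    by (rule theta_at_diff[OF t \<omega> xa(1) v(1) \<xi>c])
  also have "\<dots> \<le> \<beta> * (1 * (?R * mips_eps B))"
    using order_trans[OF vnorm_inv_root_le[OF n(1) \<omega> xa(1)] xa(2)] close \<beta>_ge_2
    by (intro mult_left_mono mult_mono) auto
  finally have "best_value t (theta_at t \<omega> ?v) \<le> best_value t ?\<theta> + \<gamma> * mips_eps B"
    unfolding a(2) using best_value(1)[OF n(2) a(1), of ?\<theta>] by (simp add: sampled_theta_eq \<gamma>_eq)
  then have 1: "optimal_vec t \<bullet> theta_star B - best_value t ?\<theta> \<le> pessimism t \<omega> + \<gamma> * mips_eps B"
    using pessimism_ge[OF z(1), of t \<omega>] by linarith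
  have "(pessimism t \<omega> - search_error) / (2 * \<gamma>) \<le> excess t \<omega>" using g by (simp add: excess_def)
  then have 2: "pessimism t \<omega> \<le> 2 * \<gamma> * excess t \<omega> + search_error"
    using \<gamma>_ge by (simp add: divide_le_eq mult_ac)
  note 3 = search_error[OF t g \<xi>]
  let ?y = "inv_root (t - 1) \<omega> *\<^sub>v arm t \<omega>"
  have y: "?y \<in> carrier_vec ?d" by (rule inv_root_mult_carrier[OF n(1) \<omega> x])
  have "?y \<bullet> ?\<xi> \<le> arm_width t \<omega> * ?R"
    using scalar_prod_le_vnorm'[OF y \<xi>c] mult_left_mono[OF \<xi> vnorm_nonneg[of ?y]] by (simp add: arm_width_def)
  then have "\<beta> * (?y \<bullet> ?\<xi>) \<le> \<beta> * (arm_width t \<omega> * ?R)" using \<beta>_ge_2 by (intro mult_left_mono) auto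
  moreover have "arm t \<omega> \<bullet> least_squares B \<omega> (t - 1) - arm t \<omega> \<bullet> theta_star B \<le> \<beta> * arm_width t \<omega>"
    using confident_estimate(1)[OF t c x] x theta_star least_squares_carrier[OF n(1) \<omega>]
    by (simp add: scalar_prod_minus_distrib[of _ ?d] arm_width_def)
  ultimately have "arm t \<omega> \<bullet> ?\<theta> - arm t \<omega> \<bullet> theta_star B \<le> (\<gamma> + \<beta>) * arm_width t \<omega>"
    unfolding sampled_theta_eq scalar_prod_theta_at(2)[OF t \<omega> x \<xi>c] \<gamma>_eq by (simp add: algebra_simps)
  with 1 2 3 show ?thesis by linarith
qed

end

lemma scalar_prod_theta_at_measurable:
  assumes t: "t \<in> {1..horizon B}" and N: "observes N (t - 1)"
    and x: "x \<in> carrier_vec (dim B)" and v: "v \<in> carrier_vec (dim B)"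
  shows "(\<lambda>\<omega>. x \<bullet> theta_at t \<omega> v) \<in> borel_measurable N"
proof -
  let ?n = "t - 1"
  have n: "?n \<le> horizon B" using t by auto
  have sp: "space N = \<Omega>" using N by (simp add: observes_def)
  have rew: "(\<lambda>\<omega>. vec (dim B) (\<lambda>i. \<Sum>s = 1..?n. reward B s \<omega> * arm s \<omega> $ i) $ i) \<in> borel_measurable N"
    if "i < dim B" for i
    using that N unfolding observes_def
    by (auto intro!: borel_measurable_sum borel_measurable_times arm_coord_measurable)
  have "(\<lambda>\<omega>. x \<bullet> (mat_inv (design_matrix B \<omega> ?n) *\<^sub>v
      vec (dim B) (\<lambda>i. \<Sum>s = 1..?n. reward B s \<omega> * arm s \<omega> $ i))) \<in> borel_measurable N"
    using x rew by (intro quadratic_form_measurable[OF sp] mat_inv_measurable[OF N] mat_inv_carrier[OF n]) auto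
  moreover have "(\<lambda>\<omega>. x \<bullet> (inv_root ?n \<omega> *\<^sub>v v)) \<in> borel_measurable N"
    using x v by (intro quadratic_form_measurable[OF sp] inv_root_measurable[OF N] inv_root_carrier[OF n]) auto
  ultimately have "(\<lambda>\<omega>. x \<bullet> (mat_inv (design_matrix B \<omega> ?n) *\<^sub>v
      vec (dim B) (\<lambda>i. \<Sum>s = 1..?n. reward B s \<omega> * arm s \<omega> $ i)) + \<beta> * (x \<bullet> (inv_root ?n \<omega> *\<^sub>v v))) \<in> borel_measurable N"
    by (intro borel_measurable_add borel_measurable_times) auto
  moreover have "x \<bullet> theta_at t \<omega> v = x \<bullet> (mat_inv (design_matrix B \<omega> ?n) *\<^sub>v
      vec (dim B) (\<lambda>i. \<Sum>s = 1..?n. reward B s \<omega> * arm s \<omega> $ i)) + \<beta> * (x \<bullet> (inv_root ?n \<omega> *\<^sub>v v))"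
    if "\<omega> \<in> space N" for \<omega>
    using scalar_prod_theta_at(1)[OF t _ x v, of \<omega>] least_squares_eq(2)[OF n, of \<omega>] that sp by simp
  ultimately show ?thesis by (simp cong: measurable_cong)
qed

lemma confident_measurable:
  assumes "observes N (t - 1)"
  shows "confident t \<in> sets N"
proof -
  have "space N = \<Omega>" using assms by (simp add: observes_def)
  moreover have "noise_norm2 (t - 1) -` {..(\<beta> - 1)\<^sup>2} \<inter> space N \<in> sets N"
    by (rule measurable_sets[OF noise_norm2_measurable[OF assms]]) simp
  moreover have "confident t = noise_norm2 (t - 1) -` {..(\<beta> - 1)\<^sup>2} \<inter> \<Omega>" by (auto simp: confident_def)
  ultimately show ?thesis by simp
qed

context
  assumes p_large: "2 * delta_round \<le> p"
begin

lemma pessimism_measurable: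
  assumes t: "t \<in> {1..horizon B}" and N: "observes N (t - 1)"
  shows "pessimism t \<in> borel_measurable N"
proof -
  have fin: "finite (arms B t)" and tT: "t \<le> horizon B" using arms[of t] t by auto
  have "(\<lambda>\<omega>. best_value t (theta_at t \<omega> v)) \<in> borel_measurable N" if v: "v \<in> carrier_vec (dim B)" for v
    unfolding best_value_def
  proof (rule borel_measurable_Max[OF fin])
    fix a assume "a \<in> arms B t"
    then have "feature B a \<in> carrier_vec (dim B)"
      using feature_in_unit_ball[OF tT] by (simp add: unit_ball_def)
    then show "(\<lambda>\<omega>. feature B a \<bullet> theta_at t \<omega> v) \<in> borel_measurable N"
      by (rule scalar_prod_theta_at_measurable[OF t N _ v])
  qed
  then show ?thesis
    unfolding pessimism_def[abs_def] using finite_grid[OF dim_pos mips_eps_pos] net_carrier(1)[OF p_large]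
    by (intro borel_measurable_Max borel_measurable_diff) auto
qed

lemma excess_measurable:
  assumes t: "t \<in> {1..horizon B}" and N: "observes N (t - 1)" and bad: "bad_round t \<in> sets N"
  shows "excess t \<in> borel_measurable N"
proof -
  have sp: "space N = \<Omega>" using N by (simp add: observes_def)
  have "good_past t \<in> sets N"
    unfolding good_past_def by (rule sets.Diff[OF confident_measurable[OF N] bad])
  moreover have "good_past t = {\<omega> \<in> space N. \<omega> \<in> good_past t}" by (auto simp: sp good_past_def confident_def)
  ultimately have "{\<omega> \<in> space N. \<omega> \<in> good_past t} \<in> sets N" by simp
  moreover have "(\<lambda>\<omega>. max 0 ((pessimism t \<omega> - search_error) / (2 * \<gamma>))) \<in> borel_measurable N"
    using pessimism_measurable[OF t N] by measurable
  ultimately show ?thesis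
    unfolding excess_def[abs_def] by (intro measurable_If) auto
qed

lemma measure_azuma:
  "measure (prob B) {\<omega> \<in> \<Omega>. (\<Sum>t = 1..horizon B. p / 2 * excess t \<omega> - arm_width t \<omega>)
      \<ge> sqrt (8 * horizon B * ln (4 / confidence B))} \<le> confidence B / 4"
proof -
  interpret P: prob_space "prob B" by (rule prob_space_run)
  let ?u = "sqrt (8 * horizon B * ln (4 / confidence B))"
  have ln: "0 < ln (4 / confidence B)" using confidence by simp
  have width: "arm_width s \<in> borel_measurable N" if "s \<in> {1..horizon B}" "observes N s" for s N
    using arm_width_measurable[of N "s - 1"] that by (cases s) auto
  have "measure (prob B) {\<omega> \<in> \<Omega>. (\<Sum>t = 1..horizon B. p / 2 * excess t \<omega> - arm_width t \<omega>) \<ge> ?u}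
    \<le> exp (- ?u\<^sup>2 / (4 * horizon B))"
  proof (rule P.azuma_bound[where F = past_measure and A = optimistic])
    fix t assume t: "t \<in> {1..horizon B}"
    show "subalgebra (prob B) (past_measure t)" by (rule subalgebra_past[OF t])
    have "\<Omega> \<in> sets (past_measure t)" using sets.top[of "past_measure t"] by simp
    from optimistic_past(1)[OF t this] show "optimistic t \<in> sets (prob B)"
      by (simp add: Int_absorb2 optimistic_def)
    \<comment> \<open>Truncation costs \<open>delta_round\<close> of the probability of optimism; by
      \<open>p_large\<close> at least half of \<open>p\<close> survives.\<close>
    show "p / 2 * measure (prob B) E \<le> measure (prob B) (optimistic t \<inter> E)" if E: "E \<in> sets (past_measure t)" for E
    proof -
      have "p / 2 * measure (prob B) E \<le> (p - delta_round) * measure (prob B) E"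
        using p_large by (intro mult_right_mono) auto
      then show ?thesis using optimistic_past(2)[OF t E] by linarith
    qed
    show "excess s \<in> borel_measurable (past_measure t)" if "s \<in> {1..t}" for s
    proof (rule excess_measurable)
      show s: "s \<in> {1..horizon B}" using that t by auto
      show "observes (past_measure t) (s - 1)"
        using that by (intro observes_mono[OF observes_past[OF t]]) auto
      show "bad_round s \<in> sets (past_measure t)" using s by (intro bad_round_past[OF t]) auto
    qed
    show "0 \<le> excess t \<omega> \<and> excess t \<omega> \<le> 1" for \<omega> by (rule excess_bounds[OF p_large t])
    show "arm_width s \<in> borel_measurable (past_measure t)" if "s \<in> {1..<t}" for s
      using that t by (intro width observes_mono[OF observes_past[OF t]]) auto
    show "arm_width t \<in> borel_measurable (prob B)"
      using t by (intro width observes_mono[OF observes_prob]) auto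
    show "0 \<le> arm_width t \<omega> \<and> arm_width t \<omega> \<le> 1" if "\<omega> \<in> \<Omega>" for \<omega>
      by (rule arm_width_bounds[OF t that])
    show "excess t \<omega> \<le> arm_width t \<omega>" if "\<omega> \<in> optimistic t" for \<omega>
      by (rule optimistic_excess[OF p_large t that])
  qed (use constants p_le_half horizon_pos ln in auto)
  \<comment> \<open>The deviation chosen in the regret bound even gives the square of
    \<open>confidence B / 4\<close>; the weaker bound suffices.\<close>
  also have "- ?u\<^sup>2 / (4 * horizon B) = - 2 * ln (4 / confidence B)"
    using ln horizon_pos by simp
  also have "exp (- 2 * ln (4 / confidence B)) \<le> exp (- ln (4 / confidence B))" using ln by simp
  also have "\<dots> = confidence B / 4" using confidence by (simp add: exp_minus)
  finally show ?thesis .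
qed

end

section \<open>Exceptional events and the regret bound\<close>

lemma measure_not_confident:
  assumes t: "t \<in> {1..horizon B}"
  shows "\<Omega> - confident t \<in> sets (prob B)" "measure (prob B) (\<Omega> - confident t) \<le> delta_round"
proof -
  have "t - 1 \<le> horizon B" using t by auto
  then have "observes (prob B) (t - 1)" by (rule observes_mono[OF observes_prob])
  then show "\<Omega> - confident t \<in> sets (prob B)" using confident_measurable by auto
  have "\<Omega> - confident t = {\<omega> \<in> \<Omega>. noise_norm2 (t - 1) \<omega> > 2 * ln (1 / delta_round) + dim B * ln (1 + horizon B / dim B)}"
    by (auto simp: confident_def \<beta>_power2)
  then show "measure (prob B) (\<Omega> - confident t) \<le> delta_round"
    using measure_noise_norm2[OF \<open>t - 1 \<le> horizon B\<close> delta_round(1,3)] by simp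
qed

definition large_sample :: "nat \<Rightarrow> 'w set" where
  "large_sample t = {\<omega> \<in> \<Omega>. vnorm (xi B t \<omega>) > radius delta_round}"

lemma measure_large_sample:
  assumes t: "t \<in> {1..horizon B}"
  shows "large_sample t \<in> sets (prob B)" "measure (prob B) (large_sample t) \<le> delta_round"
proof -
  interpret P: prob_space "prob B" by (rule prob_space_run)
  define C where "C = {\<xi> \<in> space D. vnorm \<xi> \<le> radius delta_round}"
  note c = concentration[OF delta_round(1,3), folded C_def]
  have m: "xi B t -` C \<inter> \<Omega> \<in> sets (prob B)"
    using measurable_sets[OF xi_measurable[OF t], of C] c(1) sets_D by simp
  have eq: "large_sample t = \<Omega> - (xi B t -` C \<inter> \<Omega>)"
    using xi_carrier[OF t] by (auto simp: large_sample_def C_def space_D)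
  show "large_sample t \<in> sets (prob B)" unfolding eq using m by auto
  show "measure (prob B) (large_sample t) \<le> delta_round"
    unfolding eq P.prob_compl[OF m] measure_xi[OF t c(1)] using c(2) by linarith
qed

lemma regret_eq: "regret B \<omega> = (\<Sum>t = 1..horizon B. optimal_vec t \<bullet> theta_star B - arm t \<omega> \<bullet> theta_star B)"
  by (simp add: regret_def optimal_vec_def arm_def)

lemma round_regret_le_2:
  assumes t: "t \<in> {1..horizon B}" and \<omega>: "\<omega> \<in> \<Omega>"
  shows "optimal_vec t \<bullet> theta_star B - arm t \<omega> \<bullet> theta_star B \<le> 2"
proof -
  have tT: "t \<le> horizon B" using t by simp
  have le: "\<bar>x \<bullet> theta_star B\<bar> \<le> 1" if x: "x \<in> carrier_vec (dim B)" "vnorm x \<le> 1" for x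
  proof -
    have "\<bar>x \<bullet> theta_star B\<bar> \<le> vnorm x * vnorm (theta_star B)"
      by (rule scalar_prod_le_vnorm[OF x(1) theta_star(1)])
    also have "\<dots> \<le> 1 * 1" using x theta_star by (intro mult_mono) auto
    finally show ?thesis by simp
  qed
  show ?thesis
    using le[OF optimal_vec(1,2)[OF tT]] le[OF arm_carrier[OF t \<omega>] vnorm_arm[OF t \<omega>]] by linarith
qed

lemma regret_measurable: "regret B \<in> borel_measurable (prob B)"
proof -
  have "(\<lambda>\<omega>. arm t \<omega> \<bullet> theta_star B) \<in> borel_measurable (prob B)" if "t \<in> {1..horizon B}" for t
    unfolding arm_def by (rule measurable_compose[OF play_measurable[OF that]]) simp
  then show ?thesis
    unfolding regret_eq[abs_def] by (intro borel_measurable_sum borel_measurable_diff) auto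
qed

theorem regret_bound_whp:
  "measure (prob B) {\<omega> \<in> \<Omega>. regret B \<omega> \<le>
      regret_bound (dim B) (horizon B) (confidence B) (accuracy B) p b b'} \<ge> 1 - confidence B"
proof -
  interpret P: prob_space "prob B" by (rule prob_space_run)
  let ?T = "real (horizon B)" and ?d = "real (dim B)" and ?\<delta> = "confidence B" and ?e = "mips_eps B"
  define S1 where "S1 = sqrt (2 * ?T * ?d * ln (1 + ?T / ?d))"
  define S2 where "S2 = sqrt (8 * ?T * ln (4 / ?\<delta>))"
  have S: "0 \<le> S1" "0 \<le> S2" using confidence by (auto simp: S1_def S2_def)
  have bound: "regret_bound (dim B) (horizon B) ?\<delta> (accuracy B) p b b' =
    4 * \<gamma> / p * (S1 + S2) + (\<gamma> + \<beta>) * S1 + 6 * (1 + \<gamma> + \<beta>) / p * ?e * ?T"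
    by (simp add: regret_bound_def Let_def \<beta>_def \<gamma>_def delta_round_def S1_def S2_def mips_eps_def)
  show ?thesis
  proof (cases "2 * delta_round \<le> p")
    case False
    have \<gamma>0: "0 \<le> \<gamma>"
    proof (rule ccontr)
      assume "\<not> 0 \<le> \<gamma>"
      then have "4 * \<gamma> / p * S2 \<le> 0" using constants S by (simp add: mult_nonpos_nonneg divide_nonpos_pos)
      then show False using small_p_bound False horizon_pos by (simp add: S2_def)
    qed
    have "regret B \<omega> \<le> regret_bound (dim B) (horizon B) ?\<delta> (accuracy B) p b b'" if \<omega>: "\<omega> \<in> \<Omega>" for \<omega>
    proof -
      have "regret B \<omega> \<le> (\<Sum>t = 1..horizon B. 2)"
        unfolding regret_eq by (rule sum_mono) (rule round_regret_le_2[OF _ \<omega>])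
      then have "regret B \<omega> \<le> 2 * ?T" by simp
      also have "\<dots> \<le> 4 * \<gamma> / p * S2" using small_p_bound False by (simp add: S2_def)
      also have "\<dots> \<le> 4 * \<gamma> / p * (S1 + S2)" using S \<gamma>0 constants by (intro mult_left_mono) auto
      also have "\<dots> \<le> 4 * \<gamma> / p * (S1 + S2) + (\<gamma> + \<beta>) * S1 + 6 * (1 + \<gamma> + \<beta>) / p * ?e * ?T"
        using S \<gamma>0 \<beta>_ge_2 constants mips_eps_pos by simp
      finally show ?thesis by (simp only: bound)
    qed
    then have "{\<omega> \<in> \<Omega>. regret B \<omega> \<le> regret_bound (dim B) (horizon B) ?\<delta> (accuracy B) p b b'} = \<Omega>" by blast
    then show ?thesis using P.prob_space confidence by simp
  next
    case p: True
    define E1 where "E1 = (\<Union>t \<in> {1..horizon B}. \<Omega> - confident t)"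
    define E2 where "E2 = (\<Union>t \<in> {1..horizon B}. large_sample t)"
    define E3 where "E3 = {\<omega> \<in> \<Omega>. (\<Sum>t = 1..horizon B. p / 2 * excess t \<omega> - arm_width t \<omega>) \<ge> S2}"
    define E4 where "E4 = {\<omega> \<in> \<Omega>. 6 * ?e * ?T \<le> (\<Sum>t = 1..horizon B. indicator (bad_round t) \<omega>)}"
    have Td: "?T * delta_round = ?\<delta> / 4" using horizon_pos by (simp add: delta_round_def)
    have "measure (prob B) E1 \<le> (\<Sum>t \<in> {1..horizon B}. measure (prob B) (\<Omega> - confident t))"
      unfolding E1_def using measure_not_confident(1) by (intro P.finite_measure_subadditive_finite) auto
    also have "\<dots> \<le> (\<Sum>t \<in> {1..horizon B}. delta_round)" by (intro sum_mono measure_not_confident(2))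
    finally have 1: "measure (prob B) E1 \<le> ?\<delta> / 4" using Td by simp
    have "measure (prob B) E2 \<le> (\<Sum>t \<in> {1..horizon B}. measure (prob B) (large_sample t))"
      unfolding E2_def using measure_large_sample(1) by (intro P.finite_measure_subadditive_finite) auto
    also have "\<dots> \<le> (\<Sum>t \<in> {1..horizon B}. delta_round)" by (intro sum_mono measure_large_sample(2))
    finally have 2: "measure (prob B) E2 \<le> ?\<delta> / 4" using Td by simp
    have 3: "measure (prob B) E3 \<le> ?\<delta> / 4" using measure_azuma[OF p] by (simp add: E3_def S2_def)
    have 4: "measure (prob B) E4 \<le> ?\<delta> / 4" unfolding E4_def by (rule sum_indicator_bad_round)
    have bad_m: "bad_round t \<in> sets (prob B)" if "t \<in> {1..horizon B}" for t
      using measure_bad_round(1) that by simp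
    have width_m: "arm_width t \<in> borel_measurable (prob B)" if "t \<in> {1..horizon B}" for t
      using arm_width_measurable[OF observes_mono[OF observes_prob], of "t - 1"] that by (cases t) auto
    have excess_m: "excess t \<in> borel_measurable (prob B)" if "t \<in> {1..horizon B}" for t
      using that by (intro excess_measurable[OF p _ observes_mono[OF observes_prob]] bad_m) auto
    have m1: "E1 \<in> sets (prob B)" and m2: "E2 \<in> sets (prob B)"
      unfolding E1_def E2_def by (intro sets.finite_UN measure_not_confident(1) measure_large_sample(1); simp)+
    have m3: "E3 \<in> sets (prob B)"
    proof -
      have [measurable]: "(\<lambda>\<omega>. \<Sum>t = 1..horizon B. p / 2 * excess t \<omega> - arm_width t \<omega>) \<in> borel_measurable (prob B)"
        using width_m excess_m by (intro borel_measurable_sum borel_measurable_diff borel_measurable_times) auto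
      show ?thesis unfolding E3_def by measurable
    qed
    have m4: "E4 \<in> sets (prob B)"
    proof -
      have [measurable]: "(\<lambda>\<omega>. \<Sum>t = 1..horizon B. indicator (bad_round t) \<omega> :: real) \<in> borel_measurable (prob B)"
        using bad_m by (intro borel_measurable_sum borel_measurable_indicator) auto
      show ?thesis unfolding E4_def by measurable
    qed
    have "measure (prob B) (E1 \<union> E2 \<union> E3 \<union> E4) \<le> ?\<delta>"
    proof -
      have "measure (prob B) (E1 \<union> E2) \<le> measure (prob B) E1 + measure (prob B) E2"
        using m1 m2 by (rule measure_Un_le)
      moreover have "measure (prob B) (E1 \<union> E2 \<union> E3) \<le> measure (prob B) (E1 \<union> E2) + measure (prob B) E3"
        using m1 m2 m3 by (intro measure_Un_le) auto
      moreover have "measure (prob B) (E1 \<union> E2 \<union> E3 \<union> E4) \<le> measure (prob B) (E1 \<union> E2 \<union> E3) + measure (prob B) E4"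
        using m1 m2 m3 m4 by (intro measure_Un_le) auto
      ultimately show ?thesis using 1 2 3 4 by linarith
    qed
    then have large: "1 - ?\<delta> \<le> measure (prob B) (\<Omega> - (E1 \<union> E2 \<union> E3 \<union> E4))"
      using m1 m2 m3 m4 by (subst P.prob_compl) auto
    note \<gamma> = \<gamma>_ge[OF p]
    have "regret B \<omega> \<le> regret_bound (dim B) (horizon B) ?\<delta> (accuracy B) p b b'"
      if "\<omega> \<in> \<Omega> - (E1 \<union> E2 \<union> E3 \<union> E4)" for \<omega>
    proof -
      have \<omega>: "\<omega> \<in> \<Omega>" and ok: "\<omega> \<notin> E1" "\<omega> \<notin> E2" "\<omega> \<notin> E3" "\<omega> \<notin> E4" using that by auto
      define err where "err = 2 * search_error + \<gamma> * ?e"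
      have err: "0 \<le> err" using search_error_nonneg[OF p] \<gamma> mips_eps_pos by (simp add: err_def)
      \<comment> \<open>A bad round is charged the trivial regret 2; the other terms are nonnegative
        and may remain, which gives one bound for all rounds.\<close>
      have "optimal_vec t \<bullet> theta_star B - arm t \<omega> \<bullet> theta_star B \<le>
        2 * \<gamma> * excess t \<omega> + err + (\<gamma> + \<beta>) * arm_width t \<omega> + 2 * indicator (bad_round t) \<omega>"
        if t: "t \<in> {1..horizon B}" for t
      proof (cases "\<omega> \<in> bad_round t")
        case True
        have "0 \<le> 2 * \<gamma> * excess t \<omega>" "0 \<le> (\<gamma> + \<beta>) * arm_width t \<omega>"
          using \<gamma> \<beta>_ge_2 excess_bounds[OF p t] arm_width_bounds[OF t \<omega>] by auto
        then show ?thesis using round_regret_le_2[OF t \<omega>] err True by simp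
      next
        case False
        have "\<omega> \<in> confident t" using ok(1) \<omega> t by (auto simp: E1_def)
        moreover have "vnorm (xi B t \<omega>) \<le> radius delta_round"
          using ok(2) \<omega> t by (auto simp: E2_def large_sample_def not_less)
        ultimately show ?thesis
          using round_regret[OF p t, of \<omega>] False by (simp add: good_past_def err_def)
      qed
      then have "regret B \<omega> \<le> (\<Sum>t = 1..horizon B. 2 * \<gamma> * excess t \<omega> + err + (\<gamma> + \<beta>) * arm_width t \<omega> + 2 * indicator (bad_round t) \<omega>)"
        unfolding regret_eq by (rule sum_mono)
      also have "\<dots> = 2 * \<gamma> * (\<Sum>t = 1..horizon B. excess t \<omega>) + err * ?T + (\<gamma> + \<beta>) * (\<Sum>t = 1..horizon B. arm_width t \<omega>)
          + 2 * (\<Sum>t = 1..horizon B. indicator (bad_round t) \<omega>)"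
        by (simp add: sum.distrib sum_distrib_left)
      finally have reg: "regret B \<omega> \<le> 2 * \<gamma> * (\<Sum>t = 1..horizon B. excess t \<omega>) + err * ?T
          + (\<gamma> + \<beta>) * (\<Sum>t = 1..horizon B. arm_width t \<omega>) + 2 * (\<Sum>t = 1..horizon B. indicator (bad_round t) \<omega>)" .
      have W: "(\<Sum>t = 1..horizon B. arm_width t \<omega>) \<le> S1" using sum_arm_width_le[OF \<omega>] by (simp add: S1_def)
      have "p / 2 * (\<Sum>t = 1..horizon B. excess t \<omega>) \<le> (\<Sum>t = 1..horizon B. arm_width t \<omega>) + S2"
        using ok(3) \<omega> by (simp add: E3_def sum_subtractf sum_distrib_left sum_distrib_right mult_ac sum_divide_distrib)
      then have "p / 2 * (\<Sum>t = 1..horizon B. excess t \<omega>) \<le> S1 + S2" using W by linarith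
      \<comment> \<open>The weight \<open>p / 2\<close> of the excess must be turned into
        \<open>2 * \<gamma>\<close>; this is the origin of \<open>4 * \<gamma> / p\<close> in the
        theorem.\<close>
      then have "4 * \<gamma> / p * (p / 2 * (\<Sum>t = 1..horizon B. excess t \<omega>)) \<le> 4 * \<gamma> / p * (S1 + S2)"
        using \<gamma> constants by (intro mult_left_mono) auto
      then have Z: "2 * \<gamma> * (\<Sum>t = 1..horizon B. excess t \<omega>) \<le> 4 * \<gamma> / p * (S1 + S2)"
        using constants by simp
      have W': "(\<gamma> + \<beta>) * (\<Sum>t = 1..horizon B. arm_width t \<omega>) \<le> (\<gamma> + \<beta>) * S1"
        using W \<gamma> \<beta>_ge_2 by (intro mult_left_mono) auto
      have bad: "(\<Sum>t = 1..horizon B. indicator (bad_round t) \<omega>) \<le> 6 * ?e * ?T"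
        using ok(4) \<omega> by (simp add: E4_def)
      \<comment> \<open>The 8 comes from two search errors, the single \<gamma> from the net, and
        the 12 from at most \<open>6 * ?e * ?T\<close> bad rounds of regret 2. As \<beta> and
        \<gamma> are at least 2, the sum is at most \<open>12 * (1 + \<gamma> + \<beta>)\<close>,
        and 12 is at most \<open>6 / p\<close>.\<close>
      have "err * ?T + 2 * (6 * ?e * ?T) = (8 * (1 + \<beta> + \<gamma>) + \<gamma> + 12) * (?e * ?T)"
        by (simp add: err_def search_error_def algebra_simps)
      also have "\<dots> \<le> 6 * (1 + \<gamma> + \<beta>) / p * (?e * ?T)"
      proof (rule mult_right_mono)
        have "6 * (1 + \<gamma> + \<beta>) * 2 \<le> 6 * (1 + \<gamma> + \<beta>) * (1 / p)"
          using p_le_half constants \<gamma> \<beta>_ge_2 by (intro mult_left_mono) (auto simp: field_simps)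
        then show "8 * (1 + \<beta> + \<gamma>) + \<gamma> + 12 \<le> 6 * (1 + \<gamma> + \<beta>) / p" using \<gamma> \<beta>_ge_2 by simp
      qed (use mips_eps_pos in simp)
      finally have "err * ?T + 2 * (6 * ?e * ?T) \<le> 6 * (1 + \<gamma> + \<beta>) / p * ?e * ?T" by (simp add: mult.assoc)
      then show ?thesis unfolding bound using reg Z W' bad by linarith
    qed
    then have "\<Omega> - (E1 \<union> E2 \<union> E3 \<union> E4) \<subseteq> {\<omega> \<in> \<Omega>. regret B \<omega> \<le> regret_bound (dim B) (horizon B) ?\<delta> (accuracy B) p b b'}"
      by blast
    moreover have "{\<omega> \<in> \<Omega>. regret B \<omega> \<le> regret_bound (dim B) (horizon B) ?\<delta> (accuracy B) p b b'} \<in> sets (prob B)"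
      using regret_measurable by measurable
    ultimately show ?thesis using large by (meson P.finite_measure_mono order_trans)
  qed
qed

end

subsection \<open>Running times\<close>

lemma modify_times_le:
  fixes tm :: real
  assumes runs: "runs_within d K tb tm tq S" and s: "s \<in> space (seed_space S)"
    and adm: "admissible d K P (us @ vs)"
  shows "modify_times S vs (state_after S s P us) \<le> length vs * tm"
  using adm
proof (induction vs arbitrary: us)
  case Nil
  then show ?case by simp
next
  case (Cons v vs)
  have "admissible d K P (take (length us) (us @ v # vs))" "admissible d K P (take (Suc (length us)) (us @ v # vs))"
    using Cons.prems by (rule admissible_take)+
  then have "modify_time S v (state_after S s P us) \<le> tm"
    using runs s by (auto simp: runs_within_def)
  moreover have "modify_times S vs (state_after S s P (us @ [v])) \<le> length vs * tm"
    using Cons.prems by (intro Cons.IH) simp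
  ultimately show ?case by (simp add: state_after_def algebra_simps)
qed

lemma sum_list_le_length_mult:
  fixes f :: "'b \<Rightarrow> real" and c :: real
  assumes "\<And>x. x \<in> set xs \<Longrightarrow> f x \<le> c"
  shows "(\<Sum>x\<leftarrow>xs. f x) \<le> length xs * c"
  using assms by (induction xs) (auto simp: algebra_simps intro: add_mono)

context bandit_algorithm
begin

text \<open>The factor \<open>mips_c i\<close> is tuned to the threshold so that the absolute gap
  \<open>w\<close> between \<open>r\<close> and \<open>c * r\<close> lies between
  \<open>e / 2\<close> and \<open>e\<close> for every solver. As \<open>3 - r\<close> lies between 1
  and 3, this gives \<open>e / 6 \<le> s \<le> 1\<close>, and dividing by
  \<open>2 + s \<le> 3\<close> leaves \<open>e / 18\<close>.\<close>

lemma rho_q_le: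
  assumes i: "i \<in> {1..num_solvers B}"
  shows "rho_q (mips_c i) (mips_r B i) \<le> 1 - (accuracy B / (18 * dim B))\<^sup>2"
proof -
  define e where "e = mips_eps B"
  define r where "r = mips_r B i"
  define w where "w = r / (i + 1)"
  define s where "s = w / (3 - r)"
  have e: "0 < e" "e < 1" using mips_eps_pos mips_eps_less_1 by (auto simp: e_def)
  have r: "0 < r" "r < 2" using mips_r_pos[of i] num_solvers(4)[of i] i by (auto simp: r_def)
  have r_eq: "r = i * e" by (simp add: r_def e_def mips_r_def mips_eps_def)
  have ri: "e / 2 \<le> w" "w \<le> e"
    using i e unfolding w_def r_eq by (auto simp: field_simps)
  have s: "e / 6 \<le> s" "s \<le> 1"
  proof -
    have "(e / 2) / 3 \<le> w / (3 - r)" by (rule frac_le) (use ri r e in linarith)+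
    then show "e / 6 \<le> s" by (simp add: s_def)
    have "w / (3 - r) \<le> 1 / 1" by (rule frac_le) (use ri r e in linarith)+
    then show "s \<le> 1" by (simp add: s_def)
  qed
  have cr: "3 - mips_c i * r = 3 - r + w" by (simp add: mips_c_def w_def algebra_simps)
  have "(c_prime (mips_c i) r)\<^sup>2 = (3 - mips_c i * r) / (3 - r)"
    unfolding c_prime_def cr using r ri e by simp
  also have "\<dots> = 1 + s" unfolding cr s_def using r by (simp add: field_simps)
  finally have x: "(c_prime (mips_c i) r)\<^sup>2 = 1 + s" .
  have "rho_q (mips_c i) r = 1 - (s / (2 + s))\<^sup>2"
    unfolding rho_q_def x using s e by (simp add: power2_eq_square divide_simps) (simp add: algebra_simps)
  moreover have "(e / 18)\<^sup>2 \<le> (s / (2 + s))\<^sup>2"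
  proof (rule power_mono)
    have "(e / 6) / 3 \<le> s / (2 + s)" using s e by (intro frac_le) auto
    then show "e / 18 \<le> s / (2 + s)" by simp
  qed (use e in simp)
  ultimately show ?thesis by (simp add: r_def e_def mips_eps_def mult.commute)
qed

text \<open>Arms may share a feature vector, so the set of points changes by at most as many
  elements as the set of arms.\<close>

lemma length_changes_le:
  assumes t: "t \<in> {1..horizon B}"
  shows "length (changes B t) \<le> C_change"
proof -
  have tT: "t \<le> horizon B" "t - 1 \<le> horizon B" using t by auto
  have diff: "card (points B s - points B s') \<le> card (arms B s - arms B s')" if "s \<le> horizon B" for s s'
  proof -
    have "points B s - points B s' \<subseteq> feature B ` (arms B s - arms B s')" by (auto simp: points_def)
    then have "card (points B s - points B s') \<le> card (feature B ` (arms B s - arms B s'))"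
      using arms[OF that] by (intro card_mono) auto
    also have "\<dots> \<le> card (arms B s - arms B s')" using arms[OF that] by (intro card_image_le) auto
    finally show ?thesis .
  qed
  have "length (changes B t) = card (points B (t - 1) - points B t) + card (points B t - points B (t - 1))"
    using points[OF tT(1)] points[OF tT(2)] by (simp add: changes_def length_list_of)
  also have "\<dots> \<le> card (arms B t - arms B (t - 1)) + card (arms B (t - 1) - arms B t)"
    using diff[OF tT(1), of "t - 1"] diff[OF tT(2), of t] by simp
  also have "\<dots> \<le> C_change" using bandit t by (auto simp: linear_bandit_def)
  finally show ?thesis .
qed

lemma copies_le: "copies B \<le> dim B * (ln (2 * size_bound B * dim B ^ 3 / ((accuracy B)\<^sup>2 * confidence B)) + 1)"
proof -
  let ?X = "2 * size_bound B * dim B ^ 3 / ((accuracy B)\<^sup>2 * confidence B)"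
  have "real (size_bound B) * dim B / (mips_eps B * mips_delta B) = ?X"
    using dim_pos accuracy confidence
    by (simp add: mips_eps_def mips_delta_def power2_eq_square power3_eq_cube field_simps)
  then have eq: "copies B = nat \<lceil>dim B * ln ?X\<rceil>" by (simp add: copies_def num_copies_def)
  have "(accuracy B)\<^sup>2 * confidence B \<le> 1 * 1" using accuracy confidence by (intro mult_mono) (auto simp: power_le_one)
  moreover have "1 \<le> real (size_bound B) * dim B ^ 3"
    using size_bound_pos dim_pos by (metis One_nat_def le_numeral_extra(4) mult_le_mono nat_mult_1_right of_nat_1 of_nat_le_iff of_nat_mult of_nat_power one_le_power)
  ultimately have "1 \<le> ?X" using accuracy confidence by (subst le_divide_eq_1_pos) auto
  then have "0 \<le> dim B * ln ?X" by simp
  then have "copies B \<le> dim B * ln ?X + 1" unfolding eq by linarith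
  also have "\<dots> \<le> dim B * (ln ?X + 1)" using dim_pos by (simp add: distrib_left)
  finally show ?thesis .
qed

context
  fixes tb tm gq :: real
  assumes runs: "\<And>c r. 0 < c \<and> c < 1 \<and> 0 < r \<and> r < 2 \<Longrightarrow>
      runs_within (dim B) (size_bound B) tb tm (real (size_bound B) powr (rho_q c r + gq)) (solver_for B c r)"
    and tm: "0 \<le> tm"
begin

lemma solver_runs:
  assumes "i \<in> {1..num_solvers B}"
  shows "runs_within (dim B) (size_bound B) tb tm
    (real (size_bound B) powr (1 - (accuracy B / (18 * dim B))\<^sup>2 + gq)) (solver_of B i)"
proof -
  have 1: "runs_within (dim B) (size_bound B) tb tm
      (real (size_bound B) powr (rho_q (mips_c i) (mips_r B i) + gq)) (solver_of B i)"
    unfolding solver_of_def using mips_c mips_r_pos num_solvers(4) assms by (intro runs) auto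
  have "real (size_bound B) powr (rho_q (mips_c i) (mips_r B i) + gq) \<le>
      real (size_bound B) powr (1 - (accuracy B / (18 * dim B))\<^sup>2 + gq)"
    using rho_q_le[OF assms] size_bound_pos by (intro powr_mono) auto
  then show ?thesis using 1 unfolding runs_within_def by (meson order_trans)
qed

lemma seed_in_space:
  "i \<in> {1..num_solvers B} \<Longrightarrow> j < copies B \<Longrightarrow> \<omega> \<in> space (prob B) \<Longrightarrow>
    copy_seed B i j \<omega> \<in> space (seed_space (solver_of B i))"
  using measurable_space[OF seed_measurable] by blast

lemma initialization_time_le:
  assumes \<omega>: "\<omega> \<in> space (prob B)"
  shows "initialization_time B \<omega> \<le> num_solvers B * (copies B * tb)"
proof -
  have adm: "admissible (dim B) (size_bound B) (points B 0) []"
    using updates[of 0] by (simp add: updates_def)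
  have "build_time (solver_of B i) (copy_seed B i j \<omega>) (points B 0) \<le> tb"
    if "i \<in> {1..num_solvers B}" "j < copies B" for i j
    using solver_runs[OF that(1)] seed_in_space[OF that \<omega>] adm unfolding runs_within_def by blast
  then have "initialization_time B \<omega> \<le> (\<Sum>i = 1..num_solvers B. \<Sum>j < copies B. tb)"
    unfolding initialization_time_def by (intro sum_mono) auto
  then show ?thesis by simp
qed

lemma round_time_le:
  assumes \<omega>: "\<omega> \<in> space (prob B)" and t: "t \<in> {1..horizon B}" and k: "num_solvers B + 1 \<le> 2 ^ k"
  shows "round_time elem_time B t \<omega> \<le> elem_time (dim B) t + num_solvers B * (copies B * (C_change * tm))
    + k * (copies B * real (size_bound B) powr (1 - (accuracy B / (18 * dim B))\<^sup>2 + gq)) + scan_time B t \<omega>"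
proof -
  let ?q = "real (size_bound B) powr (1 - (accuracy B / (18 * dim B))\<^sup>2 + gq)"
  have tT: "t \<le> horizon B" "t - 1 \<le> horizon B" and Suc: "Suc (t - 1) = t" using t by auto
  have upd: "updates t = updates (t - 1) @ changes B t" using updates_Suc[of "t - 1"] Suc by simp
  have adm: "admissible (dim B) (size_bound B) (points B 0) (updates (t - 1) @ changes B t)"
    using updates[OF tT(1)] upd by simp
  have states: "copy_states B i s \<omega> = map (\<lambda>j. state_after (solver_of B i) (copy_seed B i j \<omega>) (points B 0) (updates s))
      [0..<copies B]" for i s
    by (simp add: copy_states_def updates_def)
  have "(\<Sum>st\<leftarrow>copy_states B i (t - 1) \<omega>. modify_times (solver_of B i) (changes B t) st) \<le> copies B * (C_change * tm)"
    if i: "i \<in> {1..num_solvers B}" for i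
  proof -
    have "(\<Sum>st\<leftarrow>copy_states B i (t - 1) \<omega>. modify_times (solver_of B i) (changes B t) st)
      \<le> length (copy_states B i (t - 1) \<omega>) * (C_change * tm)"
    proof (rule sum_list_le_length_mult)
      fix st assume "st \<in> set (copy_states B i (t - 1) \<omega>)"
      then obtain j where j: "j < copies B"
        "st = state_after (solver_of B i) (copy_seed B i j \<omega>) (points B 0) (updates (t - 1))"
        unfolding states by auto
      have "modify_times (solver_of B i) (changes B t) st \<le> length (changes B t) * tm"
        unfolding j(2) by (rule modify_times_le[OF solver_runs[OF i] seed_in_space[OF i j(1) \<omega>] adm])
      also have "\<dots> \<le> C_change * tm" using length_changes_le[OF t] tm by (intro mult_right_mono) auto
      finally show "modify_times (solver_of B i) (changes B t) st \<le> C_change * tm" .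
    qed
    then show ?thesis by (simp add: states)
  qed
  then have "(\<Sum>i = 1..num_solvers B. \<Sum>st\<leftarrow>copy_states B i (t - 1) \<omega>. modify_times (solver_of B i) (changes B t) st)
    \<le> (\<Sum>i = 1..num_solvers B. copies B * (C_change * tm))" by (intro sum_mono) auto
  then have 1: "(\<Sum>i = 1..num_solvers B. \<Sum>st\<leftarrow>copy_states B i (t - 1) \<omega>. modify_times (solver_of B i) (changes B t) st)
    \<le> num_solvers B * (copies B * (C_change * tm))" by simp
  define ps where "ps = probes (\<lambda>i. mips_answer B t \<omega> i \<noteq> None) 0 (num_solvers B + 1)"
  define z where "z = round_query (dim B) (mips_eps B) (mips_query B t \<omega>)"
  have fin: "finite (grid (dim B) (mips_eps B))" by (rule finite_grid[OF dim_pos mips_eps_pos])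
  \<comment> \<open>Since the grid is nonempty and finite, the rounded query lies in it whatever the
    query is. The running time bound therefore holds for every outcome, not only for good
    ones.\<close>
  have "0\<^sub>v (dim B) \<in> grid (dim B) (mips_eps B)"
    by (auto simp: grid_def unit_ball_def vnorm_def intro!: exI[of _ 0])
  then have "z \<in> grid (dim B) (mips_eps B)"
    unfolding z_def round_query_def using fin by (intro arg_min_if_finite(1)) auto
  then have z: "z \<in> unit_ball (dim B)" by (rule grid_in_unit_ball)
  have "(\<Sum>i\<leftarrow>ps. adaptive_lookup_time (dim B) (mips_eps B) (solver_of B i) (copy_states B i t \<omega>) (mips_query B t \<omega>))
    \<le> length ps * (copies B * ?q)"
  proof (rule sum_list_le_length_mult)
    fix i assume "i \<in> set ps"
    then have i: "i \<in> {1..num_solvers B}" using probes_bounds[of i] unfolding ps_def by fastforce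
    have "(\<Sum>st\<leftarrow>copy_states B i t \<omega>. lookup_time (solver_of B i) st z) \<le> length (copy_states B i t \<omega>) * ?q"
    proof (rule sum_list_le_length_mult)
      fix st assume "st \<in> set (copy_states B i t \<omega>)"
      then obtain j where j: "j < copies B"
        "st = state_after (solver_of B i) (copy_seed B i j \<omega>) (points B 0) (updates t)"
        unfolding states by auto
      show "lookup_time (solver_of B i) st z \<le> ?q"
        using solver_runs[OF i] seed_in_space[OF i j(1) \<omega>] updates[OF tT(1)] z
        unfolding j(2) runs_within_def by blast
    qed
    then show "adaptive_lookup_time (dim B) (mips_eps B) (solver_of B i) (copy_states B i t \<omega>) (mips_query B t \<omega>)
        \<le> copies B * ?q"
      by (simp add: adaptive_lookup_time_def z_def states)
  qed
  also have "\<dots> \<le> k * (copies B * ?q)"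
    using length_probes_le[of "num_solvers B + 1" 0 k] k by (intro mult_right_mono) (auto simp: ps_def)
  finally show ?thesis using 1 unfolding round_time_def ps_def by linarith
qed

end

end

section \<open>Asymptotics in the number of arms\<close>

lemma ex_power2_ge:
  fixes x :: real
  assumes "1 \<le> x"
  obtains k :: nat where "x \<le> 2 ^ k" "k \<le> 1 + 2 * ln x"
proof -
  define k where "k = nat \<lceil>log 2 x\<rceil>"
  have log: "0 \<le> log 2 x" using assms by simp
  have "x = 2 powr (log 2 x)" using assms by simp
  also have "\<dots> \<le> 2 powr k" using log by (intro powr_mono) (auto simp: k_def)
  finally have 1: "x \<le> 2 ^ k" by (simp add: powr_realpow)
  have "exp (1 / 2) \<le> (2 :: real)"
  proof -
    have "exp (1 / 2) * exp (1 / 2) = exp (1 :: real)" by (simp add: exp_add[symmetric])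
    then have "(exp (1 / 2))\<^sup>2 \<le> (2 :: real)\<^sup>2" using e_less_272 by (simp add: power2_eq_square)
    then show ?thesis by (rule power2_le_imp_le) simp
  qed
  then have "1 / 2 \<le> ln (2 :: real)" by (subst ln_ge_iff) auto
  then have "ln x * (1 / 2) \<le> ln x * ln 2" using assms by (intro mult_left_mono) auto
  then have "log 2 x \<le> 2 * ln x" using \<open>1 / 2 \<le> ln 2\<close> by (simp add: log_def divide_le_eq mult_ac)
  then have "k \<le> 1 + 2 * ln x" unfolding k_def using log by linarith
  with 1 show ?thesis by (rule that)
qed

text \<open>Moves a factor into the exponent, which is how logarithmic factors become part of the
  vanishing terms.\<close>

lemma real_powr_ln_div:
  fixes x y :: real
  assumes "x > 1" "y > 0"
  shows "x powr (ln y / ln x) = y"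
  using assms by (simp add: powr_def)

lemma eventually_le_of_smallo_ln:
  assumes "(f :: nat \<Rightarrow> real) \<in> o(\<lambda>K. ln (real K))" "c > 0"
  shows "\<forall>\<^sub>F K in sequentially. f K \<le> c * ln (real K)"
  using landau_o.smallD[OF assms] eventually_ge_at_top[of 1]
  by eventually_elim auto

lemma eventually_le_powr_of_smallo_ln:
  fixes f :: "nat \<Rightarrow> real"
  assumes "(\<lambda>K. ln (f K)) \<in> o(\<lambda>K. ln (real K))" "\<And>K. K \<ge> 1 \<Longrightarrow> 0 < f K" "c > 0"
  shows "\<forall>\<^sub>F K in sequentially. f K \<le> real K powr c"
  using eventually_le_of_smallo_ln[OF assms(1,3)] eventually_ge_at_top[of 1]
proof eventually_elim
  case (elim K)
  then have "exp (ln (f K)) \<le> exp (c * ln (real K))" by simp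
  then show ?case using assms(2)[of K] elim by (simp add: powr_def)
qed

lemma eventually_const_le_powr:
  fixes a c :: real
  assumes "c > 0"
  shows "\<forall>\<^sub>F K in sequentially. a \<le> real K powr c"
proof -
  have "filterlim (\<lambda>K. real K powr c) at_top sequentially" using assms by real_asymp
  then show ?thesis by (simp add: filterlim_at_top)
qed

lemma eventually_const_le_ln: "\<forall>\<^sub>F K in sequentially. (a :: real) \<le> ln (real K)"
proof -
  have "filterlim (\<lambda>K. ln (real K)) at_top sequentially" by real_asymp
  then show ?thesis by (simp add: filterlim_at_top)
qed

text \<open>In general the factor \<open>d K\<close> cannot be hidden in the exponent:
  \<open>ln (d K) / ln K\<close> is only known to vanish, whereas \<open>g\<close> has to be smaller
  than \<open>ln K\<close> to the power -0.45. For bounded dimension it can, and then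
  \<open>e\<close> is of order \<open>\<eta>\<^sup>2\<close>. The cost of scanning the arms after a
  null search is carried as a separate summand.\<close>

theorem theoremB5:
  fixes B :: "nat \<Rightarrow> ('w, 'a, 's, 'st) bandit_run"
    and D :: "nat \<Rightarrow> real vec measure"
    and d T :: "nat \<Rightarrow> nat"
    and \<eta> :: "nat \<Rightarrow> real"
    and \<delta> p b b' :: real
    and C_change :: nat
    and elem_time :: "nat \<Rightarrow> nat \<Rightarrow> real"
    and g_build g_modify g_query :: "nat \<Rightarrow> real"
  assumes \<delta>: "0 < \<delta>" "\<delta> < 1"
    and \<eta>: "\<And>n. 0 < \<eta> n \<and> \<eta> n < 1"
    and constants: "p > 0" "b > 0" "b' > 0"
    and parameters: "\<And>K. K \<ge> 1 \<Longrightarrow> size_bound (B K) = K \<and> dim (B K) = d K \<and>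
          horizon (B K) = T K \<and> accuracy (B K) = \<eta> (T K) \<and> confidence (B K) = \<delta>"
    and bandit: "\<And>K. K \<ge> 1 \<Longrightarrow> linear_bandit C_change (B K)"
    and distribution: "\<And>K. K \<ge> 1 \<Longrightarrow> sampling_distribution (d K) p b b' (D K)"
    and algorithm: "\<And>K. K \<ge> 1 \<Longrightarrow> thompson_sampling_run (D K) (B K)"
    and dimension_growth: "(\<lambda>K. ln (real (d K))) \<in> o(\<lambda>K. ln (real K))"
    and moderate_horizon: "(\<lambda>K. ln (real (T K))) \<in> o(\<lambda>K. ln (real K))"
    and moderate_accuracy: "(\<lambda>K. ln (1 / \<eta> (T K))) \<in> o(\<lambda>K. ln (real K))"
    and solver_exponents: "g_build \<in> o(\<lambda>_. 1)" "g_modify \<in> o(\<lambda>_. 1)"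
          "g_query \<in> o(\<lambda>K. ln (real K) powr (-0.45))"
    and solver_times: "\<forall>\<^sub>F K in sequentially. \<forall>c r. 0 < c \<and> c < 1 \<and> 0 < r \<and> r < 2 \<longrightarrow>
          runs_within (d K) K (real K powr (1 + g_build K)) (real K powr g_modify K)
            (real K powr (rho_q c r + g_query K)) (solver_for (B K) c r)"
    and elementary_work: "\<exists>A m. \<forall>n\<ge>1. \<forall>t\<ge>1. elem_time n t \<le> A * (real n * real t) ^ m"
  shows "(\<forall>K\<ge>1. measure (prob (B K)) {\<omega> \<in> space (prob (B K)).
            regret (B K) \<omega> \<le> regret_bound (d K) (T K) \<delta> (\<eta> (T K)) p b b'} \<ge> 1 - \<delta>) \<and>
    (\<exists>e g. e \<in> \<Theta>(\<lambda>K. (\<eta> (T K) / real (d K))\<^sup>2) \<and>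
          g \<in> o(\<lambda>K. ln (real K) powr (-0.45)) \<and>
          (\<forall>\<^sub>F K in sequentially. \<forall>\<omega> \<in> space (prob (B K)). \<forall>t \<in> {1..T K}.
             round_time elem_time (B K) t \<omega>
               \<le> real (d K) * real K powr (1 - e K + g K) + scan_time (B K) t \<omega>)) \<and>
    ((\<exists>n. \<forall>K. d K \<le> n) \<longrightarrow>
       (\<exists>e g. e \<in> \<Theta>(\<lambda>K. (\<eta> (T K))\<^sup>2) \<and> g \<in> o(\<lambda>K. ln (real K) powr (-0.45)) \<and>
          (\<forall>\<^sub>F K in sequentially. \<forall>\<omega> \<in> space (prob (B K)). \<forall>t \<in> {1..T K}.
             round_time elem_time (B K) t \<omega>
               \<le> real K powr (1 - e K + g K) + scan_time (B K) t \<omega>))) \<and>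
    (\<exists>g. g \<in> o(\<lambda>_. 1) \<and>
          (\<forall>\<^sub>F K in sequentially. \<forall>\<omega> \<in> space (prob (B K)).
             initialization_time (B K) \<omega> \<le> real K powr (1 + g K)))"
proof -
  have pos: "d K \<ge> 1" "T K \<ge> 1" if "K \<ge> 1" for K
    using bandit[OF that] parameters[OF that] by (auto simp: linear_bandit_def)
  have run: "bandit_algorithm (B K) (D K) C_change" if "K \<ge> 1" for K
    using bandit[OF that] algorithm[OF that] parameters[OF that] \<eta> \<delta> by unfold_locales auto
  have regret: "measure (prob (B K)) {\<omega> \<in> space (prob (B K)).
      regret (B K) \<omega> \<le> regret_bound (d K) (T K) \<delta> (\<eta> (T K)) p b b'} \<ge> 1 - \<delta>" if K: "K \<ge> 1" for K
  proof -
    interpret bandit_algorithm "B K" "D K" C_change by (rule run[OF K])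
    interpret thompson_sampling "B K" "D K" C_change p b b'
      using distribution[OF K] parameters[OF K] constants by unfold_locales auto
    show ?thesis using regret_bound_whp parameters[OF K] by simp
  qed
  \<comment> \<open>A bound for the number of copies in all solvers together: at most
    \<open>2 * d / \<eta>\<close> solvers with at most \<open>3 * d * ln K\<close> copies
    each.\<close>
  define F where "F K = 6 * real (d K) ^ 2 * (1 / \<eta> (T K)) * ln (real K)" for K
  define e where "e K = (\<eta> (T K) / (18 * d K))\<^sup>2" for K
  \<comment> \<open>Measured in units of \<open>d K\<close> times the time of one lookup, elementary
    work and updates count 1 each, and the lookups count \<open>3 * (ln K)\<^sup>2\<close>: at most
    \<open>ln K\<close> probes, each asking at most \<open>3 * d * ln K\<close> copies.\<close>
  define g where "g K = g_query K + ln (2 + 3 * (ln (real K))\<^sup>2) / ln (real K)" for K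
  \<comment> \<open>With one eighth, three times \<open>ln d\<close> and twice
    \<open>ln (1 / \<eta>)\<close>, plus one \<open>ln K\<close> for the factor \<open>K\<close> and
    one for the constants, stay below \<open>3 * ln K\<close>.\<close>
  have le_log: "\<forall>\<^sub>F K in sequentially. ln (real (d K)) \<le> 1/8 * ln (real K)"
    "\<forall>\<^sub>F K in sequentially. ln (1 / \<eta> (T K)) \<le> 1/8 * ln (real K)"
    by (rule eventually_le_of_smallo_ln[OF dimension_growth] eventually_le_of_smallo_ln[OF moderate_accuracy]; simp)+
  have sizes: "\<forall>\<^sub>F K in sequentially. copies (B K) \<le> d K * (3 * ln (real K)) \<and>
      num_solvers (B K) * real (copies (B K)) \<le> F K \<and>
      1 + 2 * ln (num_solvers (B K) + 1) \<le> ln (real K)"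
    using le_log eventually_const_le_ln[of "ln 2 + ln (1 / \<delta>) + 1"]
      eventually_const_le_ln[of "2 * (1 + 2 * ln 3)"] eventually_ge_at_top[of 2]
  proof eventually_elim
    case (elim K)
    then have K: "K \<ge> 1" by simp
    interpret bandit_algorithm "B K" "D K" C_change by (rule run[OF K])
    note par = parameters[OF K]
    let ?d = "real (d K)" and ?h = "\<eta> (T K)"
    have L: "0 \<le> ln (real K)" using K by simp
    have d: "?d \<ge> 1" and h: "0 < ?h" "?h < 1" using pos[OF K] \<eta> by auto
    have "ln (2 * real K * ?d ^ 3 / (?h\<^sup>2 * \<delta>)) = ln 2 + ln (real K) + 3 * ln ?d + 2 * ln (1 / ?h) + ln (1 / \<delta>)"
      using K d h \<delta> by (simp add: ln_div ln_mult ln_realpow)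
    then have "ln (2 * real K * ?d ^ 3 / (?h\<^sup>2 * \<delta>)) + 1 \<le> 3 * ln (real K)" using elim L by linarith
    then have "?d * (ln (2 * real K * ?d ^ 3 / (?h\<^sup>2 * \<delta>)) + 1) \<le> ?d * (3 * ln (real K))"
      by (rule mult_left_mono) simp
    moreover have "copies (B K) \<le> ?d * (ln (2 * real K * ?d ^ 3 / (?h\<^sup>2 * \<delta>)) + 1)"
      using copies_le par by simp
    ultimately have c: "copies (B K) \<le> ?d * (3 * ln (real K))" by linarith
    have N: "num_solvers (B K) \<le> 2 * ?d / ?h" using num_solvers(3) par by simp
    have "num_solvers (B K) * real (copies (B K)) \<le> (2 * ?d / ?h) * (?d * (3 * ln (real K)))"
      using N c d h by (intro mult_mono) auto
    also have "\<dots> = F K" using h by (simp add: F_def power2_eq_square)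
    finally have NF: "num_solvers (B K) * real (copies (B K)) \<le> F K" .
    have "1 * 1 \<le> ?d * (1 / ?h)" using d h by (intro mult_mono) auto
    then have "num_solvers (B K) + 1 \<le> 3 * ?d * (1 / ?h)" using N by simp
    then have "ln (num_solvers (B K) + 1) \<le> ln (3 * ?d * (1 / ?h))" by (subst ln_le_cancel_iff) (use d h in auto)
    also have "\<dots> = ln 3 + ln ?d + ln (1 / ?h)" using d h by (simp add: ln_mult ln_div)
    finally have "ln (num_solvers (B K) + 1) \<le> ln 3 + ln ?d + ln (1 / ?h)" .
    moreover have "1 + 2 * (ln 3 + ln ?d + ln (1 / ?h)) \<le> ln (real K)" using elim(1,2,4) by (simp add: ring_distribs)
    ultimately have "1 + 2 * ln (num_solvers (B K) + 1) \<le> ln (real K)" by argo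
    with c NF show ?case by blast
  qed
  have lnF: "(\<lambda>K. ln (F K)) \<in> o(\<lambda>K. ln (real K))"
  proof -
    have "(\<lambda>K. ln 6 :: real) \<in> o(\<lambda>K. ln (real K))" "(\<lambda>K. ln (ln (real K))) \<in> o(\<lambda>K. ln (real K))"
      by real_asymp+
    then have "(\<lambda>K. ln 6 + 2 * ln (real (d K)) + ln (1 / \<eta> (T K)) + ln (ln (real K))) \<in> o(\<lambda>K. ln (real K))"
      by (intro sum_in_smallo(1) moderate_accuracy dimension_growth[THEN landau_o.small.cmult_in_iff[THEN iffD2, rotated]]) auto
    moreover have "\<forall>\<^sub>F K in sequentially. ln 6 + 2 * ln (real (d K)) + ln (1 / \<eta> (T K)) + ln (ln (real K)) = ln (F K)"
      using eventually_ge_at_top[of 2]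
    proof eventually_elim
      case (elim K)
      then have "ln (real K) > 0" "d K \<ge> 1" using pos[of K] by auto
      then show ?case using \<eta>[of "T K"] by (simp add: F_def ln_mult ln_div ln_realpow)
    qed
    ultimately show ?thesis by (simp cong: landau_o.small.in_cong)
  qed
  have F_le: "\<forall>\<^sub>F K in sequentially. F K \<le> real K powr (1/8)"
    using eventually_le_of_smallo_ln[OF lnF, of "1/8", simplified] eventually_ge_at_top[of 2]
  proof eventually_elim
    case (elim K)
    then have "ln (real K) > 0" "d K \<ge> 1" using pos[of K] by auto
    then have "F K > 0" using \<eta>[of "T K"] by (simp add: F_def)
    have "exp (ln (F K)) \<le> exp (1/8 * ln (real K))" using elim by simp
    then show ?case using \<open>F K > 0\<close> elim by (simp add: powr_def)
  qed
  obtain A m where A: "\<And>n t. n \<ge> 1 \<Longrightarrow> t \<ge> 1 \<Longrightarrow> elem_time n t \<le> A * (real n * real t) ^ m"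
    using elementary_work by blast
  \<comment> \<open>Chosen so that the product of \<open>d\<close> and \<open>t\<close>, each at
    most \<open>K powr c\<close>, raised to the power \<open>m\<close> costs at most
    \<open>K powr (1/4)\<close>; the constant \<open>A\<close> takes another quarter.\<close>
  define c :: real where "c = 1 / (8 * (m + 1))"
  have c: "c > 0" "m * c \<le> 1/8" by (auto simp: c_def field_simps)
  have C_le: "\<forall>\<^sub>F K in sequentially. real C_change \<le> real K powr (1/8)"
    and A_le: "\<forall>\<^sub>F K in sequentially. \<bar>A\<bar> \<le> real K powr (1/4)"
    by (rule eventually_const_le_powr; simp)+
  have powr_le: "\<forall>\<^sub>F K in sequentially. real (d K) \<le> real K powr c"
    "\<forall>\<^sub>F K in sequentially. real (T K) \<le> real K powr c"
    using eventually_le_powr_of_smallo_ln[OF dimension_growth _ c(1)]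
      eventually_le_powr_of_smallo_ln[OF moderate_horizon _ c(1)] pos by (auto simp: Suc_le_eq)
  have elem: "\<forall>\<^sub>F K in sequentially. \<forall>t\<in>{1..T K}. elem_time (d K) t \<le> real K powr (1/2)"
    using powr_le A_le eventually_ge_at_top[of 1]
  proof eventually_elim
    case (elim K)
    show ?case
    proof
      fix t assume t: "t \<in> {1..T K}"
      have "elem_time (d K) t \<le> A * (real (d K) * real t) ^ m" using A pos[of K] elim t by auto
      also have "\<dots> \<le> \<bar>A\<bar> * (real (d K) * real t) ^ m" by (intro mult_right_mono) auto
      also have "\<dots> \<le> real K powr (1/4) * (real K powr c * real K powr c) ^ m"
      proof (intro mult_mono power_mono)
        show "real t \<le> real K powr c" using t elim by simp
      qed (use elim in auto)
      also have "\<dots> = real K powr (1/4 + 2 * (m * c))"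
        using elim by (simp add: powr_add[symmetric] powr_realpow[symmetric] powr_powr mult_ac)
      also have "\<dots> \<le> real K powr (1/2)" using c elim by (intro powr_mono) auto
      finally show "elem_time (d K) t \<le> real K powr (1/2)" .
    qed
  qed
  have small: "\<forall>\<^sub>F K in sequentially. g_query K \<ge> -1/8 \<and> g_modify K \<le> 1/8"
  proof -
    have "(\<lambda>K. ln (real K) powr (-0.45)) \<in> o(\<lambda>_. 1 :: real)" by real_asymp
    then have "g_query \<in> o(\<lambda>_. 1)" by (rule landau_o.small_trans[OF solver_exponents(3)])
    then have "\<forall>\<^sub>F K in sequentially. norm (g_query K) \<le> 1/8 * norm (1 :: real)"
      "\<forall>\<^sub>F K in sequentially. norm (g_modify K) \<le> 1/8 * norm (1 :: real)"
      using landau_o.smallD[of g_query _ "\<lambda>_. 1" "1/8"] landau_o.smallD[OF solver_exponents(2), of "1/8"] by simp_all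
    then show ?thesis by eventually_elim auto
  qed
  have round: "\<forall>\<^sub>F K in sequentially. \<forall>\<omega> \<in> space (prob (B K)). \<forall>t \<in> {1..T K}.
      round_time elem_time (B K) t \<omega> \<le> real (d K) * real K powr (1 - e K + g K) + scan_time (B K) t \<omega>"
    using sizes F_le elem small solver_times C_le
      eventually_ge_at_top[of 2]
  proof eventually_elim
    case (elim K)
    then have K: "K \<ge> 1" by simp
    interpret bandit_algorithm "B K" "D K" C_change by (rule run[OF K])
    note par = parameters[OF K]
    let ?L = "ln (real K)" and ?q = "real K powr (1 - e K + g_query K)"
    have d: "real (d K) \<ge> 1" and L: "?L > 0" using pos[OF K] elim by auto
    show ?case
    proof (intro ballI)
      fix \<omega> t assume \<omega>: "\<omega> \<in> space (prob (B K))" and t: "t \<in> {1..T K}"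
      obtain k :: nat where k: "real (num_solvers (B K)) + 1 \<le> 2 ^ k" "k \<le> 1 + 2 * ln (real (num_solvers (B K)) + 1)"
        using ex_power2_ge[of "real (num_solvers (B K)) + 1"] by auto
      have "real (num_solvers (B K) + 1) \<le> real (2 ^ k)" using k(1) by simp
      then have k': "num_solvers (B K) + 1 \<le> 2 ^ k" by (simp only: of_nat_le_iff)
      have kL: "k \<le> ?L" using k(2) elim by (simp add: add.commute)
      have "round_time elem_time (B K) t \<omega> \<le> elem_time (d K) t
          + num_solvers (B K) * (copies (B K) * (C_change * real K powr g_modify K))
          + k * (copies (B K) * ?q) + scan_time (B K) t \<omega>"
        using round_time_le[OF _ _ \<omega> _ k', of "real K powr (1 + g_build K)" "real K powr g_modify K" "g_query K" t]
          par t elim by (simp add: e_def)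
      moreover have "elem_time (d K) t \<le> real K powr (1/2)" using elim t by blast
      moreover have "num_solvers (B K) * (copies (B K) * (C_change * real K powr g_modify K)) \<le> real K powr (1/2)"
      proof -
        have "num_solvers (B K) * (copies (B K) * (C_change * real K powr g_modify K))
            = (num_solvers (B K) * real (copies (B K))) * (C_change * real K powr g_modify K)" by simp
        also have "\<dots> \<le> real K powr (1/8) * (real K powr (1/8) * real K powr (1/8))"
          using elim K by (intro mult_mono powr_mono) auto
        also have "\<dots> = real K powr (3/8)" by (simp add: powr_add[symmetric])
        also have "\<dots> \<le> real K powr (1/2)" using K by (intro powr_mono) auto
        finally show ?thesis .
      qed
      moreover have "k * (copies (B K) * ?q) \<le> ?L * ((d K * (3 * ?L)) * ?q)"
        using kL elim L by (intro mult_mono mult_right_mono) auto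
      \<comment> \<open>The exponent of a lookup is at least \<open>1/2\<close>, because
        \<open>e K\<close> is at most the square of \<open>1/18\<close> and \<open>g_query K\<close>
        is at least \<open>-1/8\<close>. Hence work of order \<open>K powr (1/2)\<close> is
        dominated.\<close>
      moreover have "real K powr (1/2) \<le> d K * ?q"
      proof -
        have "e K \<le> (1/18)\<^sup>2"
          unfolding e_def using \<eta>[of "T K"] d by (intro power_mono frac_le) (auto intro!: frac_le)
        then have "1/2 \<le> 1 - e K + g_query K" using elim by (simp add: power2_eq_square)
        then have "1 * real K powr (1/2) \<le> d K * ?q" using K d by (intro mult_mono powr_mono) auto
        then show ?thesis by simp
      qed
      moreover have "real K powr (1 - e K + g K) = ?q * (2 + 3 * ?L\<^sup>2)"
      proof -
        have "2 + 3 * ?L\<^sup>2 > 0" by (simp add: add_pos_nonneg)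
        then have "real K powr (ln (2 + 3 * ?L\<^sup>2) / ?L) = 2 + 3 * ?L\<^sup>2"
          using elim by (intro real_powr_ln_div) auto
        moreover have "1 - e K + g K = 1 - e K + g_query K + ln (2 + 3 * ?L\<^sup>2) / ?L" by (simp add: g_def)
        ultimately show ?thesis by (simp add: powr_add)
      qed
      ultimately show "round_time elem_time (B K) t \<omega> \<le> real (d K) * real K powr (1 - e K + g K) + scan_time (B K) t \<omega>"
        by (simp add: algebra_simps power2_eq_square)
    qed
  qed
  have g: "g \<in> o(\<lambda>K. ln (real K) powr (-0.45))"
  proof -
    have "(\<lambda>K. ln (2 + 3 * (ln (real K))\<^sup>2) / ln (real K)) \<in> o(\<lambda>K. ln (real K) powr (-0.45))" by real_asymp
    then show ?thesis unfolding g_def[abs_def] by (rule sum_in_smallo(1)[OF solver_exponents(3)])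
  qed
  have e: "e \<in> \<Theta>(\<lambda>K. (\<eta> (T K) / real (d K))\<^sup>2)"
  proof -
    have "e = (\<lambda>K. (1/18)\<^sup>2 * (\<eta> (T K) / real (d K))\<^sup>2)" by (auto simp: e_def power_divide power_mult_distrib)
    then show ?thesis by simp
  qed
  have bounded: "\<exists>e g. e \<in> \<Theta>(\<lambda>K. (\<eta> (T K))\<^sup>2) \<and> g \<in> o(\<lambda>K. ln (real K) powr (-0.45)) \<and>
          (\<forall>\<^sub>F K in sequentially. \<forall>\<omega> \<in> space (prob (B K)). \<forall>t \<in> {1..T K}.
             round_time elem_time (B K) t \<omega> \<le> real K powr (1 - e K + g K) + scan_time (B K) t \<omega>)"
    if n: "\<And>K. d K \<le> n" for n
  proof (intro exI conjI)
    have n1: "n \<ge> 1" using n[of 1] pos[of 1] by simp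
    show "e \<in> \<Theta>(\<lambda>K. (\<eta> (T K))\<^sup>2)"
    proof (rule bigthetaI)
      show "e \<in> O(\<lambda>K. (\<eta> (T K))\<^sup>2)"
      proof (rule landau_o.bigI[of 1])
        show "\<forall>\<^sub>F K in sequentially. norm (e K) \<le> 1 * norm ((\<eta> (T K))\<^sup>2)"
          using eventually_ge_at_top[of 1]
        proof eventually_elim
          case (elim K)
          have "\<eta> (T K) / (18 * d K) \<le> \<eta> (T K) / 1" using pos[OF elim] \<eta>[of "T K"] by (intro divide_left_mono) auto
          then have "e K \<le> (\<eta> (T K))\<^sup>2" unfolding e_def using \<eta>[of "T K"] by (intro power_mono) auto
          then show ?case by (simp add: e_def)
        qed
      qed simp
      show "e \<in> \<Omega>(\<lambda>K. (\<eta> (T K))\<^sup>2)"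
      proof (rule landau_omega.bigI[of "(1 / (18 * n))\<^sup>2"])
        show "\<forall>\<^sub>F K in sequentially. (1 / (18 * n))\<^sup>2 * norm ((\<eta> (T K))\<^sup>2) \<le> norm (e K)"
          using eventually_ge_at_top[of 1]
        proof eventually_elim
          case (elim K)
          have "\<eta> (T K) / (18 * n) \<le> \<eta> (T K) / (18 * d K)"
            using pos[OF elim] \<eta>[of "T K"] n[of K] by (intro divide_left_mono) auto
          then have "(\<eta> (T K) / (18 * n))\<^sup>2 \<le> e K" unfolding e_def using \<eta>[of "T K"] by (intro power_mono) auto
          then show ?case by (simp add: e_def power_divide)
        qed
      qed (use n1 in simp)
    qed
    \<comment> \<open>The constant bound \<open>n\<close> on the dimension enters the exponent as
      \<open>ln n / ln K\<close>, which is small enough.\<close>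
    show "(\<lambda>K. g K + ln (real n) / ln (real K)) \<in> o(\<lambda>K. ln (real K) powr (-0.45))"
      by (rule sum_in_smallo(1)[OF g]) real_asymp
    show "\<forall>\<^sub>F K in sequentially. \<forall>\<omega> \<in> space (prob (B K)). \<forall>t \<in> {1..T K}.
        round_time elem_time (B K) t \<omega> \<le> real K powr (1 - e K + (g K + ln (real n) / ln (real K))) + scan_time (B K) t \<omega>"
      using round eventually_ge_at_top[of 2]
    proof eventually_elim
      case (elim K)
      have "real K powr (1 - e K + (g K + ln (real n) / ln (real K))) = real n * real K powr (1 - e K + g K)"
        using n1 elim by (simp add: add.assoc[symmetric] powr_add[of _ _ "ln (real n) / ln (real K)"] real_powr_ln_div)
      moreover have "d K * real K powr (1 - e K + g K) \<le> real n * real K powr (1 - e K + g K)"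
        using n[of K] by (intro mult_right_mono) auto
      ultimately have "d K * real K powr (1 - e K + g K) + x
          \<le> real K powr (1 - e K + (g K + ln (real n) / ln (real K))) + x" for x by simp
      then show ?case using elim(1) order_trans by blast
    qed
  qed
  \<comment> \<open>Here the exponent only has to be \<open>1 + o(1)\<close>, so the whole number of
    copies, powers of the dimension included, is absorbed as \<open>ln (F K) / ln K\<close>.\<close>
  have init: "\<forall>\<^sub>F K in sequentially. \<forall>\<omega> \<in> space (prob (B K)).
      initialization_time (B K) \<omega> \<le> real K powr (1 + (g_build K + ln (F K) / ln (real K)))"
    using sizes solver_times eventually_ge_at_top[of 2]
  proof eventually_elim
    case (elim K)
    then have K: "K \<ge> 1" by simp
    interpret bandit_algorithm "B K" "D K" C_change by (rule run[OF K])
    note par = parameters[OF K]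
    have "F K > 0" using pos[OF K] elim \<eta>[of "T K"] by (simp add: F_def)
    then have eq: "real K powr (1 + (g_build K + ln (F K) / ln (real K))) = F K * real K powr (1 + g_build K)"
      using elim by (simp add: add.assoc[symmetric] powr_add[of _ _ "ln (F K) / ln (real K)"] real_powr_ln_div)
    show ?case
    proof
      fix \<omega> assume \<omega>: "\<omega> \<in> space (prob (B K))"
      have "initialization_time (B K) \<omega> \<le> num_solvers (B K) * (copies (B K) * real K powr (1 + g_build K))"
        using initialization_time_le[OF _ _ \<omega>, of "real K powr (1 + g_build K)" "real K powr g_modify K" "g_query K"]
          par elim by simp
      also have "\<dots> = (num_solvers (B K) * real (copies (B K))) * real K powr (1 + g_build K)" by simp
      also have "\<dots> \<le> F K * real K powr (1 + g_build K)" using elim by (intro mult_right_mono) auto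
      finally show "initialization_time (B K) \<omega> \<le> real K powr (1 + (g_build K + ln (F K) / ln (real K)))"
        unfolding eq .
    qed
  qed
  have g_init: "(\<lambda>K. g_build K + ln (F K) / ln (real K)) \<in> o(\<lambda>_. 1)"
  proof -
    have "(\<lambda>K. ln (F K) / ln (real K)) \<in> o(\<lambda>_. 1)"
      using smalloD_tendsto[OF lnF] by (intro smalloI_tendsto) simp_all
    then show ?thesis by (rule sum_in_smallo(1)[OF solver_exponents(1)])
  qed
  show ?thesis
  proof (intro conjI)
    show "\<exists>e g. e \<in> \<Theta>(\<lambda>K. (\<eta> (T K) / real (d K))\<^sup>2) \<and>
          g \<in> o(\<lambda>K. ln (real K) powr (-0.45)) \<and>
          (\<forall>\<^sub>F K in sequentially. \<forall>\<omega> \<in> space (prob (B K)). \<forall>t \<in> {1..T K}.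
             round_time elem_time (B K) t \<omega>
               \<le> real (d K) * real K powr (1 - e K + g K) + scan_time (B K) t \<omega>)"
      using e g round by blast
  qed (use regret bounded init g_init in blast)+
qed

end
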